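(* Let $A=(q,q^4;q^5)_\infty$, $B=(q^2,q^3;q^5)_\infty$, $E_1=(q;q)_\infty$ and $E_5=(q^5;q^5)_\infty$. Then, as formal power series in $q$ (equivalently, as analytic functions for $|q|<1$): \begin{align*} &\sum_{n\geq0}\big[NB_{2}(1,5,5n)-3NB_{2}(2,5,5n)+3NB_{2}(3,5,5n)-NB_{2}(4,5,5n)\big]q^n = 5q\frac{A\,E_5^2}{B^3},\\ &\sum_{n\geq0}\big[NB_{2}(1,5,5n+2)+2NB_{2}(2,5,5n+2)-2NB_{2}(3,5,5n+2)-NB_{2}(4,5,5n+2)\big]q^n = 5\frac{E_5^2}{A^2},\\ &NB_{2}(1,5,5n+3)+2NB_{2}(2,5,5n+3)-2NB_{2}(3,5,5n+3)-NB_{2}(4,5,5n+3)=0 \quad\text{for all } n\geq 0,\\ &\sum_{n\geq0}\big[NB_{2}(1,5,25n+23)-NB_{2}(4,5,25n+23)\big]q^n = 10\frac{E_5^5}{E_1^3},\\ &\sum_{n\geq0}\big[NB_{2}(2,5,25n+23)-NB_{2}(3,5,25n+23)\big]q^n = -5\frac{E_5^5}{E_1^3},\\ &\sum_{n\geq0}\big[NB_{2}(1,5,5n+4)+2NB_{2}(2,5,5n+4)-2NB_{2}(3,5,5n+4)-NB_{2}(4,5,5n+4)\big]q^n = 5\frac{E_5^2}{B^2}. \end{align*}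
   Context: Notation: $(a;q)_\infty=\prod_{n\ge0}(1-aq^n)$ and $(a_1,\dots,a_t;q)_\infty=(a_1;q)_\infty\cdots(a_t;q)_\infty$. For $k\ge2$, a $k$-colored partition of a nonnegative integer $n$ is a $k$-tuple $\pi=(\pi^{(1)},\dots,\pi^{(k)})$ of ordinary integer partitions with $|\pi^{(1)}|+\cdots+|\pi^{(k)}|=n$ (written $\pi\vdash n$); $\#(\pi^{(i)})$ denotes the number of parts of $\pi^{(i)}$. The generalized crank is $\mathrm{crank}_k(\pi)=\#(\pi^{(1)})-\#(\pi^{(2)})$. For integers $k\ge2$, $j\ge2$, $0\le m\le j-1$ and $n\ge0$, define $$NB_k(m,j,n)=\sum_{\pi\vdash n,\ \mathrm{crank}_k(\pi)\equiv m \pmod j}\#(\pi^{(1)}),$$ the total number of parts of $\pi^{(1)}$ over all $k$-colored partitions $\pi$ of $n$ whose crank is congruent to $m$ modulo $j$ (so $NB_k(m,j,0)=0$). *)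

theory Defs
  imports
    "HOL-Analysis.Analysis"
    "HOL-Computational_Algebra.Formal_Power_Series"
    "HOL-Library.Multiset"
    "HOL-Number_Theory.Cong"
begin

text \<open>
  The \<open>q\<close>-shifted factorial is taken in the ring of formal power series; the infinite
  product is the limit of the partial products in the \<open>X\<close>-adic metric. \<open>prodinf\<close> is
  unspecified if the product does not converge; see \<open>qpoch_inf_has_prod\<close> for the
  arguments of interest.
\<close>

definition qpoch_inf :: "complex fps \<Rightarrow> complex fps \<Rightarrow> complex fps" where
  "qpoch_inf a q = (\<Prod>n. 1 - a * q ^ n)"

definition qpochs_inf :: "complex fps list \<Rightarrow> complex fps \<Rightarrow> complex fps" where
  "qpochs_inf as q = (\<Prod>a\<leftarrow>as. qpoch_inf a q)"

text \<open>
  An integer partition is the multiset of its parts, which are positive. The colour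
  \<open>\<pi>\<^sup>(\<^sup>i\<^sup>)\<close> of a tuple is the list entry \<open>\<pi> ! (i - 1)\<close>.
\<close>

definition is_partition :: "nat multiset \<Rightarrow> bool" where
  "is_partition p \<longleftrightarrow> 0 \<notin># p"

definition colored_partitions :: "nat \<Rightarrow> nat \<Rightarrow> nat multiset list set" where
  "colored_partitions k n =
     {\<pi>. length \<pi> = k \<and> (\<forall>p\<in>set \<pi>. is_partition p) \<and> (\<Sum>p\<leftarrow>\<pi>. \<Sum>\<^sub># p) = n}"

definition crank :: "nat multiset list \<Rightarrow> int" where
  "crank \<pi> = int (size (\<pi> ! 0)) - int (size (\<pi> ! 1))"

text \<open>Meaningful for \<open>k \<ge> 2\<close>, \<open>j \<ge> 2\<close> and \<open>m \<le> j - 1\<close>.\<close>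

definition NB :: "nat \<Rightarrow> nat \<Rightarrow> nat \<Rightarrow> nat \<Rightarrow> nat" where
  "NB k m j n =
     (\<Sum>\<pi> | \<pi> \<in> colored_partitions k n \<and> [crank \<pi> = int m] (mod int j). size (\<pi> ! 0))"

lemma finite_colored_partitions: "finite (colored_partitions k n)"
proof -
  have size_le: "size p \<le> \<Sum>\<^sub># p" if "0 \<notin># p" for p :: "nat multiset"
    using that by (induction p) auto
  define P where "P = (\<Union>s\<le>n. {p :: nat multiset. size p = s \<and> set_mset p \<subseteq> {..n}})"
  have "finite P"
    unfolding P_def using finite_multisets_of_size[of "{..n}"]
    by (auto simp: multisets_of_size_def conj_commute)
  have "colored_partitions k n \<subseteq> {\<pi>. set \<pi> \<subseteq> P \<and> length \<pi> = k}"
  proof safe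
    fix \<pi> p assume \<pi>: "\<pi> \<in> colored_partitions k n" and p: "p \<in> set \<pi>"
    have "\<Sum>\<^sub># p \<le> n"
      using \<pi> p member_le_sum_list[of "\<Sum>\<^sub># p" "map sum_mset \<pi>"]
      by (auto simp: colored_partitions_def)
    moreover have "0 \<notin># p"
      using \<pi> p by (auto simp: colored_partitions_def is_partition_def)
    moreover have "x \<le> \<Sum>\<^sub># p" if "x \<in># p" for x
      using that by (metis sum_mset.remove le_add1)
    ultimately show "p \<in> P"
      using size_le[of p] by (force simp: P_def)
  qed (auto simp: colored_partitions_def)
  thus ?thesis
    using finite_lists_length_eq[OF \<open>finite P\<close>] finite_subset by blast
qed

lemma qpoch_inf_has_prod:
  assumes "i > 0" "d > 0"
  shows "(\<lambda>n. 1 - fps_X ^ i * (fps_X ^ d) ^ n) has_prod qpoch_inf (fps_X ^ i) (fps_X ^ d)"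
proof -
  define f :: "nat \<Rightarrow> complex fps" where "f = (\<lambda>n. 1 - fps_X ^ i * (fps_X ^ d) ^ n)"
  define P where
    "P = Abs_fps (\<lambda>n. \<Sum>X\<in>multisets_of_size {..n} n. \<Prod>i\<le>n. fps_nth (f i) (count X i))"
  have f_eq: "f n = 1 - fps_X ^ (i + d * n)" for n
    by (simp add: f_def power_add power_mult)
  have f_0: "fps_nth (f n) 0 = 1" for n
    using assms by (simp add: f_eq fps_X_power_nth)
  have nz: "f n \<noteq> 0" for n
    using f_0[of n] by force
  have sub: "n < subdegree (f k - 1)" if "k > n" for n k
  proof -
    have "k \<le> d * k"
      using assms by simp
    hence "n < i + d * k"
      using that by linarith
    thus ?thesis
      by (simp add: f_eq)
  qed
  have "(\<lambda>n. \<Prod>k\<le>n. f k) \<longlonglongrightarrow> P"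
    unfolding P_def using nz sub by (rule tendsto_prod_fps)
  moreover have "fps_nth P 0 = 1"
    by (simp add: P_def f_0)
  hence "P \<noteq> 0"
    by force
  ultimately have "f has_prod P"
    by (simp add: has_prod_def raw_has_prod_def)
  thus ?thesis
    using has_prod_unique[of f P] by (simp add: f_def qpoch_inf_def)
qed

end

theory Submission
  imports
    Defs
    "HOL-Computational_Algebra.Formal_Laurent_Series"
    "HOL-Computational_Algebra.Polynomial"
begin

text \<open>
  Let $\zeta$ be a primitive fifth root of unity and let $X_1, X_2$ be the Lambert series whose
  coefficient at $q^n$ is the number of divisors of $n$ that are $\equiv 1$ (resp. $2$) minus the
  number of those that are $\equiv 4$ (resp. $3$) modulo 5. Evaluating the generating function of
  the numbers of parts of $\pi^{(1)}$, weighted by $\zeta^{\mathrm{crank}}$, at $\zeta$ and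
  $\zeta^{-1}$ shows that $(\zeta - \zeta^4)(N_1 - N_4) + (\zeta^2 - \zeta^3)(N_2 - N_3)$ equals
  $((\zeta - \zeta^4) X_1 + (\zeta^2 - \zeta^3) X_2) / (\zeta q, \zeta^{-1} q; q)_\infty$, where
  $N_m$ is the generating function of $NB_2(m, 5, n)$. The Jacobi triple product gives
  $1 / (\zeta q, \zeta^{-1} q; q)_\infty = 1/a + (\zeta + \zeta^{-1}) q / b$ with $a = A(q^5)$ and
  $b = B(q^5)$, so that $N_1 - N_4 = X_1 / a + q X_2 / b$ and
  $N_2 - N_3 = X_2 / a + q (X_1 - X_2) / b$.

  The nonzero sections of $X_1$ and $X_2$ modulo 5 are instances of Kronecker's series
  $\sum_k x^k / (1 - c q^k)$, which are products, and the sections modulo 0 are $X_1$ and $X_2$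
  again. Comparing sections yields all claims, given $X_1 - 3 X_2 = q A^2 E_5^2 / B^3$ (again a
  partial fraction decomposition of a product) for the first one, and the section of $1/E_1$ at
  the exponents $5n + 4$ for the two claims modulo 25. The latter follows from
  $E_1 = E_{25} (b/a - q - q^2 a/b)$ by taking the norm with respect to $q \mapsto \zeta q$.
\<close>

section \<open>Formal power series as a topological ring, infinite products\<close>

text \<open>No analysis enters: every infinite identity is the $q$-adic limit of a finite one. The
  finite versions contain negative powers of $q$, so they are stated for elements of an arbitrary
  field, applied to the Laurent series \<open>fls_X\<close> and pulled back to power series, where
  each coefficient is eventually constant.

  The parts that multiply $z - z^4$ and $z^2 - z^3$ are separated without any linear independence
  over the rationals: replacing $z$ by $z^2$ yields a second linear equation, whose determinant with
  the first is 5.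

  The integer weights in the claims come from the sections of $D_1 = N_1 - N_4$ and $D_2 = N_2 -
  N_3$. At $5n+2$, $5n+3$ and $5n+4$ these are multiples of a common product with ratios 1 : 2, 2 :
  -1 and -1 : 3, so $D_1 + 2 D_2$ has the factors 5, 0 and 5. At $5n$ the Lambert series survive,
  and $D_1 - 3 D_2$ is the combination in which they form a product. The claims modulo 25 take a
  further section of the product at $5n+3$, which is $E_5^3 / E_1$.\<close>

instance fps :: (ab_group_add) topological_ab_group_add
proof
  fix a b :: "'a fps"
  show "((\<lambda>x. fst x + snd x) \<longlongrightarrow> a + b) (nhds a \<times>\<^sub>F nhds b)"
  proof (rule tendsto_fpsI)
    fix n
    have "eventually (\<lambda>x. fps_nth (fst x) n = fps_nth a n \<and> fps_nth (snd x) n = fps_nth b n)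
            (nhds a \<times>\<^sub>F nhds b)"
      using eventually_compose_filterlim[OF eventually_fps_nth_eq_nhds_fps_strong[of n a] filterlim_fst]
        eventually_compose_filterlim[OF eventually_fps_nth_eq_nhds_fps_strong[of n b] filterlim_snd]
      by eventually_elim auto
    thus "eventually (\<lambda>x. fps_nth (fst x + snd x) n = fps_nth (a + b) n) (nhds a \<times>\<^sub>F nhds b)"
      by eventually_elim auto
  qed
  show "(uminus \<longlongrightarrow> - a) (nhds a)"
  proof (rule tendsto_fpsI)
    fix n
    show "eventually (\<lambda>x. fps_nth (- x) n = fps_nth (- a) n) (nhds a)"
      using eventually_fps_nth_eq_nhds_fps_strong[of n a] by eventually_elim auto
  qed
qed

text \<open>Coefficient \<open>n\<close> of a product involves only the coefficients up to
  \<open>n\<close> of its factors, and near the limit these agree with those of the limit. The two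
  instances give access to \<open>tendsto_mult\<close> and to the algebraic rules for
  \<open>has_sum\<close>.\<close>

instance fps :: (ring) topological_semigroup_mult
proof
  fix a b :: "'a fps"
  show "((\<lambda>x. fst x * snd x) \<longlongrightarrow> a * b) (nhds a \<times>\<^sub>F nhds b)"
  proof (rule tendsto_fpsI)
    fix n
    have "eventually (\<lambda>x. (\<forall>k\<le>n. fps_nth (fst x) k = fps_nth a k) \<and> (\<forall>k\<le>n. fps_nth (snd x) k = fps_nth b k))
            (nhds a \<times>\<^sub>F nhds b)"
      using eventually_compose_filterlim[OF eventually_fps_nth_eq_nhds_fps_strong[of n a] filterlim_fst]
        eventually_compose_filterlim[OF eventually_fps_nth_eq_nhds_fps_strong[of n b] filterlim_snd]
      by eventually_elim auto
    thus "eventually (\<lambda>x. fps_nth (fst x * snd x) n = fps_nth (a * b) n) (nhds a \<times>\<^sub>F nhds b)"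
      by eventually_elim (auto simp: fps_mult_nth)
  qed
qed


lemma fps_nth_prod_lessThan_stable:
  fixes f :: "nat \<Rightarrow> 'a :: comm_ring_1 fps"
  assumes "\<And>k m. m \<le> k \<Longrightarrow> fps_nth (f k) m = fps_nth 1 m" and "n > m"
  shows "fps_nth (\<Prod>k<n. f k) m = fps_nth (\<Prod>k<Suc m. f k) m"
  using \<open>n > m\<close>
proof (induction n)
  case (Suc n)
  show ?case
  proof (cases "n = m")
    case False
    hence "n > m" using Suc.prems by simp
    have "(\<Prod>k<Suc n. f k) = (\<Prod>k<n. f k) + (\<Prod>k<n. f k) * (f n - 1)"
      by (simp add: algebra_simps)
    moreover have "fps_nth ((\<Prod>k<n. f k) * (f n - 1)) m = 0"
      unfolding fps_mult_nth by (intro sum.neutral) (use assms(1) \<open>n > m\<close> in auto)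
    ultimately have "fps_nth (\<Prod>k<Suc n. f k) m = fps_nth (\<Prod>k<n. f k) m"
      by simp
    thus ?thesis using Suc.IH \<open>n > m\<close> by simp
  qed auto
qed auto

text \<open>\<open>has_prod\<close> demands a nonzero limit. All factors have constant coefficient
  1, hence so has the limit \<open>P\<close>, which is assembled from the coefficients at which the
  partial products have become stable.\<close>

lemma fps_prodinf_LIMSEQ:
  fixes f :: "nat \<Rightarrow> complex fps"
  assumes f: "\<And>k m. m \<le> k \<Longrightarrow> fps_nth (f k) m = fps_nth 1 m"
  shows "(\<lambda>n. \<Prod>k<n. f k) \<longlonglongrightarrow> (\<Prod>k. f k)"
proof -
  define P where "P = Abs_fps (\<lambda>m. fps_nth (\<Prod>k<Suc m. f k) m)"
  have lim: "(\<lambda>n. \<Prod>k<n. f k) \<longlonglongrightarrow> P"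
  proof (rule tendsto_fpsI)
    fix m
    show "\<forall>\<^sub>F n in sequentially. fps_nth (\<Prod>k<n. f k) m = fps_nth P m"
      using eventually_gt_at_top[of m]
      by eventually_elim (use fps_nth_prod_lessThan_stable[of f, OF f] in \<open>auto simp: P_def\<close>)
  qed
  have "fps_nth P 0 = 1" by (simp add: P_def f)
  hence "P \<noteq> 0" by force
  moreover have "(\<lambda>n. \<Prod>k\<le>n. f k) \<longlonglongrightarrow> P"
    using LIMSEQ_Suc[OF lim] by (simp add: lessThan_Suc_atMost)
  ultimately have "f has_prod P" by (simp add: has_prod_def raw_has_prod_def)
  thus ?thesis using lim has_prod_unique by blast
qed

section \<open>The products $(c q^i; q^d)$, infinite and finite\<close>

definition qp :: "complex \<Rightarrow> nat \<Rightarrow> nat \<Rightarrow> complex fps" where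
  "qp c i d = qpoch_inf (fps_const c * fps_X ^ i) (fps_X ^ d)"

definition qpn :: "complex \<Rightarrow> nat \<Rightarrow> nat \<Rightarrow> nat \<Rightarrow> complex fps" where
  "qpn c i d n = (\<Prod>k<n. 1 - fps_const c * fps_X ^ (i + d * k))"

lemma qpn_0 [simp]: "qpn c i d 0 = 1"
  and qpn_Suc: "qpn c i d (Suc n) = qpn c i d n * (1 - fps_const c * fps_X ^ (i + d * n))"
  by (simp_all add: qpn_def)

lemma qpn_LIMSEQ:
  assumes "i > 0" "d > 0"
  shows "qpn c i d \<longlonglongrightarrow> qp c i d"
proof -
  have "qp c i d = (\<Prod>k. 1 - fps_const c * fps_X ^ (i + d * k))"
    unfolding qp_def qpoch_inf_def by (simp add: power_add power_mult mult.assoc)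
  moreover have "qpn c i d = (\<lambda>n. \<Prod>k<n. 1 - fps_const c * fps_X ^ (i + d * k))"
    by (simp add: qpn_def fun_eq_iff)
  moreover have "fps_nth (1 - fps_const c * fps_X ^ (i + d * k)) m = fps_nth 1 m" if "m \<le> k" for k m
  proof -
    have "k \<le> d * k" using assms by simp
    hence "m \<noteq> i + d * k" using that assms by linarith
    thus ?thesis by (simp add: fps_mult_left_const_nth)
  qed
  ultimately show ?thesis using fps_prodinf_LIMSEQ by simp
qed

lemma filterlim_nat_int_add:
  "filterlim (\<lambda>n. nat (int n + j)) at_top sequentially"
  unfolding filterlim_at_top
proof
  fix Z show "eventually (\<lambda>n. Z \<le> nat (int n + j)) sequentially"
    using eventually_ge_at_top[of "nat (int Z - j)"] by eventually_elim linarith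
qed

text \<open>In the finite identities below, the summation index \<open>j\<close> is an integer and
  the partial products have lengths such as $n - j$ and $n + j$. A fixed offset disappears in the
  limit, and the truncation by \<open>nat\<close> concerns finitely many \<open>n\<close>
  only.\<close>

lemma qpn_nat_LIMSEQ:
  assumes "i > 0" "d > 0"
  shows "(\<lambda>n. qpn c i d (nat (int n + j))) \<longlonglongrightarrow> qp c i d"
    and "(\<lambda>n. qpn c i d (nat (int n - j))) \<longlonglongrightarrow> qp c i d"
    and "(\<lambda>n. qpn c i d (n + a)) \<longlonglongrightarrow> qp c i d"
proof -
  show *: "(\<lambda>n. qpn c i d (nat (int n + j))) \<longlonglongrightarrow> qp c i d" for j
    using filterlim_compose[OF qpn_LIMSEQ[OF assms] filterlim_nat_int_add] .
  show "(\<lambda>n. qpn c i d (nat (int n - j))) \<longlonglongrightarrow> qp c i d"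
    using *[of "- j"] by simp
  show "(\<lambda>n. qpn c i d (n + a)) \<longlonglongrightarrow> qp c i d"
    using LIMSEQ_ignore_initial_segment[OF qpn_LIMSEQ[OF assms]] .
qed

lemma qpn_mult_LIMSEQ:
  assumes "i > 0" "d > 0" "e > 0"
  shows "(\<lambda>n. qpn c i d (e * n)) \<longlonglongrightarrow> qp c i d"
  using LIMSEQ_subseq_LIMSEQ[OF qpn_LIMSEQ[OF assms(1,2)], of "\<lambda>n. e * n"] assms
  by (simp add: o_def strict_mono_def)

lemma qpn_nth_0 [simp]: "i > 0 \<Longrightarrow> fps_nth (qpn c i d n) 0 = 1"
  by (induction n) (auto simp: qpn_Suc)

lemma fps_nth_LIMSEQ_const:
  fixes f :: "nat \<Rightarrow> 'a :: group_add fps"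
  assumes "f \<longlonglongrightarrow> L" "\<And>n. fps_nth (f n) m = c"
  shows "fps_nth L m = c"
proof -
  have "eventually (\<lambda>n. fps_nth (f n) m = fps_nth L m) sequentially"
    using assms(1) by (auto simp: tendsto_fps_iff)
  thus ?thesis using assms(2) by (auto simp: eventually_sequentially)
qed

lemma qp_nth_0 [simp]:
  assumes "i > 0" "d > 0" shows "fps_nth (qp c i d) 0 = 1"
  using fps_nth_LIMSEQ_const[OF qpn_LIMSEQ[OF assms]] assms by simp

lemma qp_nonzero [simp]:
  assumes "i > 0" "d > 0" shows "qp c i d \<noteq> 0"
  using qp_nth_0[OF assms, of c] by force

text \<open>A formal counterpart of Tannery's theorem: locally finite families need no dominating bound.\<close>

lemma fps_has_sum_LIMSEQ:
  fixes t :: "'b \<Rightarrow> complex fps"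
  assumes L: "F \<longlonglongrightarrow> L"
    and F: "eventually (\<lambda>n. F n = (\<Sum>j\<in>I n. t j * u n j)) sequentially"
    and fin: "\<And>n. finite (I n)" and sub: "\<And>n. I n \<subseteq> J"
    and I: "\<And>j. j \<in> J \<Longrightarrow> eventually (\<lambda>n. j \<in> I n) sequentially"
    and t: "\<And>m. finite {j\<in>J. fps_nth (t j) m \<noteq> 0}"
    and u: "\<And>j. j \<in> J \<Longrightarrow> (\<lambda>n. u n j) \<longlonglongrightarrow> U"
  shows "((\<lambda>j. t j * U) has_sum L) J"
proof (rule has_sum_fpsI)
  fix m
  \<comment> \<open>Outside \<open>A\<close> the coefficients of \<open>t j\<close> up to
    \<open>m\<close> vanish, and so do those of its product with any series. Coefficient
    \<open>m\<close> of every sum that occurs is therefore a sum over one fixed finite set.\<close>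
  define A where "A = (\<Union>k\<le>m. {j\<in>J. fps_nth (t j) k \<noteq> 0})"
  have A: "finite A" "A \<subseteq> J" using t by (auto simp: A_def)
  have nz: "fps_nth (t j * v) m = 0" if "j \<in> J - A" for j v
    unfolding fps_mult_nth using that by (intro sum.neutral) (auto simp: A_def)
  have sub': "{j\<in>J. fps_nth (t j * U) m \<noteq> 0} \<subseteq> A" using nz by blast
  show "finite {j\<in>J. fps_nth (t j * U) m \<noteq> 0}" using sub' A finite_subset by blast
  have "eventually (\<lambda>n. \<forall>j\<in>A. j \<in> I n) sequentially"
    using A I by (intro eventually_ball_finite) auto
  moreover have "eventually (\<lambda>n. \<forall>j\<in>A. fps_nth (t j * u n j) m = fps_nth (t j * U) m) sequentially"
  proof (intro eventually_ball_finite ballI A)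
    fix j assume "j \<in> A"
    hence "(\<lambda>n. t j * u n j) \<longlonglongrightarrow> t j * U" using u A by (intro tendsto_mult) auto
    thus "eventually (\<lambda>n. fps_nth (t j * u n j) m = fps_nth (t j * U) m) sequentially"
      by (simp add: tendsto_fps_iff)
  qed
  moreover have "eventually (\<lambda>n. fps_nth (F n) m = fps_nth L m) sequentially"
    using L by (simp add: tendsto_fps_iff)
  ultimately have "eventually (\<lambda>n. fps_nth L m = (\<Sum>j\<in>A. fps_nth (t j * U) m)) sequentially"
    using F
  proof eventually_elim
    case (elim n)
    have "fps_nth L m = (\<Sum>j\<in>I n. fps_nth (t j * u n j) m)"
      using elim by (simp add: fps_sum_nth)
    also have "\<dots> = (\<Sum>j\<in>A. fps_nth (t j * u n j) m)"
      by (rule sum.mono_neutral_right) (use elim fin sub nz in blast)+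
    finally show ?case using elim by simp
  qed
  hence "fps_nth L m = (\<Sum>j\<in>A. fps_nth (t j * U) m)"
    by (auto simp: eventually_sequentially)
  also have "\<dots> = (\<Sum>j | j \<in> J \<and> fps_nth (t j * U) m \<noteq> 0. fps_nth (t j * U) m)"
    by (rule sum.mono_neutral_right) (use A sub' in auto)
  finally show "fps_nth L m = \<dots>" .
qed

section \<open>The Jacobi triple product\<close>

definition qfac :: "'a :: field \<Rightarrow> nat \<Rightarrow> 'a" where
  "qfac p m = (\<Prod>k<m. 1 - p ^ Suc k)"

definition inv_qfac :: "'a :: field \<Rightarrow> int \<Rightarrow> 'a" where
  "inv_qfac p m = (if m < 0 then 0 else 1 / qfac p (nat m))"

text \<open>Extending $1/(p;p)_m$ by 0 to negative \<open>m\<close> keeps the recurrence valid on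
  all integers: at $m = -1$ the factor $1 - p^0$ vanishes, and below that both sides do.\<close>

lemma inv_qfac_rec:
  fixes p :: "'a :: field"
  assumes "\<And>k. k > 0 \<Longrightarrow> p ^ k \<noteq> 1"
  shows "inv_qfac p m = (1 - p powi (m + 1)) * inv_qfac p (m + 1)"
proof -
  consider "m < -1" | "m = -1" | "m \<ge> 0" by linarith
  thus ?thesis
  proof cases
    case 3
    then obtain n where n: "m = int n" using nonneg_int_cases by blast
    have "p powi (m + 1) = p ^ Suc n"
      using n by (metis of_nat_Suc power_int_of_nat add.commute)
    moreover have "nat (m + 1) = Suc n" "nat m = n" using n by auto
    moreover have "1 - p ^ Suc n \<noteq> 0" using assms[of "Suc n"] by (simp del: power_Suc)
    ultimately show ?thesis
      using 3 by (simp add: inv_qfac_def qfac_def del: power_Suc)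
  qed (auto simp: inv_qfac_def)
qed

text \<open>
  The weights are Gaussian binomials $2n \choose n+j$, written such that they vanish for
  $|j| > n$ and the recurrence in $n$ needs no case distinction at the boundary.
\<close>

lemma finite_jacobi_triple_product:
  fixes x y p :: "'a :: field"
  assumes p: "p = x * y" and xy: "x \<noteq> 0" "y \<noteq> 0" and np: "\<And>k. k > 0 \<Longrightarrow> p ^ k \<noteq> 1"
    and "n \<le> M"
  shows "(\<Prod>k<n. (1 - x * p ^ k) * (1 - y * p ^ k)) =
    (\<Sum>j\<in>{-int M..int M}. (-1) powi j * x powi (j * (j + 1) div 2) * y powi (j * (j - 1) div 2) *
       (qfac p (2 * n) * inv_qfac p (int n - j) * inv_qfac p (int n + j)))"
  using \<open>n \<le> M\<close>
proof (induction n)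
  case 0
  have "(\<Sum>j\<in>{-int M..int M}. (-1) powi j * x powi (j * (j + 1) div 2) * y powi (j * (j - 1) div 2) *
       (qfac p (2 * 0) * inv_qfac p (int 0 - j) * inv_qfac p (int 0 + j))) =
      (\<Sum>j\<in>{0::int}. (-1) powi j * x powi (j * (j + 1) div 2) * y powi (j * (j - 1) div 2) *
       (qfac p (2 * 0) * inv_qfac p (int 0 - j) * inv_qfac p (int 0 + j)))"
    by (rule sum.mono_neutral_right) (auto simp: inv_qfac_def)
  thus ?case by (simp add: inv_qfac_def qfac_def)
next
  case (Suc n)
  define e where "e = (\<lambda>j. (-1) powi j * x powi (j * (j + 1) div 2) * y powi (j * (j - 1) div 2))"
  define b where "b = (\<lambda>n j. qfac p (2 * n) * inv_qfac p (int n - j) * inv_qfac p (int n + j))"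
  have p0: "p \<noteq> 0" using p xy by simp
  have e_Suc: "e (j + 1) = - e j * x * p powi j" for j
  proof -
    have "(j + 1) * (j + 1 + 1) div 2 = j * (j + 1) div 2 + (j + 1)"
      using div_mult_self2[of 2 "j * (j + 1)" "j + 1"] by (simp add: algebra_simps)
    moreover have "(j + 1) * (j + 1 - 1) div 2 = j * (j - 1) div 2 + j"
      using div_mult_self2[of 2 "j * (j - 1)" "j"] by (simp add: algebra_simps)
    ultimately show ?thesis
      using xy p by (simp add: e_def power_int_add power_int_mult_distrib)
  qed
  have b0: "b n j = 0" if "\<bar>j\<bar> > int n" for j
    using that by (auto simp: b_def inv_qfac_def)
  \<comment> \<open>Since $xy = p$, the new factor $(1 - x p^n)(1 - y p^n)$ is $1 + p^{2n+1} - x p^n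
    - y p^n$. The three terms of this Pascal-type rule match these parts: by \<open>e_Suc\<close>,
    the shifts of \<open>j\<close> by one produce $-x p^n$ and $-y p^n$.\<close>
  have b_Suc: "b (Suc n) j = (1 + p ^ (2*n+1)) * b n j + p powi (int n + 1 - j) * b n (j - 1)
                 + p powi (int n + 1 + j) * b n (j + 1)" for j
  proof -
    define R S where "R = inv_qfac p (int n + 1 - j)" and "S = inv_qfac p (int n + 1 + j)"
    define u v where "u = p powi (int n - j)" and "v = p powi (int n + j)"
    have shift: "int n - j + 1 = int n + 1 - j" "int n + j + 1 = int n + 1 + j" by simp_all
    have up: "p powi (int n + 1 - j) = u * p" "p powi (int n + 1 + j) = v * p"
      using power_int_add_1[of p "int n - j"] power_int_add_1[of p "int n + j"] p0
      unfolding shift by (simp_all add: u_def v_def)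
    have R1: "inv_qfac p (int n - j) = (1 - u * p) * R"
      using inv_qfac_rec[OF np, of "int n - j"] unfolding shift up R_def .
    have R2: "inv_qfac p (int n - (j + 1)) = (1 - u) * (1 - u * p) * R"
      using inv_qfac_rec[OF np, of "int n - j - 1"] R1 by (simp add: u_def algebra_simps)
    have S1: "inv_qfac p (int n + j) = (1 - v * p) * S"
      using inv_qfac_rec[OF np, of "int n + j"] unfolding shift up S_def .
    have S2: "inv_qfac p (int n + (j - 1)) = (1 - v) * (1 - v * p) * S"
      using inv_qfac_rec[OF np, of "int n + j - 1"] S1 by (simp add: v_def add_diff_eq mult.assoc)
    have uv: "p ^ (2 * n) = u * v"
      using p0 by (simp add: u_def v_def flip: power_int_add power_int_of_nat)
    have q2: "qfac p (2 * Suc n) = qfac p (2 * n) * (1 - u * v * p) * (1 - u * v * p * p)"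
      using uv by (simp add: qfac_def algebra_simps)
    have R3: "inv_qfac p (int (Suc n) - j) = R" "inv_qfac p (int n - (j - 1)) = R"
      and S3: "inv_qfac p (int (Suc n) + j) = S" "inv_qfac p (int n + (j + 1)) = S"
      by (simp_all add: R_def S_def algebra_simps)
    show ?thesis
      unfolding b_def R1 R2 S1 S2 R3 S3 q2 up power_add uv by (simp add: algebra_simps)
  qed
  \<comment> \<open>The summation range does not depend on \<open>n\<close>. As
    \<open>Suc n \<le> M\<close>, shifting \<open>j\<close> by one moves only vanishing terms across
    its ends.\<close>
  let ?I = "{-int M..int M}"
  have shift1: "(\<Sum>j\<in>?I. e j * (p powi (int n + 1 - j) * b n (j - 1))) = - x * p ^ n * (\<Sum>j\<in>?I. e j * b n j)"
  proof -
    have "(\<Sum>j\<in>?I. e j * (p powi (int n + 1 - j) * b n (j - 1))) =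
          (\<Sum>j\<in>{-int M-1..int M-1}. e (j + 1) * (p powi (int n - j) * b n j))"
      by (rule sum.reindex_bij_witness[of _ "\<lambda>j. j + 1" "\<lambda>j. j - 1"]) (auto simp: algebra_simps)
    also have "\<dots> = (\<Sum>j\<in>{-int M-1..int M-1}. - x * p ^ n * (e j * b n j))"
      using p0 by (intro sum.cong refl) (simp add: e_Suc power_int_diff)
    also have "\<dots> = (\<Sum>j\<in>?I. - x * p ^ n * (e j * b n j))"
      by (rule sum.mono_neutral_cong) (use Suc.prems b0 in auto)
    finally show ?thesis by (simp add: sum_distrib_left)
  qed
  have shift2: "(\<Sum>j\<in>?I. e j * (p powi (int n + 1 + j) * b n (j + 1))) = - y * p ^ n * (\<Sum>j\<in>?I. e j * b n j)"
  proof -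
    have *: "e j * p powi (j + 1) = - e (j + 1) * y" for j
      using p0 by (simp add: e_Suc power_int_add p)
    have "(\<Sum>j\<in>?I. e j * (p powi (int n + 1 + j) * b n (j + 1))) =
          (\<Sum>j\<in>?I. - y * p ^ n * (e (j + 1) * b n (j + 1)))"
    proof (intro sum.cong refl)
      fix j
      have "p powi (int n + 1 + j) = p powi (j + 1) * p ^ n"
        using p0 by (simp flip: power_int_of_nat power_int_add add: algebra_simps)
      thus "e j * (p powi (int n + 1 + j) * b n (j + 1)) = - y * p ^ n * (e (j + 1) * b n (j + 1))"
        using *[of j] by (metis (no_types, opaque_lifting) mult.assoc mult.commute mult_minus_left)
    qed
    also have "\<dots> = (\<Sum>j\<in>{-int M+1..int M+1}. - y * p ^ n * (e j * b n j))"
      by (rule sum.reindex_bij_witness[of _ "\<lambda>j. j - 1" "\<lambda>j. j + 1"]) (auto simp: algebra_simps)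
    also have "\<dots> = (\<Sum>j\<in>?I. - y * p ^ n * (e j * b n j))"
      by (rule sum.mono_neutral_cong) (use Suc.prems b0 in auto)
    finally show ?thesis by (simp add: sum_distrib_left)
  qed
  have "(\<Sum>j\<in>?I. e j * b (Suc n) j) = (1 + p ^ (2*n+1)) * (\<Sum>j\<in>?I. e j * b n j)
     + (\<Sum>j\<in>?I. e j * (p powi (int n + 1 - j) * b n (j - 1)))
     + (\<Sum>j\<in>?I. e j * (p powi (int n + 1 + j) * b n (j + 1)))"
    unfolding b_Suc by (simp add: sum.distrib sum_distrib_left algebra_simps)
  also have "\<dots> = (1 - x * p ^ n) * (1 - y * p ^ n) * (\<Sum>j\<in>?I. e j * b n j)"
    unfolding shift1 shift2
    by (simp add: algebra_simps p power_mult_distrib power_add mult_2 mult_2_right)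
  also have "(\<Sum>j\<in>?I. e j * b n j) = (\<Prod>k<n. (1 - x * p ^ k) * (1 - y * p ^ k))"
    using Suc by (simp add: e_def b_def)
  finally show ?case by (simp add: e_def b_def mult.commute)
qed


lemma fps_to_fls_prod: "fps_to_fls (\<Prod>x\<in>A. f x) = (\<Prod>x\<in>A. fps_to_fls (f x :: 'b :: comm_ring_1 fps))"
  by (induction A rule: infinite_finite_induct) (simp_all add: fls_times_fps_to_fls)

lemma fps_to_fls_sum: "fps_to_fls (\<Sum>x\<in>A. f x) = (\<Sum>x\<in>A. fps_to_fls (f x :: 'b :: comm_ring_1 fps))"
  by (induction A rule: infinite_finite_induct) simp_all

lemma fps_to_fls_inverse:
  "fps_nth f 0 \<noteq> 0 \<Longrightarrow> fps_to_fls (inverse f) = inverse (fps_to_fls (f :: 'b :: field fps))"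
  by (simp add: fls_inverse_fps_to_fls)

lemma fls_X_power_eq_1_iff: "(fls_X :: 'a :: field fls) ^ k = 1 \<longleftrightarrow> k = 0"
proof
  assume "(fls_X :: 'a fls) ^ k = 1"
  hence "fps_to_fls (fps_X ^ k :: 'a fps) = fps_to_fls 1" by (simp add: fps_to_fls_power)
  hence "(fps_X ^ k :: 'a fps) = 1" by (simp only: fps_to_fls_eq_iff)
  hence "fps_nth (fps_X ^ k :: 'a fps) 0 = fps_nth 1 0" by (rule arg_cong)
  thus "k = 0" unfolding fps_X_power_nth by (simp split: if_splits)
qed simp

lemma qpn_to_fls:
  "fps_to_fls (qpn c i d n) = (\<Prod>k<n. 1 - fls_const c * fls_X ^ i * (fls_X ^ d) ^ k)"
  by (simp add: qpn_def fps_to_fls_prod fls_times_fps_to_fls fps_to_fls_power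
        power_add power_mult mult.assoc)

lemma qfac_fls: "qfac (fls_X ^ d) m = fps_to_fls (qpn 1 d d m)"
  unfolding qpn_to_fls qfac_def by (simp add: power_mult)

text \<open>Values in \<open>nat\<close> keep theta series within power series: $j(j+1)/2$ is
  nonnegative for negative \<open>j\<close> too, and \<open>triangular (j - 1)\<close> is
  $j(j-1)/2$.\<close>

definition triangular :: "int \<Rightarrow> nat" where
  "triangular j = nat (j * (j + 1) div 2)"

lemma of_nat_triangular: "int (triangular j) = j * (j + 1) div 2"
proof -
  have "0 \<le> j * (j + 1)" by (cases "j \<ge> 0") (auto intro: mult_nonpos_nonpos)
  thus ?thesis by (simp add: triangular_def)
qed

lemma two_triangular: "2 * int (triangular j) = j * (j + 1)"
  unfolding of_nat_triangular by (rule dvd_mult_div_cancel) simp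

text \<open>The term of index \<open>j\<close> in Ramanujan's theta function $f(a, b)$, the sum of
  $a^{j(j+1)/2} b^{j(j-1)/2}$, at $a = -z q^i$ and $b = -q^l/z$.\<close>

definition theta_term :: "complex \<Rightarrow> nat \<Rightarrow> nat \<Rightarrow> int \<Rightarrow> complex fps" where
  "theta_term z i l j =
     fps_const ((-1) powi j * z powi j) * fps_X ^ (i * triangular j + l * triangular (j - 1))"

text \<open>The limit \<open>L\<close> of the partial products is a hypothesis in order to admit
  \<open>l = 0\<close>. In that case the second product begins with the constant $1 - 1/z$, and
  \<open>qpn_LIMSEQ\<close> does not apply to it directly.\<close>

lemma jacobi_triple_product_LIMSEQ:
  assumes i: "i > 0" and z: "z \<noteq> 0"
    and L: "(\<lambda>n. qpn z i (i + l) n * qpn (1 / z) l (i + l) n) \<longlonglongrightarrow> L"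
  shows "(theta_term z i l has_sum qp 1 (i + l) (i + l) * L) UNIV"
proof -
  define d where "d = i + l"
  have d: "d > 0" using i by (simp add: d_def)
  define r where "r = (\<lambda>m. if m < 0 then 0 else inverse (qpn 1 d d (nat m)))"
  have r: "fps_to_fls (r m) = inv_qfac (fls_X ^ d) m" for m
    using d by (simp add: r_def inv_qfac_def qfac_fls fps_to_fls_inverse divide_inverse)
  define u where "u = (\<lambda>n j. qpn 1 d d (2 * n) * r (int n - j) * r (int n + j))"
  have F: "qpn z i d n * qpn (1 / z) l d n = (\<Sum>j\<in>{-int n..int n}. theta_term z i l j * u n j)" for n
  proof -
    define x y where "x = fls_const z * fls_X ^ i" and "y = fls_const (1 / z) * fls_X ^ l"
    have xy: "x \<noteq> 0" "y \<noteq> 0" using z by (auto simp: x_def y_def)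
    have "x * y = (fls_const z * fls_const (1 / z)) * (fls_X ^ i * fls_X ^ l)"
      by (simp only: x_def y_def mult_ac)
    hence p: "fls_X ^ d = x * y" using z by (simp add: d_def power_add)

    have trm: "(-1) powi j * x powi (j * (j + 1) div 2) * y powi (j * (j - 1) div 2) =
        fps_to_fls (theta_term z i l j)" for j
    proof -
      have "j * (j - 1) div 2 = int (triangular (j - 1))"
        by (simp add: of_nat_triangular mult.commute)
      moreover have "z powi (int (triangular j)) * (1 / z) powi (int (triangular (j - 1))) = z powi j"
      proof -
        have "int (triangular j) - int (triangular (j - 1)) = j"
          using two_triangular[of j] two_triangular[of "j - 1"] by (simp add: algebra_simps)
        hence "z powi j = z powi (int (triangular j)) / z powi (int (triangular (j - 1)))"
          using z by (metis power_int_diff)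
        thus ?thesis by (simp add: power_divide)
      qed
      moreover have "x powi int (triangular j) * y powi int (triangular (j - 1)) =
          (fls_const z ^ triangular j * fls_const (1 / z) ^ triangular (j - 1)) *
          fls_X ^ (i * triangular j + l * triangular (j - 1))"
        by (simp add: x_def y_def power_mult_distrib power_mult power_add mult_ac)
      moreover have "fls_const (z powi j) = fls_const z ^ triangular j * fls_const (1 / z) ^ triangular (j - 1)"
        using calculation(2) by (simp flip: fls_const_power)
      moreover have "(-1) powi j = fls_const ((-1) powi j :: complex)"
        by (simp add: fls_const_power_int)
      ultimately show ?thesis
        by (simp add: theta_term_def fls_times_fps_to_fls fps_to_fls_power mult.assoc
              flip: of_nat_triangular fls_const_mult_const)
    qed
    have "fps_to_fls (qpn z i d n * qpn (1 / z) l d n) =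
        (\<Prod>k<n. (1 - x * (fls_X ^ d) ^ k) * (1 - y * (fls_X ^ d) ^ k))"
      by (simp add: fls_times_fps_to_fls qpn_to_fls x_def y_def prod.distrib)
    also have "\<dots> = (\<Sum>j\<in>{-int n..int n}. fps_to_fls (theta_term z i l j) *
        (qfac (fls_X ^ d) (2 * n) * inv_qfac (fls_X ^ d) (int n - j) * inv_qfac (fls_X ^ d) (int n + j)))"
      unfolding trm [symmetric]
    proof (rule finite_jacobi_triple_product[OF p xy _ order.refl])
      show "((fls_X :: complex fls) ^ d) ^ k \<noteq> 1" if "k > 0" for k
        using that d by (simp add: fls_X_power_eq_1_iff flip: power_mult)
    qed
    also have "\<dots> = fps_to_fls (\<Sum>j\<in>{-int n..int n}. theta_term z i l j * u n j)"
      by (simp add: fps_to_fls_sum u_def r fls_times_fps_to_fls qfac_fls)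
    finally show ?thesis by simp
  qed
  have rlim: "(\<lambda>n. r (int n + j)) \<longlonglongrightarrow> inverse (qp 1 d d)" for j
  proof -
    have "(\<lambda>n. inverse (qpn 1 d d (nat (int n + j)))) \<longlonglongrightarrow> inverse (qp 1 d d)"
      using qpn_nat_LIMSEQ(1)[OF d d] d by (intro tendsto_inverse_fps) auto
    moreover have "eventually (\<lambda>n. r (int n + j) = inverse (qpn 1 d d (nat (int n + j)))) sequentially"
      using eventually_ge_at_top[of "nat (- j)"] by eventually_elim (auto simp: r_def)
    ultimately show ?thesis by (subst tendsto_cong) auto
  qed
  have U: "(\<lambda>n. u n j) \<longlonglongrightarrow> inverse (qp 1 d d)" for j
  proof -
    have "(\<lambda>n. r (int n - j)) \<longlonglongrightarrow> inverse (qp 1 d d)" using rlim[of "- j"] by simp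
    hence "(\<lambda>n. u n j) \<longlonglongrightarrow> qp 1 d d * inverse (qp 1 d d) * inverse (qp 1 d d)"
      unfolding u_def by (intro tendsto_mult rlim qpn_mult_LIMSEQ d) auto
    thus ?thesis using d by (simp add: inverse_mult_eq_1')
  qed
  have fin: "finite {j\<in>UNIV. fps_nth (theta_term z i l j) m \<noteq> 0}" for m
  proof (rule finite_subset)
    show "{j\<in>UNIV. fps_nth (theta_term z i l j) m \<noteq> 0} \<subseteq> {-int m - 2..int m + 2}"
    proof
      fix j assume "j \<in> {j\<in>UNIV. fps_nth (theta_term z i l j) m \<noteq> 0}"
      hence "m = i * triangular j + l * triangular (j - 1)"
        by (auto simp: theta_term_def split: if_splits)
      hence "triangular j \<le> m" using i by (metis le_add1 le_trans mult_le_mono1 nat_mult_1 Suc_leI One_nat_def)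
      hence "j * (j + 1) \<le> 2 * int m" using two_triangular[of j] by linarith
      show "j \<in> {-int m - 2..int m + 2}"
      proof (rule ccontr)
        assume "j \<notin> {-int m - 2..int m + 2}"
        then consider "j \<ge> int m + 3" | "-1 - j \<ge> int m + 2" by force
        hence "j * (j + 1) \<ge> (int m + 2) * 2"
        proof cases
          case 1 thus ?thesis by (intro mult_mono) auto
        next
          case 2
          hence "(-1 - j) * (- j) \<ge> (int m + 2) * 2" by (intro mult_mono) auto
          thus ?thesis by (simp add: algebra_simps)
        qed
        thus False using \<open>j * (j + 1) \<le> 2 * int m\<close> by simp
      qed
    qed
  qed auto
  have "((\<lambda>j. theta_term z i l j * inverse (qp 1 d d)) has_sum L) UNIV"
  proof (rule fps_has_sum_LIMSEQ[where u = u and I = "\<lambda>n. {-int n..int n}"])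
    show "(\<lambda>n. qpn z i d n * qpn (1 / z) l d n) \<longlonglongrightarrow> L" using L by (simp add: d_def)
    show "eventually (\<lambda>n. j \<in> {-int n..int n}) sequentially" for j
      by (auto simp: eventually_sequentially intro: exI[of _ "nat \<bar>j\<bar>"])
  qed (use F U fin in auto)
  hence "((\<lambda>j. theta_term z i l j * inverse (qp 1 d d) * qp 1 d d) has_sum L * qp 1 d d) UNIV"
    by (rule has_sum_cmult_left)
  thus ?thesis using d by (simp add: mult.assoc inverse_mult_eq_1 d_def mult.commute[of L])
qed

section \<open>Quintisection of theta series at fifth roots of unity\<close>

lemma root5_sum:
  assumes "z ^ 5 = 1" "z \<noteq> (1 :: complex)"
  shows "1 + z + z^2 + z^3 + z^4 = 0"
proof -
  have "(z - 1) * (1 + z + z^2 + z^3 + z^4) = z ^ 5 - 1" by algebra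
  thus ?thesis using assms by simp
qed

lemma root5_inverse:
  assumes "z ^ 5 = (1 :: complex)"
  shows "1 / z = z ^ 4" "z \<noteq> 0"
proof -
  show "z \<noteq> 0" using assms by auto
  have "z * z ^ 4 = 1" using assms by (simp add: eval_nat_numeral)
  thus "1 / z = z ^ 4" using \<open>z \<noteq> 0\<close> by (simp add: field_simps)
qed

lemma qpn_0_1_Suc: "qpn w 0 1 (Suc n) = fps_const (1 - w) * qpn w 1 1 n"
proof -
  have "qpn w 0 1 (Suc n) = (1 - fps_const w) * qpn w 1 1 n"
    unfolding qpn_def by (subst prod.lessThan_Suc_shift) simp
  thus ?thesis by (simp flip: fps_const_sub)
qed

lemma jacobi_triple_product:
  assumes "i > 0" "l > 0" "z \<noteq> 0"
  shows "(theta_term z i l has_sum qp 1 (i+l) (i+l) * (qp z i (i+l) * qp (1/z) l (i+l))) UNIV"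
  using assms by (intro jacobi_triple_product_LIMSEQ tendsto_mult qpn_LIMSEQ) auto

text \<open>The case \<open>l = 0\<close>, with the constant factor $1 - 1/z$ of the second product
  split off. It is the form with base $q$ and triangular exponents, which is dissected modulo 5
  below.\<close>

lemma jacobi_triple_product_unilateral:
  assumes "z \<noteq> 0"
  shows "(theta_term z 1 0 has_sum qp 1 1 1 * (qp z 1 1 * (fps_const (1 - 1 / z) * qp (1/z) 1 1))) UNIV"
proof -
  have "(\<lambda>n. qpn (1/z) 0 1 (Suc n)) \<longlonglongrightarrow> fps_const (1 - 1 / z) * qp (1/z) 1 1"
    unfolding qpn_0_1_Suc by (intro tendsto_mult tendsto_const qpn_LIMSEQ) auto
  hence "qpn (1/z) 0 1 \<longlonglongrightarrow> fps_const (1 - 1 / z) * qp (1/z) 1 1"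
    by (rule LIMSEQ_imp_Suc)
  hence "(\<lambda>n. qpn z 1 1 n * qpn (1/z) 0 1 n) \<longlonglongrightarrow> qp z 1 1 * (fps_const (1 - 1 / z) * qp (1/z) 1 1)"
    by (intro tendsto_mult qpn_LIMSEQ) auto
  thus ?thesis using jacobi_triple_product_LIMSEQ[of 1 z 0] assms by simp
qed

text \<open>On four residue classes modulo 5 the triangular numbers are again theta exponents, with
  base $q^{25}$, and the classes coincide in pairs. The fifth class, that of 2, is mapped to itself
  by $j -> -1-j$, which preserves triangular numbers.\<close>

lemma triangular_5:
  "triangular (5 * r) = 15 * triangular r + 10 * triangular (r - 1)"
  "triangular (- 5 * r - 1) = 15 * triangular r + 10 * triangular (r - 1)"
  "triangular (5 * r + 1) = Suc (20 * triangular r + 5 * triangular (r - 1))"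
  "triangular (- 5 * r - 2) = Suc (20 * triangular r + 5 * triangular (r - 1))"
  "triangular (- 5 * r - 3) = triangular (5 * r + 2)"
proof -
  have double: "a = b" if "2 * int a = 2 * int b" for a b
    using that by simp
  note t = two_triangular[of r] two_triangular[of "r - 1"]
  have "2 * int (triangular (5 * r)) = 2 * int (15 * triangular r + 10 * triangular (r - 1))"
    using t two_triangular[of "5 * r"] by (simp add: algebra_simps)
  thus "triangular (5 * r) = 15 * triangular r + 10 * triangular (r - 1)" by (rule double)
  have "2 * int (triangular (- 5 * r - 1)) = 2 * int (15 * triangular r + 10 * triangular (r - 1))"
    using t two_triangular[of "- 5 * r - 1"] by (simp add: algebra_simps)
  thus "triangular (- 5 * r - 1) = 15 * triangular r + 10 * triangular (r - 1)" by (rule double)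
  have "2 * int (triangular (5 * r + 1)) = 2 * int (Suc (20 * triangular r + 5 * triangular (r - 1)))"
    using t two_triangular[of "5 * r + 1"] by (simp add: algebra_simps)
  thus "triangular (5 * r + 1) = Suc (20 * triangular r + 5 * triangular (r - 1))" by (rule double)
  have "2 * int (triangular (- 5 * r - 2)) = 2 * int (Suc (20 * triangular r + 5 * triangular (r - 1)))"
    using t two_triangular[of "- 5 * r - 2"] by (simp add: algebra_simps)
  thus "triangular (- 5 * r - 2) = Suc (20 * triangular r + 5 * triangular (r - 1))" by (rule double)
  have "2 * int (triangular (- 5 * r - 3)) = 2 * int (triangular (5 * r + 2))"
    using two_triangular[of "- 5 * r - 3"] two_triangular[of "5 * r + 2"] by (simp add: algebra_simps)
  thus "triangular (- 5 * r - 3) = triangular (5 * r + 2)" by (rule double)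
qed

text \<open>A bijection that reverses signs shows that the sum \<open>S\<close> equals
  \<open>- S\<close>; hence \<open>S\<close> is 0 in characteristic 0. Local finiteness provides the
  existence of \<open>S\<close>.\<close>

lemma fps_has_sum_imp_eq_0:
  fixes f :: "'b \<Rightarrow> complex fps"
  assumes fin: "\<And>m. finite {x\<in>A. fps_nth (f x) m \<noteq> 0}"
    and h: "bij_betw h A A" "\<And>x. x \<in> A \<Longrightarrow> f (h x) = - f x"
  shows "(f has_sum 0) A"
proof -
  define S where "S = Abs_fps (\<lambda>m. \<Sum>x | x \<in> A \<and> fps_nth (f x) m \<noteq> 0. fps_nth (f x) m)"
  have S: "(f has_sum S) A"
    by (rule has_sum_fpsI) (use fin in \<open>auto simp: S_def\<close>)
  hence "((\<lambda>x. f (h x)) has_sum S) A" using h(1) by (subst has_sum_reindex_bij_betw)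
  hence "((\<lambda>x. - f x) has_sum S) A" using h(2) by (subst (asm) has_sum_cong) auto
  hence "S = - S" using has_sum_uminusI[OF S] has_sum_unique by blast
  hence "fps_nth S m = 0" for m
    using arg_cong[OF \<open>S = - S\<close>, of "\<lambda>s. fps_nth s m"] by simp
  hence "S = 0" by (simp add: fps_eq_iff)
  thus ?thesis using S by simp
qed

text \<open>Sort the theta series by \<open>j\<close> modulo 5, on which $z^j$ depends. Classes 0
  and 4 give \<open>U\<close> with factors $1$ and $-1/z$, classes 1 and 3 give $q$ times
  \<open>V\<close> with factors $-z$ and $1/z^2$, and class 2 contributes nothing. Both pairs of
  factors contain $1 - 1/z$, which is cancelled and is nonzero because $z$ is not 1.\<close>

lemma theta_dissection:
  assumes z: "z ^ 5 = 1" "z \<noteq> 1"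
  shows "qp 1 1 1 * qp z 1 1 * qp (1/z) 1 1 =
     qp 1 25 25 * (qp 1 10 25 * qp 1 15 25) -
     fps_const (1 + z + 1/z) * fps_X * (qp 1 25 25 * (qp 1 5 25 * qp 1 20 25))"
proof -
  define U V where "U = qp 1 25 25 * (qp 1 15 25 * qp 1 10 25)"
    and "V = qp 1 25 25 * (qp 1 20 25 * qp 1 5 25)"
  have z0: "z \<noteq> 0" using root5_inverse z by auto
  have U: "(theta_term 1 15 10 has_sum U) UNIV" and V: "(theta_term 1 20 5 has_sum V) UNIV"
    using jacobi_triple_product[of 15 10 1] jacobi_triple_product[of 20 5 1] by (auto simp: U_def V_def)
  define f where "f = theta_term z 1 0"
  have f: "f j = fps_const ((-1) powi j * z powi j) * fps_X ^ triangular j" for j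
    by (simp add: f_def theta_term_def)
  have z5a: "z powi (5 * r) = 1" for r
    using z(1) power_int_mult[of z 5 r] by simp
  have z5: "z powi (5 * r) = 1" "z powi (- 5 * r) = 1" for r
    using z5a[of r] z5a[of "-r"] by simp_all
  have s5: "(-1) powi (5 * r) = ((-1) powi r :: complex)" "(-1) powi (- 5 * r) = ((-1) powi r :: complex)" for r :: int
    by (auto simp: power_int_minus_left)
  define total where "total = qp 1 1 1 * (qp z 1 1 * (fps_const (1 - 1 / z) * qp (1/z) 1 1))"
  have F: "(f has_sum total) UNIV"
    using jacobi_triple_product_unilateral[OF z0] by (simp add: f_def total_def)
  have f0: "(f has_sum U) (range (\<lambda>r. 5 * r))"
  proof (subst has_sum_reindex)
    have "f \<circ> (\<lambda>r. 5 * r) = theta_term 1 15 10"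
      by (auto simp: fun_eq_iff f theta_term_def triangular_5 z5 s5)
    thus "(f \<circ> (\<lambda>r. 5 * r) has_sum U) UNIV" using U by simp
  qed (auto intro: injI)
  have f1: "(f has_sum fps_const (- (1 / z)) * U) (range (\<lambda>r. - 5 * r - 1))"
  proof (subst has_sum_reindex)
    have "f \<circ> (\<lambda>r. - 5 * r - 1) = (\<lambda>r. fps_const (- (1 / z)) * theta_term 1 15 10 r)"
    proof
      fix r
      have "z powi (- 5 * r - 1) = 1 / z" "(-1) powi (- 5 * r - 1) = - ((-1) powi r :: complex)"
        using z5[of r] s5[of r] z0 by (simp_all add: power_int_diff)
      thus "(f \<circ> (\<lambda>r. - 5 * r - 1)) r = fps_const (- (1 / z)) * theta_term 1 15 10 r"
        unfolding o_def f theta_term_def triangular_5 by (simp add: mult.commute flip: mult.assoc)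
    qed
    thus "(f \<circ> (\<lambda>r. - 5 * r - 1) has_sum fps_const (- (1 / z)) * U) UNIV"
      using has_sum_cmult_right[OF U] by simp
  qed (auto intro: injI)
  have f2: "(f has_sum fps_const (- z) * fps_X * V) (range (\<lambda>r. 5 * r + 1))"
  proof (subst has_sum_reindex)
    have "f \<circ> (\<lambda>r. 5 * r + 1) = (\<lambda>r. fps_const (- z) * fps_X * theta_term 1 20 5 r)"
    proof
      fix r
      have "z powi (5 * r + 1) = z" "(-1) powi (5 * r + 1) = - ((-1) powi r :: complex)"
        using z5[of r] s5[of r] z0 by (simp_all add: power_int_add)
      thus "(f \<circ> (\<lambda>r. 5 * r + 1)) r = fps_const (- z) * fps_X * theta_term 1 20 5 r"
        unfolding o_def f theta_term_def triangular_5
        by (simp add: mult_ac)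
    qed
    thus "(f \<circ> (\<lambda>r. 5 * r + 1) has_sum fps_const (- z) * fps_X * V) UNIV"
      using has_sum_cmult_right[OF V] by simp
  qed (auto intro: injI)
  have f3: "(f has_sum fps_const ((1/z)^2) * fps_X * V) (range (\<lambda>r. - 5 * r - 2))"
  proof (subst has_sum_reindex)
    have "f \<circ> (\<lambda>r. - 5 * r - 2) = (\<lambda>r. fps_const ((1/z)^2) * fps_X * theta_term 1 20 5 r)"
    proof
      fix r
      have "z powi (- 5 * r - 2) = (1/z)^2" "(-1) powi (- 5 * r - 2) = ((-1) powi r :: complex)"
        using z5[of r] s5[of r] z0 by (simp_all add: power_int_diff power_divide)
      thus "(f \<circ> (\<lambda>r. - 5 * r - 2)) r = fps_const ((1/z)^2) * fps_X * theta_term 1 20 5 r"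
        unfolding o_def f theta_term_def triangular_5
        by (simp add: mult_ac)
    qed
    thus "(f \<circ> (\<lambda>r. - 5 * r - 2) has_sum fps_const ((1/z)^2) * fps_X * V) UNIV"
      using has_sum_cmult_right[OF V] by simp
  qed (auto intro: injI)
  \<comment> \<open>On this class $j -> -1-j$ preserves the triangular number and, because $z^{-3} =
    z^2$, also the power of $z$, but it changes the parity of \<open>j\<close>.\<close>
  have f4: "(f has_sum 0) (range (\<lambda>r. 5 * r + 2))"
  proof (rule fps_has_sum_imp_eq_0[where h = "\<lambda>j. - j - 1"])
    show "finite {x \<in> range (\<lambda>r. 5 * r + 2). fps_nth (f x) m \<noteq> 0}" for m
      using has_sum_fpsD(1)[OF F, of m] by (rule rev_finite_subset) auto
    show "bij_betw (\<lambda>j. - j - 1) (range (\<lambda>r. 5 * r + 2)) (range (\<lambda>r. 5 * r + 2 :: int))"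
    proof (rule bij_betwI[where g = "\<lambda>j. - j - 1"])
      have "- j - 1 \<in> range (\<lambda>r. 5 * r + 2)" if "j \<in> range (\<lambda>r. 5 * r + 2)" for j :: int
      proof -
        from that obtain r where "j = 5 * r + 2" by auto
        hence "- j - 1 = 5 * (- r - 1) + 2" by simp
        thus ?thesis by blast
      qed
      thus "(\<lambda>j. - j - 1) \<in> range (\<lambda>r. 5 * r + 2) \<rightarrow> range (\<lambda>r. 5 * r + 2 :: int)"
        "(\<lambda>j. - j - 1) \<in> range (\<lambda>r. 5 * r + 2) \<rightarrow> range (\<lambda>r. 5 * r + 2 :: int)" by auto
    qed auto
    fix j assume "j \<in> range (\<lambda>r. 5 * r + 2 :: int)"
    then obtain r where j: "j = 5 * r + 2" by auto
    have j': "- j - 1 = - 5 * r - 3" using j by simp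
    have "z powi (5 * r + 2) = z^2" "z powi (- 5 * r - 3) = 1 / z^3"
      using z5[of r] z0 by (simp_all add: power_int_add power_int_diff)
    moreover have "1 / z^3 = z^2"
      using z z0 by (simp add: field_simps flip: power_add)
    moreover have "(-1) powi (- 5 * r - 3) = - ((-1) powi r :: complex)" "(-1) powi (5 * r + 2) = ((-1) powi r :: complex)"
      using s5[of r] by (simp_all add: power_int_add power_int_diff)
    ultimately show "f (- j - 1) = - f j"
      unfolding j' unfolding j f triangular_5 by (simp flip: fps_const_neg)
  qed
  have ranges: "range (\<lambda>r. 5 * r) = {j::int. j mod 5 = 0}" "range (\<lambda>r. - 5 * r - 1) = {j::int. j mod 5 = 4}"
    "range (\<lambda>r. 5 * r + 1) = {j::int. j mod 5 = 1}" "range (\<lambda>r. - 5 * r - 2) = {j::int. j mod 5 = 3}"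
    "range (\<lambda>r. 5 * r + 2) = {j::int. j mod 5 = 2}"
    by (intro set_eqI, simp add: image_iff, presburger)+
  have un: "(UNIV :: int set) = ((({j. j mod 5 = 0} \<union> {j. j mod 5 = 4}) \<union> {j. j mod 5 = 1}) \<union> {j. j mod 5 = 3}) \<union> {j. j mod 5 = 2}"
    by auto
  have "(f has_sum U + fps_const (- (1 / z)) * U + fps_const (- z) * fps_X * V + fps_const ((1/z)^2) * fps_X * V + 0) UNIV"
    unfolding un by (intro has_sum_Un_disjoint f0[unfolded ranges] f1[unfolded ranges]
      f2[unfolded ranges] f3[unfolded ranges] f4[unfolded ranges]) auto
  hence "total = U + fps_const (- (1 / z)) * U + fps_const (- z) * fps_X * V + fps_const ((1/z)^2) * fps_X * V + 0"
    using F has_sum_unique by blast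
  also have "\<dots> = fps_const (1 - 1/z) * U - fps_const (z - (1/z)^2) * (fps_X * V)"
    by (simp add: algebra_simps flip: fps_const_sub fps_const_neg)
  also have "z - (1/z)^2 = (1 - 1/z) * (1 + z + 1/z)"
    using z0 by (simp add: field_simps power2_eq_square)
  finally have "total = fps_const (1 - 1/z) * U - (fps_const (1 - 1/z) * fps_const (1 + z + 1/z)) * (fps_X * V)"
    by (simp only: fps_const_mult)
  hence "fps_const (1 - 1/z) * (qp 1 1 1 * qp z 1 1 * qp (1/z) 1 1) =
      fps_const (1 - 1/z) * (U - fps_const (1 + z + 1/z) * fps_X * V)"
    by (simp only: total_def right_diff_distrib mult_ac)
  moreover have "fps_const (1 - 1/z) \<noteq> 0" using z by simp
  ultimately have "qp 1 1 1 * qp z 1 1 * qp (1/z) 1 1 = U - fps_const (1 + z + 1/z) * fps_X * V"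
    using mult_left_cancel by blast
  thus ?thesis by (simp add: U_def V_def mult_ac)
qed

section \<open>Partial fractions\<close>

lemma degree_prod_linear_le:
  fixes f :: "'b \<Rightarrow> 'a :: idom"
  assumes "finite A"
  shows "degree (\<Prod>j\<in>A. [:1, f j:]) \<le> card A"
proof -
  have "degree (\<Prod>j\<in>A. [:1, f j:]) \<le> (\<Sum>j\<in>A. degree [:1, f j:])"
    by (rule degree_prod_sum_le[unfolded o_def]) (use assms in auto)
  also have "\<dots> \<le> (\<Sum>j\<in>A. 1)" by (intro sum_mono) auto
  finally show ?thesis by simp
qed

text \<open>Lagrange interpolation: \<open>R\<close> is the numerator of the right-hand side over
  the common denominator. It agrees with \<open>p\<close> at the nodes \<open>1 / c k\<close>, and
  both degrees are smaller than the number of nodes.\<close>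

lemma partial_fraction_decomposition:
  fixes c :: "'b \<Rightarrow> 'a :: field"
  assumes S: "finite S" "inj_on c S" "\<And>k. k \<in> S \<Longrightarrow> c k \<noteq> 0" and deg: "degree p < card S"
    and z: "\<And>k. k \<in> S \<Longrightarrow> 1 - z * c k \<noteq> 0"
  shows "poly p z / (\<Prod>k\<in>S. 1 - z * c k) =
    (\<Sum>k\<in>S. poly p (1 / c k) / (\<Prod>k'\<in>S-{k}. 1 - c k' / c k) / (1 - z * c k))"
proof -
  define w where "w = (\<lambda>k. poly p (1 / c k) / (\<Prod>k'\<in>S-{k}. 1 - c k' / c k))"
  define R where "R = (\<Sum>k\<in>S. smult (w k) (\<Prod>k'\<in>S-{k}. [:1, - c k':]))"
  have polyR: "poly R y = (\<Sum>k\<in>S. w k * (\<Prod>k'\<in>S-{k}. 1 - y * c k'))" for y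
    by (simp add: R_def poly_sum poly_prod)
  have "p = R"
  proof (rule poly_eqI_degree[where A = "(\<lambda>k. 1 / c k) ` S"])
    fix y assume "y \<in> (\<lambda>k. 1 / c k) ` S"
    then obtain j where j: "j \<in> S" "y = 1 / c j" by auto
    have nz: "(\<Prod>k'\<in>S-{j}. 1 - c k' / c j) \<noteq> 0"
      using S j by (auto simp: inj_on_def)
    have "poly R y = (\<Sum>k\<in>{j}. w k * (\<Prod>k'\<in>S-{k}. 1 - y * c k'))"
      unfolding polyR
    proof (rule sum.mono_neutral_right)
      show "\<forall>k\<in>S - {j}. w k * (\<Prod>k'\<in>S-{k}. 1 - y * c k') = 0"
        using S j by (auto simp: prod_zero_iff intro!: bexI[of _ j])
    qed (use S j in auto)
    also have "\<dots> = poly p y" using nz j by (simp add: w_def)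
    finally show "poly p y = poly R y" by simp
  next
    have card: "card ((\<lambda>k. 1 / c k) ` S) = card S"
      using S by (intro card_image) (auto simp: inj_on_def)
    show "degree p < card ((\<lambda>k. 1 / c k) ` S)" using deg card by simp
    have "degree R \<le> card S - 1"
      unfolding R_def
    proof (intro degree_sum_le S)
      fix k assume k: "k \<in> S"
      have "degree (smult (w k) (\<Prod>k'\<in>S-{k}. [:1, - c k':])) \<le> degree (\<Prod>k'\<in>S-{k}. [:1, - c k':])"
        by (rule degree_smult_le)
      also have "\<dots> \<le> card (S - {k})"
        by (rule degree_prod_linear_le) (use S in auto)
      also have "\<dots> = card S - 1" using S k by simp
      finally show "degree (smult (w k) (\<Prod>k'\<in>S-{k}. [:1, - c k':])) \<le> card S - 1" .
    qed
    thus "degree R < card ((\<lambda>k. 1 / c k) ` S)" using deg card by linarith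
  qed
  hence "poly p z / (\<Prod>k\<in>S. 1 - z * c k) =
      (\<Sum>k\<in>S. w k * (\<Prod>k'\<in>S-{k}. 1 - z * c k') / (\<Prod>k\<in>S. 1 - z * c k))"
    by (simp add: polyR sum_divide_distrib)
  also have "\<dots> = (\<Sum>k\<in>S. w k / (1 - z * c k))"
  proof (intro sum.cong refl)
    fix k assume k: "k \<in> S"
    have "(\<Prod>k'\<in>S-{k}. 1 - z * c k') \<noteq> 0" using S z by auto
    moreover have "(\<Prod>k\<in>S. 1 - z * c k) = (1 - z * c k) * (\<Prod>k'\<in>S-{k}. 1 - z * c k')"
      using S k by (simp add: prod.remove)
    ultimately show "w k * (\<Prod>k'\<in>S-{k}. 1 - z * c k') / (\<Prod>k\<in>S. 1 - z * c k) = w k / (1 - z * c k)"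
      by simp
  qed
  finally show ?thesis by (simp add: w_def)
qed

definition qprod :: "'a :: field \<Rightarrow> 'a \<Rightarrow> nat \<Rightarrow> 'a" where
  "qprod q w n = (\<Prod>m<n. 1 - w * q ^ m)"

text \<open>This is $q^{-n(n+1)/2}$. Kept as a product, it mostly cancels as a whole, and elsewhere
  its recurrence suffices.\<close>

definition inv_qpower_prod :: "'a :: field \<Rightarrow> nat \<Rightarrow> 'a" where
  "inv_qpower_prod q n = (\<Prod>m<n. 1 / q ^ Suc m)"

lemma inv_qpower_prod_nonzero: "q \<noteq> 0 \<Longrightarrow> inv_qpower_prod q n \<noteq> 0"
  by (simp add: inv_qpower_prod_def)

lemma one_minus_reflect:
  fixes q w :: "'a :: field"
  assumes "q \<noteq> 0" "w \<noteq> 0"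
  shows "1 - w * q powi (- int (Suc a)) = (1 - (q / w) * q ^ a) * (- w * (1 / q ^ Suc a))"
proof -
  have "q powi (- int (Suc a)) = 1 / q ^ Suc a"
    by (metis power_int_minus power_int_of_nat inverse_eq_divide)
  thus ?thesis using assms by (simp add: field_simps)
qed

text \<open>The factors with negative index are reflected by $1 - y = -y (1 - 1/y)$. This creates
  the second product, in $q/w$, and a monomial that has to be tracked.\<close>

lemma prod_int_interval_qprod:
  fixes q w :: "'a :: field"
  assumes "q \<noteq> 0" "w \<noteq> 0"
  shows "(\<Prod>j\<in>{-int a..<int b}. 1 - w * q powi j) =
     qprod q w b * qprod q (q / w) a * ((- w) ^ a * inv_qpower_prod q a)"
proof (induction a)
  case 0
  show ?case
  proof (induction b)
    case (Suc b)
    have "{-int 0..<int (Suc b)} = insert (int b) {-int 0..<int b}" by auto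
    thus ?case using Suc by (simp add: qprod_def inv_qpower_prod_def mult.commute)
  qed (simp add: qprod_def inv_qpower_prod_def)
next
  case (Suc a)
  have "{-int (Suc a)..<int b} = insert (- int (Suc a)) {-int a..<int b}" by auto
  hence "(\<Prod>j\<in>{-int (Suc a)..<int b}. 1 - w * q powi j) =
      (1 - w * q powi (- int (Suc a))) * (\<Prod>j\<in>{-int a..<int b}. 1 - w * q powi j)"
    by simp
  thus ?case unfolding Suc one_minus_reflect[OF assms]
    by (simp add: qprod_def inv_qpower_prod_def mult_ac)
qed

text \<open>The case $w = 1$ without its vanishing factor, as it occurs in the residue at a
  pole.\<close>

lemma prod_int_interval_qprod_delete:
  fixes q :: "'a :: field"
  assumes "q \<noteq> 0"
  shows "(\<Prod>j\<in>{-int a..int b}-{0}. 1 - q powi j) =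
     qprod q q b * qprod q q a * ((- 1) ^ a * inv_qpower_prod q a)"
proof (induction a)
  case 0
  show ?case
  proof (induction b)
    case (Suc b)
    have "{-int 0..int (Suc b)}-{0} = insert (int (Suc b)) ({-int 0..int b}-{0})" by auto
    hence "(\<Prod>j\<in>{-int 0..int (Suc b)}-{0}. 1 - q powi j) =
      (1 - q powi int (Suc b)) * (\<Prod>j\<in>{-int 0..int b}-{0}. 1 - q powi j)"
      by (simp del: power_int_of_nat)
    moreover have "q powi int (Suc b) = q * q ^ b" by (simp only: power_int_of_nat power_Suc)
    ultimately show ?case unfolding Suc by (simp add: qprod_def inv_qpower_prod_def mult_ac)
  qed (simp add: qprod_def inv_qpower_prod_def)
next
  case (Suc a)
  have "{-int (Suc a)..int b}-{0} = insert (- int (Suc a)) ({-int a..int b}-{0})" by auto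
  hence "(\<Prod>j\<in>{-int (Suc a)..int b}-{0}. 1 - q powi j) =
      (1 - 1 * q powi (- int (Suc a))) * (\<Prod>j\<in>{-int a..int b}-{0}. 1 - q powi j)"
    by simp
  thus ?case unfolding Suc one_minus_reflect[OF assms one_neq_zero]
    by (simp add: qprod_def inv_qpower_prod_def mult_ac)
qed

lemma prod_int_interval_shift:
  "(\<Prod>j\<in>{a..<b}. f (j - k)) = (\<Prod>j\<in>{a-k..<b-k}. f (j :: int))"
  by (rule prod.reindex_bij_witness[of _ "\<lambda>j. j + k" "\<lambda>j. j - k"]) auto

lemma power_int_eq_iff_of_non_root:
  fixes q :: "'a :: field"
  assumes "q \<noteq> 0" "\<And>k. k > 0 \<Longrightarrow> q ^ k \<noteq> 1"
  shows "q powi a = q powi b \<longleftrightarrow> a = b"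
proof
  have *: False if "q powi a = q powi b" "a < b" for a b
  proof -
    have "q powi (b - a) = 1" using that assms(1) by (simp add: power_int_diff)
    hence "q ^ nat (b - a) = 1" using that by (simp add: power_int_def)
    thus False using assms(2)[of "nat (b - a)"] that by simp
  qed
  show "a = b" if "q powi a = q powi b"
    using *[of a b] *[of b a] that by (metis linorder_neqE)
qed simp

text \<open>
  Partial fractions in $c$ of $\prod_{-n \le j < n} (1 - c x q^j) / \prod_{-n \le j \le n} (1 - c q^j)$.
  The powers of $q$ that arise from reflecting the factors with $j < 0$ cancel.
\<close>

lemma finite_kronecker_sum:
  fixes q x c :: "'a :: field"
  assumes q: "q \<noteq> 0" "\<And>k. k > 0 \<Longrightarrow> q ^ k \<noteq> 1" and xc: "x \<noteq> 0" "c \<noteq> 0"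
    and c: "\<And>k. c * q powi k \<noteq> 1"
  shows "qprod q (c * x) n * qprod q (q / (c * x)) n / (qprod q c (Suc n) * qprod q (q / c) n) =
    (\<Sum>k\<in>{-int n..int n}. x powi k / (1 - c * q powi k) *
       (qprod q x (nat (int n - k)) * qprod q (q / x) (nat (int n + k)) /
        (qprod q q (nat (int n - k)) * qprod q q (nat (int n + k)))))"
proof -
  note inj = power_int_eq_iff_of_non_root[OF q]
  define p where "p = (\<Prod>j\<in>{-int n..<int n}. [:1, - (x * q powi j):])"
  have poly_p: "poly p y = (\<Prod>j\<in>{-int n..<int n}. 1 - (y * x) * q powi j)" for y
    by (simp add: p_def poly_prod mult_ac)
  \<comment> \<open>The asymmetric range of the numerator supplies the strict inequality: $2n$
    factors against $2n + 1$ poles.\<close>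
  have deg: "degree p < card {-int n..int n}"
    using degree_prod_linear_le[of "{-int n..<int n}" "\<lambda>j. - (x * q powi j)"] by (simp add: p_def)
  let ?I = "{-int n..int n}"
  have I: "?I = {-int n..<int (Suc n)}" by auto
  have pf: "poly p c / (\<Prod>k\<in>?I. 1 - c * q powi k) =
    (\<Sum>k\<in>?I. poly p (1 / q powi k) / (\<Prod>k'\<in>?I-{k}. 1 - q powi k' / q powi k) / (1 - c * q powi k))"
    by (rule partial_fraction_decomposition) (use deg c q inj in \<open>auto simp: inj_on_def\<close>)
  have lhs: "poly p c / (\<Prod>k\<in>?I. 1 - c * q powi k) = x ^ n *
     (qprod q (c * x) n * qprod q (q / (c * x)) n / (qprod q c (Suc n) * qprod q (q / c) n))"
    unfolding poly_p I prod_int_interval_qprod[OF q(1) xc(2)]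
      prod_int_interval_qprod[OF q(1) no_zero_divisors[OF xc(2,1)]]
  proof -
    have "(- (c * x)) ^ n = x ^ n * (- c) ^ n"
      by (metis mult.commute mult_minus_left power_mult_distrib)
    moreover have "(- c) ^ n * inv_qpower_prod q n \<noteq> 0"
      using xc inv_qpower_prod_nonzero[OF q(1), of n] by simp
    ultimately show "qprod q (c * x) n * qprod q (q / (c * x)) n * ((- (c * x)) ^ n * inv_qpower_prod q n) /
      (qprod q c (Suc n) * qprod q (q / c) n * ((- c) ^ n * inv_qpower_prod q n)) = x ^ n *
      (qprod q (c * x) n * qprod q (q / (c * x)) n / (qprod q c (Suc n) * qprod q (q / c) n))"
      using xc by simp
  qed
  have rhs: "poly p (1 / q powi k) / (\<Prod>k'\<in>?I-{k}. 1 - q powi k' / q powi k) / (1 - c * q powi k) =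
      x ^ n * (x powi k / (1 - c * q powi k) *
       (qprod q x (nat (int n - k)) * qprod q (q / x) (nat (int n + k)) /
        (qprod q q (nat (int n - k)) * qprod q q (nat (int n + k)))))" if "k \<in> ?I" for k
  proof -
    \<comment> \<open>At the pole $q^{-k}$ every factor depends on $j - k$ only, so both ranges
      become intervals that reach from \<open>- a\<close> towards \<open>b\<close>.\<close>
    define a b where "a = nat (int n + k)" and "b = nat (int n - k)"
    have ab: "- int n - k = - int a" "int n - k = int b" "int a = int n + k" "int b = int n - k"
      using that by (auto simp: a_def b_def)
    have "poly p (1 / q powi k) = (\<Prod>j\<in>{-int n..<int n}. 1 - x * q powi (j - k))"
      using q by (simp add: poly_p power_int_diff)
    also have "\<dots> = (\<Prod>j\<in>{-int a..<int b}. 1 - x * q powi j)"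
      unfolding prod_int_interval_shift[where f = "\<lambda>j. 1 - x * q powi j"] ab(1,2) ..
    also have "\<dots> = qprod q x b * qprod q (q / x) a * ((- x) ^ a * inv_qpower_prod q a)"
      by (rule prod_int_interval_qprod) (use q xc in auto)
    finally have 1: "poly p (1 / q powi k) = \<dots>" .
    have "(\<Prod>k'\<in>?I-{k}. 1 - q powi k' / q powi k) = (\<Prod>j\<in>{-int a..int b}-{0}. 1 - q powi j)"
      by (rule prod.reindex_bij_witness[of _ "\<lambda>j. j + k" "\<lambda>j. j - k"])
        (use \<open>int a = int n + k\<close> \<open>int b = int n - k\<close> q in \<open>auto simp: power_int_diff\<close>)
    hence 2: "(\<Prod>k'\<in>?I-{k}. 1 - q powi k' / q powi k) =
        qprod q q b * qprod q q a * ((- 1) ^ a * inv_qpower_prod q a)"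
      using prod_int_interval_qprod_delete[OF q(1)] by simp
    define h where "h = (- 1) ^ a * inv_qpower_prod q a"
    have h: "h \<noteq> 0" using inv_qpower_prod_nonzero[OF q(1), of a] by (simp add: h_def)
    have "x powi int a = x powi int n * x powi k"
      unfolding ab(3) using xc(1) by (simp add: power_int_add)
    hence "(- x) ^ a * inv_qpower_prod q a = (x ^ n * x powi k) * h"
      by (simp add: power_minus[of x] h_def)
    thus ?thesis unfolding 1 2 a_def [symmetric] b_def [symmetric] h_def [symmetric]
      using h by (simp add: mult_ac)
  qed
  have "x ^ n * (qprod q (c * x) n * qprod q (q / (c * x)) n / (qprod q c (Suc n) * qprod q (q / c) n)) =
     x ^ n * (\<Sum>k\<in>{-int n..int n}. x powi k / (1 - c * q powi k) *
       (qprod q x (nat (int n - k)) * qprod q (q / x) (nat (int n + k)) /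
        (qprod q q (nat (int n - k)) * qprod q q (nat (int n + k)))))"
    using pf unfolding lhs sum_distrib_left by (simp only: rhs cong: sum.cong)
  moreover have "x ^ n \<noteq> 0" using xc by simp
  ultimately show ?thesis using mult_left_cancel by blast
qed


text \<open>
  Partial fractions of $\prod_j (1 - z q^{5j+2})^2 / ((1 - z q^{5j}) (1 - z q^{5j+4}))$ at $z = q^2$.
  To lower the degree of the numerator, one factor $1 - z q^2$ is split off; it is also what turns
  the summands into differences that are summable for $n \to \infty$.
\<close>

lemma finite_triple_quotient:
  fixes q :: "'a :: field"
  assumes q: "q \<noteq> 0" "\<And>k. k > 0 \<Longrightarrow> q ^ k \<noteq> 1"
  defines "H \<equiv> \<lambda>i. qprod (q ^ 5) (q ^ i)"
  shows "- q * (H 4 (n + 2) * H 1 (n + 1)) ^ 2 / (H 2 (n + 2) * H 3 (n + 1) * (H 1 (n + 3) * H 4 n)) =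
    (\<Sum>k\<in>{-int (n+1)..int (n+1)}. (1 / (1 - q powi (5 * k + 2)) - 1 / (1 - q powi (5 * k - 2))) *
       ((H 2 (nat (int (n+1) - k + 1)) * H 3 (nat (int (n+1) + k))) ^ 2 /
        (H 5 (nat (int (n+1) - k)) * H 5 (nat (int (n+1) + k)) *
         (H 4 (nat (int (n+1) - k + 1)) * H 1 (nat (int (n+1) + k)))))) -
    (\<Sum>k\<in>{-int (n+1)..int (n+1)}. (1 / (1 - q powi (5 * k + 6)) - 1 / (1 - q powi (5 * k + 2))) *
       ((H 3 (nat (int (n+1) - k)) * H 2 (nat (int (n+1) + k + 1))) ^ 2 /
        (H 5 (nat (int (n+1) - k)) * H 5 (nat (int (n+1) + k)) *
         (H 1 (nat (int (n+1) - k)) * H 4 (nat (int (n+1) + k + 1))))))"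
proof -
  \<comment> \<open>At $z = q^2$ the exponents $5j + 4$ become $5(j + 1) + 1$, which shifts the
    interval by one. With \<open>N = n + 1\<close> the number of its negative indices is
    \<open>n\<close>, again a natural number.\<close>
  define N where "N = n + 1"
  define Q where "Q = q ^ 5"
  have Q: "Q \<noteq> 0" "\<And>k. k > 0 \<Longrightarrow> Q ^ k \<noteq> 1"
    using q by (auto simp: Q_def simp flip: power_mult)
  have Qi: "Q powi j = q powi (5 * j)" for j
    by (simp add: Q_def power_int_mult)
  note inj = power_int_eq_iff_of_non_root[OF q]
  have ne1: "q powi m \<noteq> 1" if "m \<noteq> 0" for m using inj[of m 0] that by simp
  define g where "g = inv_qpower_prod Q"
  have g: "g m \<noteq> 0" for m using inv_qpower_prod_nonzero[OF Q(1)] by (simp add: g_def)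
  have g_Suc: "g (Suc m) = g m / Q ^ Suc m" for m by (simp add: g_def inv_qpower_prod_def)
  have H_eq: "qprod Q (q ^ i) = H i" for i by (simp add: H_def Q_def)
  have interval: "(\<Prod>j\<in>{-int a..<int b}. 1 - q powi (5 * j + int i)) =
      H i b * H (5 - i) a * ((- (q ^ i)) ^ a * g a)" if "i < 5" for a b i
  proof -
    have "Q / q ^ i = q ^ (5 - i)" using q that by (simp add: Q_def power_diff)
    thus ?thesis
      using prod_int_interval_qprod[OF Q(1), of "q ^ i" a b] q
      by (simp add: Qi power_int_add H_eq g_def mult.commute)
  qed
  have interval': "(\<Prod>j\<in>{-int N..int N}. 1 - q powi (5 * (j - k) + int i)) =
      H i b * H (5 - i) a * ((- (q ^ i)) ^ a * g a)" if "i < 5" "int a = int N + k" "int b = int N - k + 1" for a b i k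
  proof -
    have "{-int N..int N} = {-int N..<int N + 1}" by auto
    hence "(\<Prod>j\<in>{-int N..int N}. 1 - q powi (5 * (j - k) + int i)) =
       (\<Prod>j\<in>{-int N - k..<int N + 1 - k}. 1 - q powi (5 * j + int i))"
      by (simp only: prod_int_interval_shift[where f = "\<lambda>j. 1 - q powi (5 * j + int i)"])
    also have "{-int N - k..<int N + 1 - k} = {-int a..<int b}" using that by auto
    finally show ?thesis using interval[OF that(1)] by simp
  qed
  have H5: "qprod Q Q = H 5" by (simp add: H_def Q_def)
  have delete: "(\<Prod>j\<in>{-int N..int N}-{k}. 1 - q powi (5 * (j - k))) =
      H 5 b * H 5 a * ((- 1) ^ a * g a)" if "int a = int N + k" "int b = int N - k" for a b k
  proof -
    have "(\<Prod>j\<in>{-int N..int N}-{k}. 1 - q powi (5 * (j - k))) = (\<Prod>j\<in>{-int a..int b}-{0}. 1 - Q powi j)"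
      by (rule prod.reindex_bij_witness[of _ "\<lambda>j. j + k" "\<lambda>j. j - k"])
        (use that in \<open>auto simp: Qi\<close>)
    thus ?thesis using prod_int_interval_qprod_delete[OF Q(1), of a b] by (simp add: H5 g_def)
  qed
  let ?I = "{-int N..int N}"
  \<comment> \<open>The pair \<open>(s, k)\<close> stands for the pole parameter $q^{5k+s}$. Tagging
    both families by \<open>s\<close> lets one decomposition treat them together.\<close>
  define S where "S = ({0,4::int} \<times> ?I)"
  define c where "c = (\<lambda>(s,k). q powi (5 * k + s))"
  define p where "p = (\<Prod>j\<in>?I. [:1, - (q powi (5 * j + 2)):]) * (\<Prod>j\<in>?I-{0}. [:1, - (q powi (5 * j + 2)):])"
  define z where "z = q ^ 2"
  have poly_p: "poly p y * (1 - y * q ^ 2) = (\<Prod>j\<in>?I. 1 - y * q powi (5 * j + 2)) ^ 2" for y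
  proof -
    have "poly p y = (\<Prod>j\<in>?I. 1 - y * q powi (5 * j + 2)) * (\<Prod>j\<in>?I-{0}. 1 - y * q powi (5 * j + 2))"
      by (simp add: p_def poly_prod)
    moreover have "(\<Prod>j\<in>?I. 1 - y * q powi (5 * j + 2)) = (1 - y * q ^ 2) * (\<Prod>j\<in>?I-{0}. 1 - y * q powi (5 * j + 2))"
      by (subst prod.remove[of _ 0]) auto
    ultimately show ?thesis by (simp add: power2_eq_square mult_ac)
  qed
  have deg: "degree p < card S"
  proof -
    have "degree p \<le> card ?I + card (?I - {0})"
      unfolding p_def by (intro order_trans[OF degree_mult_le] add_mono degree_prod_linear_le) auto
    thus ?thesis by (simp add: S_def card_cartesian_product)
  qed
  have pf: "poly p z / (\<Prod>k\<in>S. 1 - z * c k) =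
    (\<Sum>k\<in>S. poly p (1 / c k) / (\<Prod>k'\<in>S-{k}. 1 - c k' / c k) / (1 - z * c k))"
  proof (rule partial_fraction_decomposition)
    show "inj_on c S" by (auto simp: inj_on_def c_def S_def inj; presburger)
    show "1 - z * c k \<noteq> 0" if kS: "k \<in> S" for k
    proof -
      obtain s j where k: "k = (s, j)" "s \<in> {0, 4}" using kS unfolding S_def by blast
      have "z * c k = q powi (5 * j + s + 2)"
        using q k by (simp add: z_def c_def power_int_add mult.commute)
      moreover have "5 * j + s + 2 \<noteq> 0" using k by auto presburger+
      ultimately show ?thesis using ne1 by simp
    qed
  qed (use deg q in \<open>auto simp: S_def c_def\<close>)
  have one_minus_z4: "1 - q ^ 4 \<noteq> 0" using q(2)[of 4] by simp
  have S_prod: "(\<Prod>k\<in>S. f k) = (\<Prod>j\<in>?I. f (0, j)) * (\<Prod>j\<in>?I. f (4, j))" for f :: "int \<times> int \<Rightarrow> 'a"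
    unfolding S_def by (simp flip: prod.cartesian_product[where g = "\<lambda>x y. f (x, y)", simplified])
  have S_sum: "(\<Sum>k\<in>S. f k) = (\<Sum>j\<in>?I. f (0, j)) + (\<Sum>j\<in>?I. f (4, j))" for f :: "int \<times> int \<Rightarrow> 'a"
    unfolding S_def by (simp flip: sum.cartesian_product[where g = "\<lambda>x y. f (x, y)", simplified])
  have gn: "g m = g (Suc m) * q ^ (5 * Suc m)" for m
    using q by (simp add: g_Suc Q_def power_add flip: power_mult)

  have lhs: "(1 - q ^ 4) * (poly p z / (\<Prod>k\<in>S. 1 - z * c k)) =
      - q * (H 4 (n + 2) * H 1 (n + 1)) ^ 2 / (H 2 (n + 2) * H 3 (n + 1) * (H 1 (n + 3) * H 4 n))"
  proof -
    have "poly p z * (1 - q ^ 4) = (\<Prod>j\<in>?I. 1 - q powi (5 * (j - 0) + int 4)) ^ 2"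
      using poly_p[of z] q by (simp add: z_def power_int_add mult_ac flip: power_add)
    also have "\<dots> = (H 4 (n + 2) * H 1 (n + 1) * ((- (q ^ 4)) ^ N * g N)) ^ 2"
      by (subst interval'[where a = N and b = "n + 2"]) (auto simp: N_def)
    finally have 1: "(1 - q ^ 4) * poly p z = (H 4 (n + 2) * H 1 (n + 1)) ^ 2 * ((- (q ^ 4)) ^ N * g N) ^ 2"
      by (simp add: power_mult_distrib mult.commute)
    have "(\<Prod>j\<in>?I. 1 - z * c (0, j)) = (\<Prod>j\<in>?I. 1 - q powi (5 * (j - 0) + int 2))"
      using q by (simp add: z_def c_def power_int_add mult.commute)
    also have "\<dots> = H 2 (n + 2) * H 3 (n + 1) * ((- (q ^ 2)) ^ N * g N)"
      by (subst interval'[where a = N and b = "n + 2"]) (auto simp: N_def)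
    finally have 2: "(\<Prod>j\<in>?I. 1 - z * c (0, j)) = \<dots>" .
    have "z * c (4, j) = q powi (5 * (j - (- 1)) + int 1)" for j
      using q by (simp add: z_def c_def power_int_add mult_ac flip: power_add)
    hence "(\<Prod>j\<in>?I. 1 - z * c (4, j)) = (\<Prod>j\<in>?I. 1 - q powi (5 * (j - (- 1)) + int 1))"
      by simp
    also have "\<dots> = H 1 (n + 3) * H 4 n * ((- (q ^ 1)) ^ n * g n)"
      by (subst interval'[where a = n and b = "n + 3"]) (auto simp: N_def)
    finally have 3: "(\<Prod>j\<in>?I. 1 - z * c (4, j)) = \<dots>" .
    define h where "h = (- (q ^ 2)) ^ N * g N * ((- (q ^ 1)) ^ n * g n)"
    have h: "h \<noteq> 0" using q g by (simp add: h_def)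
    \<comment> \<open>The monomials from the reflected factors of numerator and denominator differ
      by $-q$; this is the origin of the factor \<open>- q\<close> in the statement.\<close>
    have "((- (q ^ 4)) ^ N * g N) ^ 2 = - q * h"
    proof -
      have "(- (q ^ 2)) ^ N * (- (q ^ 1)) ^ n = - (q ^ 2) * (q ^ 3) ^ n"
      proof -
        have "(- (q ^ 2)) ^ N * (- (q ^ 1)) ^ n = - (q ^ 2) * ((- (q ^ 2)) * (- (q ^ 1))) ^ n"
          unfolding N_def by (simp only: power_mult_distrib power_add power_one_right mult_ac)
        also have "(- (q ^ 2)) * (- (q ^ 1)) = q ^ 3" by (simp add: eval_nat_numeral)
        finally show ?thesis .
      qed
      hence "- q * h = q ^ (3 + 3 * n) * (g N * g n)"
        by (simp add: h_def mult_ac power_add power_mult power_mult_distrib eval_nat_numeral)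
      also have "g n = g N * q ^ (5 * N)" using gn[of n] unfolding N_def by simp
      also have "q ^ (3 + 3 * n) * (g N * (g N * q ^ (5 * N))) = q ^ (3 + 3 * n + 5 * N) * (g N * g N)"
        by (simp only: power_add mult_ac)
      also have "3 + 3 * n + 5 * N = 4 * N * 2" by (simp add: N_def)
      also have "q ^ (4 * N * 2) = ((q ^ 4) ^ 2) ^ N"
        by (simp only: power_mult [symmetric] mult_ac)
      also have "(q ^ 4) ^ 2 = (- (q ^ 4)) ^ 2"
        by (simp only: power2_minus)
      also have "\<dots> ^ N = ((- (q ^ 4)) ^ N) ^ 2"
        by (simp only: power_mult [symmetric] mult.commute)
      finally show ?thesis by (simp add: power_mult_distrib power2_eq_square)
    qed
    hence "(1 - q ^ 4) * poly p z = - q * (H 4 (n + 2) * H 1 (n + 1)) ^ 2 * h"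
      using 1 by simp
    moreover have "(\<Prod>k\<in>S. 1 - z * c k) = (H 2 (n + 2) * H 3 (n + 1) * (H 1 (n + 3) * H 4 n)) * h"
      unfolding S_prod 2 3 by (simp add: h_def mult_ac)
    ultimately show ?thesis using h by simp
  qed

  \<comment> \<open>Each of the two factors repairs the omission of $1 - z q^2$ from
    \<open>p\<close>: $1 - q^4$ is its value at $z = q^2$, and $1 - q^2/C$ its value at the pole
    $1/C$, where it completes the numerator to a full square. The quotient of the two is what turns
    a simple fraction into a difference.\<close>
  have split: "(1 - q ^ 4) * (y / d / (1 - z * C)) = (y * (1 - 1 / C * q ^ 2) / d) * (1 / (1 - q ^ 2 * C) - 1 / (1 - C / q ^ 2))"
    if "C \<noteq> 0" "q ^ 2 \<noteq> C" "1 - q ^ 2 * C \<noteq> 0" for y d C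
  proof -
    have "(1 - q ^ 4) / (1 - q ^ 2 * C) = (1 - 1 / C * q ^ 2) * (1 / (1 - q ^ 2 * C) - 1 / (1 - C / q ^ 2))"
    proof -
      define e where "e = 1 - 1 / C * q ^ 2"
      have "1 - C / q ^ 2 = - e * (C / q ^ 2)"
        using that q by (simp add: e_def field_simps)
      moreover have "e \<noteq> 0" using that by (simp add: e_def field_simps)
      ultimately have "e * (1 / (1 - C / q ^ 2)) = - (q ^ 2 / C)"
        using that(1) q(1) by simp
      hence "e * (1 / (1 - q ^ 2 * C) - 1 / (1 - C / q ^ 2)) = e / (1 - q ^ 2 * C) + q ^ 2 / C"
        by (simp add: right_diff_distrib)
      hence "(1 - 1 / C * q ^ 2) * (1 / (1 - q ^ 2 * C) - 1 / (1 - C / q ^ 2)) =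
          (1 - q ^ 2 / C) / (1 - q ^ 2 * C) + q ^ 2 / C"
        by (simp add: e_def)
      also have "\<dots> = ((1 - q ^ 2 / C) + q ^ 2 / C * (1 - q ^ 2 * C)) / (1 - q ^ 2 * C)"
        using that by (simp add: add_divide_distrib)
      also have "(1 - q ^ 2 / C) + q ^ 2 / C * (1 - q ^ 2 * C) = 1 - q ^ 4"
        using that by (simp add: right_diff_distrib flip: power_add)
      finally show ?thesis by simp
    qed
    hence "y / d * ((1 - q ^ 4) / (1 - q ^ 2 * C)) =
        y / d * ((1 - 1 / C * q ^ 2) * (1 / (1 - q ^ 2 * C) - 1 / (1 - C / q ^ 2)))"
      by (rule arg_cong)
    thus ?thesis by (simp add: z_def mult_ac)
  qed

  have rhs0: "(1 - q ^ 4) * (poly p (1 / c (0, k)) / (\<Prod>k'\<in>S-{(0,k)}. 1 - c k' / c (0, k)) / (1 - z * c (0, k))) =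
      (1 / (1 - q powi (5 * k + 2)) - 1 / (1 - q powi (5 * k - 2))) *
       ((H 2 (nat (int N - k + 1)) * H 3 (nat (int N + k))) ^ 2 /
        (H 5 (nat (int N - k)) * H 5 (nat (int N + k)) *
         (H 4 (nat (int N - k + 1)) * H 1 (nat (int N + k)))))" if k: "k \<in> ?I" for k
  proof -
    define a b where "a = nat (int N + k)" and "b = nat (int N - k)"
    have ab: "int a = int N + k" "int b = int N - k" "nat (int N - k + 1) = Suc b" "int (Suc b) = int N - k + 1"
      using k by (auto simp: a_def b_def)
    define C where "C = q powi (5 * k)"
    have cC: "c (0, k) = C" by (simp add: c_def C_def)
    have "poly p (1 / C) * (1 - 1 / C * q ^ 2) = (\<Prod>j\<in>?I. 1 - q powi (5 * (j - k) + int 2)) ^ 2"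
      unfolding poly_p using q by (simp add: C_def power_int_add power_int_diff right_diff_distrib)
    also have "\<dots> = (H 2 (Suc b) * H 3 a * ((- (q ^ 2)) ^ a * g a)) ^ 2"
      using interval'[OF _ ab(1) ab(4), of 2] by simp
    finally have 1: "poly p (1 / C) * (1 - 1 / C * q ^ 2) = (H 2 (Suc b) * H 3 a) ^ 2 * ((- (q ^ 2)) ^ a * g a) ^ 2"
      by (simp add: power_mult_distrib)
    have "(\<Prod>k'\<in>S-{(0,k)}. 1 - c k' / C) = (\<Prod>j\<in>?I-{k}. 1 - c (0, j) / C) * (\<Prod>j\<in>?I. 1 - c (4, j) / C)"
    proof -
      have "S - {(0,k)} = Pair 0 ` (?I - {k}) \<union> Pair 4 ` ?I" by (auto simp: S_def)
      hence "(\<Prod>k'\<in>S-{(0,k)}. 1 - c k' / C) = (\<Prod>k'\<in>Pair 0 ` (?I - {k}). 1 - c k' / C) * (\<Prod>k'\<in>Pair 4 ` ?I. 1 - c k' / C)"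
        by (simp only:) (rule prod.union_disjoint, auto)
      thus ?thesis by (simp add: prod.reindex inj_on_def)
    qed
    also have "(\<Prod>j\<in>?I-{k}. 1 - c (0, j) / C) = (\<Prod>j\<in>?I-{k}. 1 - q powi (5 * (j - k)))"
      using q by (simp add: c_def C_def power_int_diff right_diff_distrib)
    also have "\<dots> = H 5 b * H 5 a * ((- 1) ^ a * g a)"
      using delete[OF ab(1,2)] .
    also have "(\<Prod>j\<in>?I. 1 - c (4, j) / C) = (\<Prod>j\<in>?I. 1 - q powi (5 * (j - k) + int 4))"
      using q by (simp add: c_def C_def power_int_add power_int_diff right_diff_distrib)
    also have "\<dots> = H 4 (Suc b) * H 1 a * ((- (q ^ 4)) ^ a * g a)"
      using interval'[OF _ ab(1) ab(4), of 4] by simp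
    finally have 2: "(\<Prod>k'\<in>S-{(0,k)}. 1 - c k' / C) =
       (H 5 b * H 5 a * (H 4 (Suc b) * H 1 a)) * (((- 1) ^ a * g a) * ((- (q ^ 4)) ^ a * g a))"
      by (simp add: mult_ac)
    define h where "h = ((- (q ^ 2)) ^ a * g a) ^ 2"
    have h: "h \<noteq> 0" using g q by (simp add: h_def)
    have h': "((- 1) ^ a * g a) * ((- (q ^ 4)) ^ a * g a) = h"
    proof -
      have "(- 1) ^ a * (- (q ^ 4)) ^ a = (q ^ 4) ^ a"
        by (simp flip: power_mult_distrib)
      moreover have "((- (q ^ 2)) ^ a) ^ 2 = ((- (q ^ 2)) ^ 2) ^ a"
        by (simp only: power_mult [symmetric] mult.commute)
      hence "((- (q ^ 2)) ^ a) ^ 2 = (q ^ 4) ^ a"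
        by (simp flip: power_mult)
      ultimately show ?thesis by (simp add: h_def power_mult_distrib power2_eq_square mult_ac)
    qed
    have e: "q ^ 2 * C = q powi (5 * k + 2)" "C / q ^ 2 = q powi (5 * k - 2)"
      using q by (simp_all add: C_def power_int_add power_int_diff)
    have k2: "5 * k + 2 \<noteq> 0" "2 \<noteq> 5 * k" by presburger+
    have "q ^ 2 \<noteq> C" using inj[of 2 "5 * k"] k2 by (simp add: C_def)
    moreover have "1 - q ^ 2 * C \<noteq> 0" using ne1[OF k2(1)] by (simp add: e)
    moreover have "C \<noteq> 0" using q by (simp add: C_def)
    ultimately have sp: "(1 - q ^ 4) * (y / d / (1 - z * C)) = (y * (1 - 1 / C * q ^ 2) / d) *
        (1 / (1 - q ^ 2 * C) - 1 / (1 - C / q ^ 2))" for y d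
      by (intro split)
    have canc: "X * h / (D * h) * T = T * (X / D)" for X D T using h by simp
    show ?thesis
      unfolding cC sp 1 2 h' h_def [symmetric] e a_def [symmetric] b_def [symmetric] ab(3)
      by (rule canc)
  qed

  have rhs4: "(1 - q ^ 4) * (poly p (1 / c (4, k)) / (\<Prod>k'\<in>S-{(4,k)}. 1 - c k' / c (4, k)) / (1 - z * c (4, k))) =
      - ((1 / (1 - q powi (5 * k + 6)) - 1 / (1 - q powi (5 * k + 2))) *
       ((H 3 (nat (int N - k)) * H 2 (nat (int N + k + 1))) ^ 2 /
        (H 5 (nat (int N - k)) * H 5 (nat (int N + k)) *
         (H 1 (nat (int N - k)) * H 4 (nat (int N + k + 1))))))" if k: "k \<in> ?I" for k
  proof -
    define a b where "a = nat (int N + k)" and "b = nat (int N - k)"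
    have ab: "int a = int N + k" "int b = int N - k" "nat (int N + k + 1) = Suc a"
      "int (Suc a) = int N + (k + 1)" "int b = int N - (k + 1) + 1"
      using k by (auto simp: a_def b_def)
    define C where "C = q powi (5 * k + 4)"
    have cC: "c (4, k) = C" by (simp add: c_def C_def)
    have "poly p (1 / C) * (1 - 1 / C * q ^ 2) = (\<Prod>j\<in>?I. 1 - q powi (5 * (j - (k + 1)) + int 3)) ^ 2"
    proof -
      have "1 / C * q powi (5 * j + 2) = q powi (5 * (j - (k + 1)) + int 3)" for j
        using q by (simp add: C_def algebra_simps flip: power_int_diff)
      thus ?thesis unfolding poly_p by (simp only:)
    qed
    also have "\<dots> = (H 3 b * H 2 (Suc a) * ((- (q ^ 3)) ^ Suc a * g (Suc a))) ^ 2"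
      using interval'[OF _ ab(4,5), of 3] by simp
    finally have 1: "poly p (1 / C) * (1 - 1 / C * q ^ 2) =
        (H 3 b * H 2 (Suc a)) ^ 2 * ((- (q ^ 3)) ^ Suc a * g (Suc a)) ^ 2"
      by (simp only: power_mult_distrib)
    have "(\<Prod>k'\<in>S-{(4,k)}. 1 - c k' / C) = (\<Prod>j\<in>?I-{k}. 1 - c (4, j) / C) * (\<Prod>j\<in>?I. 1 - c (0, j) / C)"
    proof -
      have "S - {(4,k)} = Pair 4 ` (?I - {k}) \<union> Pair 0 ` ?I" by (auto simp: S_def)
      hence "(\<Prod>k'\<in>S-{(4,k)}. 1 - c k' / C) = (\<Prod>k'\<in>Pair 4 ` (?I - {k}). 1 - c k' / C) * (\<Prod>k'\<in>Pair 0 ` ?I. 1 - c k' / C)"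
        by (simp only:) (rule prod.union_disjoint, auto)
      thus ?thesis by (simp add: prod.reindex inj_on_def)
    qed
    also have "(\<Prod>j\<in>?I-{k}. 1 - c (4, j) / C) = (\<Prod>j\<in>?I-{k}. 1 - q powi (5 * (j - k)))"
    proof -
      have "c (4, j) / C = q powi (5 * (j - k))" for j
        using q by (simp add: c_def C_def algebra_simps flip: power_int_diff)
      thus ?thesis by (simp only:)
    qed
    also have "\<dots> = H 5 b * H 5 a * ((- 1) ^ a * g a)"
      using delete[OF ab(1,2)] .
    also have "(\<Prod>j\<in>?I. 1 - c (0, j) / C) = (\<Prod>j\<in>?I. 1 - q powi (5 * (j - (k + 1)) + int 1))"
    proof -
      have "c (0, j) / C = q powi (5 * (j - (k + 1)) + int 1)" for j
        using q by (simp add: c_def C_def algebra_simps flip: power_int_diff)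
      thus ?thesis by (simp only:)
    qed
    also have "\<dots> = H 1 b * H 4 (Suc a) * ((- (q ^ 1)) ^ Suc a * g (Suc a))"
      using interval'[OF _ ab(4,5), of 1] by simp
    finally have 2: "(\<Prod>k'\<in>S-{(4,k)}. 1 - c k' / C) =
       (H 5 b * H 5 a * (H 1 b * H 4 (Suc a))) * (((- 1) ^ a * g a) * ((- (q ^ 1)) ^ Suc a * g (Suc a)))"
      by (simp only: mult_ac)
    define h where "h = ((- (q ^ 3)) ^ Suc a * g (Suc a)) ^ 2"
    have h: "h \<noteq> 0" using g q by (simp add: h_def)
    \<comment> \<open>For the poles of class 4 the monomials of numerator and denominator differ in
      sign, which explains the minus between the two sums of the statement.\<close>
    have h': "((- 1) ^ a * g a) * ((- (q ^ 1)) ^ Suc a * g (Suc a)) = - h"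
    proof -
      have q1: "(- 1) ^ a * (- (q ^ 1)) ^ Suc a = - (q ^ Suc a)"
      proof -
        have "(- (q ^ 1)) ^ Suc a = (- 1) ^ Suc a * q ^ Suc a"
          unfolding power_one_right by (rule power_minus)
        also have "\<dots> = (- 1) ^ a * (- (q ^ Suc a))" by simp
        finally have "(- 1) ^ a * (- (q ^ 1)) ^ Suc a = ((- 1) ^ a * (- 1) ^ a) * (- (q ^ Suc a))"
          by (simp only: mult.assoc)
        also have "(- 1) ^ a * (- 1) ^ a = (1 :: 'a)" by (simp flip: power_mult_distrib)
        finally show ?thesis by simp
      qed
      have "((- (q ^ 3)) ^ Suc a) ^ 2 = ((- (q ^ 3)) ^ 2) ^ Suc a"
        by (simp only: power_mult [symmetric] mult.commute)
      also have "\<dots> = (q ^ 6) ^ Suc a"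
        by (simp only: power2_minus power_mult [symmetric]) simp
      also have "\<dots> = q ^ (Suc a + 5 * Suc a)"
        unfolding power_mult [symmetric] by (rule arg_cong) simp
      finally have q6: "((- (q ^ 3)) ^ Suc a) ^ 2 = q ^ Suc a * q ^ (5 * Suc a)"
        by (simp only: power_add)
      have "((- 1) ^ a * g a) * ((- (q ^ 1)) ^ Suc a * g (Suc a)) =
          ((- 1) ^ a * (- (q ^ 1)) ^ Suc a) * q ^ (5 * Suc a) * (g (Suc a) * g (Suc a))"
        unfolding gn[of a] by (simp only: mult_ac)
      also have "\<dots> = - ((q ^ Suc a * q ^ (5 * Suc a)) * (g (Suc a) * g (Suc a)))"
        unfolding q1 by simp
      also have "\<dots> = - h"
        unfolding h_def q6 [symmetric] by (simp only: power_mult_distrib power2_eq_square mult_ac)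
      finally show ?thesis .
    qed
    have "q ^ 2 * C = q powi (2 + (5 * k + 4))" "C / q ^ 2 = q powi ((5 * k + 4) - 2)"
      unfolding C_def using power_int_add[of q 2 "5 * k + 4"] power_int_diff[of q "5 * k + 4" 2] q
      by (auto simp del: power_int_add power_int_diff)
    hence e: "q ^ 2 * C = q powi (5 * k + 6)" "C / q ^ 2 = q powi (5 * k + 2)"
      by (simp_all add: algebra_simps)
    have k2: "5 * k + 6 \<noteq> 0" "2 \<noteq> 5 * k + 4" by presburger+
    have "q ^ 2 \<noteq> C" using inj[of 2 "5 * k + 4"] k2 by (simp add: C_def)
    moreover have "1 - q ^ 2 * C \<noteq> 0" using ne1[OF k2(1)] by (simp add: e)
    moreover have "C \<noteq> 0" using q by (simp add: C_def)
    ultimately have sp: "(1 - q ^ 4) * (y / d / (1 - z * C)) = (y * (1 - 1 / C * q ^ 2) / d) *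
        (1 / (1 - q ^ 2 * C) - 1 / (1 - C / q ^ 2))" for y d
      by (intro split)
    have canc: "X * h / (D * (- h)) * T = - (T * (X / D))" for X D T using h by simp
    show ?thesis
      unfolding cC sp 1 2 h' h_def [symmetric] e a_def [symmetric] b_def [symmetric] ab(3)
      by (rule canc)
  qed
  have "(1 - q ^ 4) * (poly p z / (\<Prod>k\<in>S. 1 - z * c k)) =
    (\<Sum>k\<in>?I. (1 - q ^ 4) * (poly p (1 / c (0, k)) / (\<Prod>k'\<in>S-{(0,k)}. 1 - c k' / c (0, k)) / (1 - z * c (0, k)))) +
    (\<Sum>k\<in>?I. (1 - q ^ 4) * (poly p (1 / c (4, k)) / (\<Prod>k'\<in>S-{(4,k)}. 1 - c k' / c (4, k)) / (1 - z * c (4, k))))"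
    unfolding pf S_sum by (simp only: distrib_left sum_distrib_left)
  thus ?thesis
    unfolding lhs by (simp only: rhs0 rhs4 cong: sum.cong) (simp only: N_def sum_negf diff_conv_add_uminus)
qed

section \<open>Kronecker's series\<close>

lemma fps_nth_inverse_one_minus_monom:
  fixes c :: "'a :: field"
  assumes "m > 0"
  shows "fps_nth (inverse (1 - fps_const c * fps_X ^ m)) n = (if m dvd n then c ^ (n div m) else 0)"
proof -
  define F where "F = Abs_fps (\<lambda>n. if m dvd n then c ^ (n div m) else 0)"
  have "(1 - fps_const c * fps_X ^ m) * F = 1"
  proof (rule fps_ext)
    fix n
    have "fps_nth ((1 - fps_const c * fps_X ^ m) * F) n = fps_nth F n - c * fps_nth (fps_X ^ m * F) n"
      by (simp add: left_diff_distrib mult.assoc)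
    also have "\<dots> = fps_nth F n - (if n < m then 0 else c * fps_nth F (n - m))"
      by (simp add: fps_X_power_mult_nth)
    also have "\<dots> = fps_nth 1 n"
    proof (cases "n < m")
      case True
      hence "m dvd n \<longleftrightarrow> n = 0" using nat_dvd_not_less[of n m] by (cases "n = 0") auto
      thus ?thesis using True by (auto simp: F_def)
    next
      case False
      hence "m dvd n - m \<longleftrightarrow> m dvd n" by (metis dvd_minus_self leI)
      moreover have "c * c ^ ((n - m) div m) = c ^ (n div m)"
        using False assms by (simp add: le_div_geq)
      moreover have "n \<noteq> 0" using False assms by simp
      ultimately show ?thesis using False by (simp add: F_def)
    qed
    finally show "fps_nth ((1 - fps_const c * fps_X ^ m) * F) n = fps_nth 1 n" .
  qed
  hence "inverse (1 - fps_const c * fps_X ^ m) = F"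
    by (rule fps_inverse_unique)
  thus ?thesis by (simp add: F_def)
qed

declare fls_X_power_int [simp del]

text \<open>The expansion of $1/(1 - q^m)$ in nonnegative powers of $q$ for every nonzero integer
  \<open>m\<close>. For negative \<open>m\<close> it is rewritten as $-q^{-m}/(1 - q^{-m})$.\<close>

definition geom :: "int \<Rightarrow> complex fps" where
  "geom m = (if m > 0 then inverse (1 - fps_X ^ nat m)
             else - (fps_X ^ nat (- m) * inverse (1 - fps_X ^ nat (- m))))"

lemma fps_X_power_to_fls: "a \<ge> 0 \<Longrightarrow> fps_to_fls (fps_X ^ nat a :: complex fps) = fls_X powi a"
  unfolding fps_to_fls_power power_int_def by simp

lemma inverse_one_minus_X_power_to_fls:
  "a > 0 \<Longrightarrow> fps_to_fls (inverse (1 - fps_X ^ nat a :: complex fps)) = 1 / (1 - fls_X powi a)"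
  by (subst fps_to_fls_inverse) (simp_all add: fps_X_power_to_fls divide_inverse)

lemma reflect_one_over_one_minus:
  fixes y :: "'a :: field"
  assumes "y \<noteq> 0" shows "- (y * (1 / (1 - y))) = 1 / (1 - 1 / y)"
proof (cases "y = 1")
  case False
  hence "1 - y \<noteq> 0" "y - 1 \<noteq> 0" by auto
  thus ?thesis using assms by (simp add: field_simps)
qed auto

lemma geom_to_fls: "m \<noteq> 0 \<Longrightarrow> fps_to_fls (geom m) = 1 / (1 - fls_X powi m)"
proof (cases "m > 0")
  case False
  assume "m \<noteq> 0"
  hence "fps_to_fls (geom m) = - (fls_X powi (- m) * (1 / (1 - fls_X powi (- m))))"
    using False
    by (simp add: geom_def fls_times_fps_to_fls inverse_one_minus_X_power_to_fls fps_X_power_to_fls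
         )
  also have "\<dots> = 1 / (1 - 1 / fls_X powi (- m))" by (rule reflect_one_over_one_minus) simp
  also have "1 / fls_X powi (- m) = (fls_X powi m :: complex fls)" by (simp add: power_int_minus divide_inverse)
  finally show ?thesis .
qed (simp add: geom_def inverse_one_minus_X_power_to_fls)

text \<open>The reason for counting divisors of both signs: at positive exponents,
  \<open>geom m\<close> and \<open>geom (- m)\<close> have opposite coefficients. Their constant
  coefficients do not follow this rule.\<close>

lemma geom_nth:
  assumes "n > 0"
  shows "fps_nth (geom m) n = (if m dvd int n then of_int (sgn m) else 0)"
proof (cases "m > 0")
  case True
  then obtain k where k: "m = int k" "k > 0" using zero_less_imp_eq_int by blast
  have "fps_nth (geom m) n = (if k dvd n then 1 else 0)"
    using fps_nth_inverse_one_minus_monom[of k "1::complex" n] k by (simp add: geom_def)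
  thus ?thesis using k by simp
next
  case False
  show ?thesis
  proof (cases "m = 0")
    case True
    thus ?thesis using assms by (simp add: geom_def)
  next
    case m0: False
    then obtain k where k: "m = - int k" "k > 0"
      using False by (metis linorder_neqE neg_0_less_iff_less zero_less_imp_eq_int minus_equation_iff)
    have "fps_nth (geom m) n = - (if n < k then 0 else if k dvd n - k then 1 else 0)"
      using fps_nth_inverse_one_minus_monom[of k "1::complex" "n - k"] k
      by (simp add: geom_def fps_X_power_mult_nth)
    also have "\<dots> = - (if k dvd n then 1 else 0)"
      using assms by (auto dest: dvd_imp_le) (metis dvd_minus_self leI not_less)+
    finally show ?thesis using k by simp
  qed
qed

lemma geom_nth_0: "fps_nth (geom m) 0 = (if m > 0 then 1 else 0)"
  by (auto simp: geom_def)

lemma qprod_fls: "qprod (fls_X ^ d) (fls_X ^ i) n = fps_to_fls (qpn 1 i d n)"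
  unfolding qpn_to_fls qprod_def by simp

lemma power_mult_powi:
  fixes q :: "'a :: field"
  assumes "q \<noteq> 0"
  shows "q ^ i * (q ^ d) powi k = q powi (int d * k + int i)" "(q ^ l) powi k = q powi (int l * k)"
  using assms power_int_mult[of q "int d" k] power_int_mult[of q "int l" k]
  by (simp_all add: power_int_add)

text \<open>The quotient $q^{lk}/(1 - q^{dk+i})$. For negative \<open>k\<close> the numerator alone
  would have a negative exponent; after reflecting the denominator the total exponent is positive if
  \<open>i + l < d\<close>.\<close>

definition kronecker_term :: "nat \<Rightarrow> nat \<Rightarrow> nat \<Rightarrow> int \<Rightarrow> complex fps" where
  "kronecker_term d i l k =
     (if k \<ge> 0 then fps_X ^ nat (int l * k) * geom (int d * k + int i)
      else - (fps_X ^ nat (int l * k - (int d * k + int i)) * geom (- (int d * k + int i))))"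

text \<open>The exponent is $(d - l)(-k) - i$, and $d - l$ is at least $i + 1$. Its linear growth in
  $-k$ makes the bilateral sum locally finite.\<close>

lemma kronecker_term_exponent:
  assumes "i + l < d" "k < (0 :: int)"
  shows "int l * k - (int d * k + int i) > - k - 1" "int d * k + int i < 0"
proof -
  have "(int d - int l) * (- k) \<ge> (int i + 1) * (- k)"
    using assms by (intro mult_right_mono) auto
  moreover have "int i * (- k) \<ge> int i * 1" using assms by (intro mult_left_mono) auto
  ultimately show 1: "int l * k - (int d * k + int i) > - k - 1" by (simp add: algebra_simps)
  have "int l * k \<le> 0" using assms by (simp add: mult_nonneg_nonpos)
  thus "int d * k + int i < 0" using 1 assms by linarith
qed

lemma kronecker_term_to_fls:
  assumes "i > 0" "l > 0" "i + l < d"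
  shows "fps_to_fls (kronecker_term d i l k) = (fls_X ^ l) powi k / (1 - fls_X ^ i * (fls_X ^ d) powi k)"
proof -
  define m where "m = int d * k + int i"
  have e: "fls_X ^ i * (fls_X ^ d) powi k = (fls_X powi m :: complex fls)"
    "(fls_X ^ l) powi k = (fls_X powi (int l * k) :: complex fls)"
    unfolding m_def using power_mult_powi fls_X_nonzero by blast+
  show ?thesis
  proof (cases "k \<ge> 0")
    case True
    hence "m > 0" using assms by (simp add: m_def add_nonneg_pos)
    thus ?thesis unfolding e using True
      by (simp add: kronecker_term_def fls_times_fps_to_fls geom_to_fls fps_X_power_to_fls flip: m_def)
  next
    case False
    hence m: "m < 0" "int l * k - m > 0"
      using kronecker_term_exponent[OF assms(3), of k] by (simp_all add: m_def)
    have "fps_to_fls (kronecker_term d i l k) =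
        - (fls_X powi (int l * k - m) * (1 / (1 - fls_X powi (- m))))"
      using False m
      by (simp add: kronecker_term_def fls_times_fps_to_fls geom_to_fls fps_X_power_to_fls flip: m_def)
    also have "\<dots> = fls_X powi (int l * k) * (- (fls_X powi (- m) * (1 / (1 - fls_X powi (- m)))))"
      by (simp add: power_int_diff power_int_minus divide_inverse)
    also have "- (fls_X powi (- m) * (1 / (1 - fls_X powi (- m)))) = 1 / (1 - (fls_X powi m :: complex fls))"
      by (subst reflect_one_over_one_minus) (simp_all add: power_int_minus divide_inverse)
    finally show ?thesis unfolding e by simp
  qed
qed

lemma fps_nth_X_power_mult_eq_0:
  "n < a \<Longrightarrow> fps_nth (fps_X ^ a * f) n = (0 :: 'a :: comm_ring_1)"
  by (simp add: fps_X_power_mult_nth)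

text \<open>Kronecker's identity with $c = q^i$, $x = q^l$ and base $q^d$, as the limit of
  \<open>finite_kronecker_sum\<close>. All weights tend to the same unit \<open>U\<close>, whose
  inverse is moved to the product side.\<close>

lemma kronecker_sum:
  assumes i: "i > 0" "l > 0" "i + l < d"
  shows "(kronecker_term d i l has_sum
     qp 1 d d ^ 2 * (qp 1 (i + l) d * qp 1 (d - i - l) d) *
     inverse (qp 1 i d * qp 1 (d - i) d * (qp 1 l d * qp 1 (d - l) d))) UNIV"
proof -
  have d: "d > 0" using i by simp
  define I where "I = inverse (qp 1 i d * qp 1 (d - i) d)"
  define L where "L = qp 1 (i + l) d * qp 1 (d - i - l) d * I"
  define U where "U = qp 1 l d * qp 1 (d - l) d * inverse (qp 1 d d * qp 1 d d)"
  define F where "F = (\<lambda>n. qpn 1 (i + l) d n * qpn 1 (d - i - l) d n * inverse (qpn 1 i d (n + 1) * qpn 1 (d - i) d n))"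
  define u where "u = (\<lambda>n k. qpn 1 l d (nat (int n - k)) * qpn 1 (d - l) d (nat (int n + k)) *
      inverse (qpn 1 d d (nat (int n - k)) * qpn 1 d d (nat (int n + k))))"
  let ?X = "fls_X :: complex fls"
  have F: "F n = (\<Sum>k\<in>{-int n..int n}. kronecker_term d i l k * u n k)" for n
  proof -
    have quot: "?X ^ d / ?X ^ j = ?X ^ (d - j)" if "j \<le> d" for j
      using that by (simp add: power_diff)
    have "fps_to_fls (F n) = qprod (?X ^ d) (?X ^ i * ?X ^ l) n * qprod (?X ^ d) (?X ^ d / (?X ^ i * ?X ^ l)) n /
        (qprod (?X ^ d) (?X ^ i) (Suc n) * qprod (?X ^ d) (?X ^ d / ?X ^ i) n)"
      using i quot[of "i + l"] quot[of i]
      by (simp add: F_def fls_times_fps_to_fls fps_to_fls_inverse qprod_fls divide_inverse flip: power_add)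
    also have "\<dots> = (\<Sum>k\<in>{-int n..int n}. (?X ^ l) powi k / (1 - ?X ^ i * (?X ^ d) powi k) *
       (qprod (?X ^ d) (?X ^ l) (nat (int n - k)) * qprod (?X ^ d) (?X ^ d / ?X ^ l) (nat (int n + k)) /
        (qprod (?X ^ d) (?X ^ d) (nat (int n - k)) * qprod (?X ^ d) (?X ^ d) (nat (int n + k)))))"
    proof (rule finite_kronecker_sum)
      show "(?X ^ d) ^ k \<noteq> 1" if "k > 0" for k
        using that d by (simp add: fls_X_power_eq_1_iff flip: power_mult)
      have "?X ^ k \<noteq> 1" if "k > 0" for k using that by (simp add: fls_X_power_eq_1_iff)
      hence inj: "?X powi a = ?X powi b \<longleftrightarrow> a = b" for a b
        by (intro power_int_eq_iff_of_non_root) auto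
      have ne: "int i + int d * k \<noteq> 0" for k
      proof (cases "k \<ge> 0")
        case True thus ?thesis using i by (simp add: add_pos_nonneg less_imp_neq[symmetric])
      next
        case False thus ?thesis using kronecker_term_exponent(2)[OF i(3), of k] by simp
      qed
      have "?X powi (int d * k + int i) \<noteq> ?X powi 0" for k
        using ne[of k] inj[of "int d * k + int i" 0] by (metis add.commute)
      thus "?X ^ i * (?X ^ d) powi k \<noteq> 1" for k
        unfolding power_mult_powi(1)[OF fls_X_nonzero] power_int_0_right .
    qed auto
    also have "\<dots> = fps_to_fls (\<Sum>k\<in>{-int n..int n}. kronecker_term d i l k * u n k)"
      using i quot[of l]
      by (simp add: fps_to_fls_sum u_def fls_times_fps_to_fls kronecker_term_to_fls fps_to_fls_inverse
            qprod_fls divide_inverse)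
    finally show ?thesis by simp
  qed
  have "F \<longlonglongrightarrow> L"
    unfolding F_def L_def I_def using i d
    by (intro tendsto_mult tendsto_inverse_fps qpn_LIMSEQ qpn_nat_LIMSEQ) auto
  moreover have "(\<lambda>n. u n k) \<longlonglongrightarrow> U" for k
    unfolding u_def U_def using i d
    by (intro tendsto_mult tendsto_inverse_fps qpn_nat_LIMSEQ) auto
  moreover have "finite {k\<in>UNIV. fps_nth (kronecker_term d i l k) m \<noteq> 0}" for m
  proof (rule finite_subset)
    show "{k\<in>UNIV. fps_nth (kronecker_term d i l k) m \<noteq> 0} \<subseteq> {- int m - 1..int m}"
    proof
      fix k assume k: "k \<in> {k\<in>UNIV. fps_nth (kronecker_term d i l k) m \<noteq> 0}"
      show "k \<in> {- int m - 1..int m}"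
      proof (rule ccontr)
        assume "k \<notin> {- int m - 1..int m}"
        then consider "k > int m" | "k < - int m - 1" by force
        thus False
        proof cases
          case 1
          have "1 * k \<le> int l * k" using i 1 by (intro mult_right_mono) auto
          hence "m < nat (int l * k)" using 1 by linarith
          thus False using k 1 by (simp add: kronecker_term_def fps_nth_X_power_mult_eq_0)
        next
          case 2
          hence "m < nat (int l * k - (int d * k + int i))"
            using kronecker_term_exponent(1)[OF i(3), of k] by linarith
          thus False using k 2 by (simp add: kronecker_term_def fps_nth_X_power_mult_eq_0)
        qed
      qed
    qed
  qed auto
  moreover have "eventually (\<lambda>n. k \<in> {-int n..int n}) sequentially" for k
    using eventually_ge_at_top[of "nat \<bar>k\<bar>"] by eventually_elim auto
  ultimately have "((\<lambda>k. kronecker_term d i l k * U) has_sum L) UNIV"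
    using fps_has_sum_LIMSEQ[of F L "kronecker_term d i l" u "\<lambda>n. {-int n..int n}" UNIV U] F by simp
  hence "((\<lambda>k. kronecker_term d i l k * U * inverse U) has_sum L * inverse U) UNIV"
    by (rule has_sum_cmult_left)
  moreover have "U * inverse U = 1"
    using i d by (intro inverse_mult_eq_1') (simp add: U_def)
  moreover have "inverse U = qp 1 d d ^ 2 * inverse (qp 1 l d * qp 1 (d - l) d)"
    using d by (simp add: U_def fps_inverse_mult fps_inverse_idempotent power2_eq_square mult_ac)
  ultimately show ?thesis
    by (simp add: L_def I_def mult.assoc fps_inverse_mult) (simp add: mult_ac)
qed

section \<open>Lambert series modulo 5\<close>

text \<open>
  Divisors of both signs are taken into account: a negative divisor $m \equiv r$ contributes minus
  the positive divisor $-m \equiv -r$.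
\<close>

definition signed_divisors :: "nat \<Rightarrow> nat \<Rightarrow> int" where
  "signed_divisors r n = (\<Sum>m | m dvd int n \<and> m mod 5 = int r. sgn m)"

text \<open>\<open>lambert5 1\<close> and \<open>lambert5 2\<close> are $X_1$ and $X_2$. The
  coefficient at 0 is set separately because every integer divides 0.\<close>

definition lambert5 :: "nat \<Rightarrow> complex fps" where
  "lambert5 r = Abs_fps (\<lambda>n. if n = 0 then 0 else of_int (signed_divisors r n))"

lemma finite_int_divisors: "n > 0 \<Longrightarrow> finite {m. m dvd int n \<and> P m}"
  using finite_divisors_int[of "int n"] by (rule rev_finite_subset) auto

lemma signed_divisors_reflect:
  assumes "r + s = 5" "r > 0" "s > 0"
  shows "signed_divisors r n = - signed_divisors s n"
proof -
  have neg: "(- m) mod 5 = int s" if "m mod 5 = int r" "r + s = 5" "r > 0" for m r s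
    using that zmod_zminus1_eq_if[of m 5] by auto
  have "signed_divisors r n = (\<Sum>m | m dvd int n \<and> m mod 5 = int s. - sgn m)"
    unfolding signed_divisors_def
  proof (rule sum.reindex_bij_witness[of _ uminus uminus])
    fix m
    show "- m \<in> {m. m dvd int n \<and> m mod 5 = int s}" if "m \<in> {m. m dvd int n \<and> m mod 5 = int r}"
      using that neg[of m r s] assms by auto
    show "- m \<in> {m. m dvd int n \<and> m mod 5 = int r}" if "m \<in> {m. m dvd int n \<and> m mod 5 = int s}"
      using that neg[of m s r] assms by (auto simp: add.commute)
  qed (auto simp: sgn_minus)
  thus ?thesis by (simp add: signed_divisors_def sum_negf)
qed

lemma int_dvd_bound:
  assumes "m dvd int n" "n > 0"
  shows "\<bar>m\<bar> \<le> int n"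
  using assms dvd_imp_le_int[of "int n" m] by simp

text \<open>With $m = 5k + i$ and $w = n - lk$ one has $5n + il = 5w + lm$. As \<open>m\<close> is
  prime to 5, it divides $5n + il$ if and only if it divides \<open>w\<close>, which is the
  condition for a contribution of $q^{lk}/(1 - q^m)$ to $q^n$. It remains to see that divisibility
  alone forces the exponent left for the geometric series to be nonnegative.\<close>

lemma kronecker_term_nth:
  assumes i: "0 < i" "0 < l" "i + l < 5"
  shows "fps_nth (kronecker_term 5 i l k) n =
    (if 5 * k + int i dvd 5 * int n + int (i * l) then of_int (sgn (5 * k + int i)) else 0)"
proof -
  define m where "m = 5 * k + int i"
  have m5: "coprime m 5"
  proof -
    have "\<not> 5 dvd m" using i by (auto simp: m_def) presburger
    moreover have "prime (5 :: int)" by simp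
    ultimately show ?thesis by (metis coprime_commute prime_imp_coprime_int)
  qed
  have m0: "m \<noteq> 0" using i by (auto simp: m_def) presburger
  define w where "w = int n - int l * k"
  have w: "5 * int n + int (i * l) = 5 * w + int l * m"
    by (simp add: w_def m_def algebra_simps)
  have dvd: "m dvd 5 * int n + int (i * l) \<longleftrightarrow> m dvd w"
  proof -
    have "m dvd 5 * w + int l * m \<longleftrightarrow> m dvd 5 * w" by (rule dvd_add_left_iff) simp
    also have "\<dots> \<longleftrightarrow> m dvd w" using m5 by (rule coprime_dvd_mult_right_iff)
    finally show ?thesis by (simp only: w)
  qed
  have pos: "5 * w + int l * m > 0"
    unfolding w [symmetric] using i by (simp add: add_nonneg_pos)
  show ?thesis
  proof (cases "k \<ge> 0")
    case True
    have mpos: "m > 0" using True i by (simp add: m_def)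
    \<comment> \<open>A negative multiple \<open>w\<close> of \<open>m\<close> would be at most
      $-m$, and then $5w + lm$ would be at most $-5m + 4m$, against \<open>pos\<close>.\<close>
    have w0: "w \<ge> 0" if "m dvd w"
    proof (rule ccontr)
      assume "\<not> w \<ge> 0"
      hence "m dvd - w" "- w > 0" using that by auto
      hence "m \<le> - w" by (rule zdvd_imp_le)
      moreover have "int l * m \<le> 4 * m" using i mpos by (intro mult_right_mono) auto
      ultimately show False using pos mpos by linarith
    qed
    obtain p where p: "m = int p" "p > 0" using mpos zero_less_imp_eq_int by blast
    have lk: "int (nat (int l * k)) = int l * k" using True by simp
    have "fps_nth (kronecker_term 5 i l k) n =
        (if n < nat (int l * k) then 0 else fps_nth (geom m) (n - nat (int l * k)))"
      using True by (simp add: kronecker_term_def fps_X_power_mult_nth m_def)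
    also have "\<dots> = (if m dvd w then 1 else 0)"
    proof (cases "n < nat (int l * k)")
      case True
      hence "w < 0" using lk by (simp add: w_def)
      thus ?thesis using True w0 by auto
    next
      case False
      define r where "r = n - nat (int l * k)"
      have r: "int r = w" using False lk by (simp add: r_def w_def of_nat_diff)
      have "fps_nth (geom m) r = (if m dvd int r then 1 else 0)"
      proof (cases "r = 0")
        case True thus ?thesis using mpos by (simp add: geom_nth_0)
      next
        case False thus ?thesis using mpos by (simp add: geom_nth)
      qed
      thus ?thesis using False r by (simp add: r_def)
    qed
    finally show ?thesis using dvd mpos by (simp add: m_def)
  next
    case False
    note e = kronecker_term_exponent[of i l 5 k]
    have mneg: "m < 0" and elow: "int l * k - m > 0" using e False i by (simp_all add: m_def)
    define E where "E = nat (int l * k - m)"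
    have E: "int E = int l * k - m" using elow by (simp add: E_def)
    \<comment> \<open>If $w + m$ were negative it would be at most \<open>m\<close>, so
      \<open>w\<close> would not be positive, and $5w + lm$ would not be either.\<close>
    have wm: "w + m \<ge> 0" if "m dvd w"
    proof (rule ccontr)
      assume *: "\<not> w + m \<ge> 0"
      have "m dvd w + m" using that by simp
      hence "- m dvd - (w + m)" by simp
      moreover have "- (w + m) > 0" using * by simp
      ultimately have "- m \<le> - (w + m)" by (rule zdvd_imp_le)
      hence "w \<le> 0" by simp
      moreover have "int l * m \<le> 0" using mneg by (simp add: mult_nonneg_nonpos)
      ultimately show False using pos by linarith
    qed
    have "fps_nth (kronecker_term 5 i l k) n = - (if n < E then 0 else fps_nth (geom (- m)) (n - E))"
      using False by (simp add: kronecker_term_def fps_X_power_mult_nth m_def E_def)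
    also have "\<dots> = - (if m dvd w then 1 else 0)"
    proof (cases "n < E")
      case True
      hence "w + m < 0" using E by (simp add: w_def)
      thus ?thesis using True wm by auto
    next
      case False
      define r where "r = n - E"
      have r: "int r = w + m" using False E by (simp add: r_def w_def of_nat_diff)
      have "fps_nth (geom (- m)) r = (if m dvd int r then 1 else 0)"
      proof (cases "r = 0")
        case True thus ?thesis using mneg by (simp add: geom_nth_0)
      next
        case False thus ?thesis using mneg by (simp add: geom_nth)
      qed
      thus ?thesis using False r by (simp add: r_def)
    qed
    finally show ?thesis using dvd mneg by (simp add: m_def)
  qed
qed

text \<open>As \<open>k\<close> runs through the integers, $5k + i$ runs through the whole residue
  class of \<open>i\<close>, negative members included. Kronecker's series is thus the section of a
  Lambert series at the exponents $5n + il$.\<close>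

lemma kronecker_sum_nth:
  assumes i: "0 < i" "0 < l" "i + l < 5"
    and S: "(kronecker_term 5 i l has_sum S) UNIV"
  shows "fps_nth S n = of_int (signed_divisors i (5 * n + i * l))"
proof -
  define M where "M = 5 * n + i * l"
  have M: "M > 0" "int M = 5 * int n + int (i * l)" using i by (simp_all add: M_def)
  have nth: "fps_nth (kronecker_term 5 i l k) n = (if 5 * k + int i dvd int M then of_int (sgn (5 * k + int i)) else 0)" for k
    using kronecker_term_nth[OF i] M by simp
  have nz: "sgn (5 * k + int i) \<noteq> 0" for k using i by (simp add: sgn_eq_0_iff) presburger
  have "fps_nth S n = (\<Sum>k | 5 * k + int i dvd int M. of_int (sgn (5 * k + int i)))"
    using has_sum_fpsD(2)[OF S, of n] nz by (simp add: nth cong: conj_cong)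
  also have "\<dots> = (\<Sum>m | m dvd int M \<and> m mod 5 = int i. of_int (sgn m))"
  proof (rule sum.reindex_bij_witness[of _ "\<lambda>m. m div 5" "\<lambda>k. 5 * k + int i"])
    show "5 * (m div 5) + int i = m" if "m \<in> {m. m dvd int M \<and> m mod 5 = int i}" for m
      using that by (metis (mono_tags, lifting) mem_Collect_eq mult_div_mod_eq)
    thus "m div 5 \<in> {k. 5 * k + int i dvd int M}" if "m \<in> {m. m dvd int M \<and> m mod 5 = int i}" for m
      using that by simp
  qed (use i in auto)
  finally show ?thesis by (simp add: signed_divisors_def M_def)
qed

text \<open>The limit of \<open>finite_triple_quotient\<close>. At a positive exponent the
  differences of geometric series can be summed separately and give the divisor sums of the classes
  2, 3, 1 and 2 with signs $+, -, -, +$. Since class 3 is minus class 2, the total is $3 X_2 -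
  X_1$.\<close>

lemma lambert_triple_quotient:
  defines "E \<equiv> qp 1 5 5" and "A \<equiv> qp 1 1 5 * qp 1 4 5" and "B \<equiv> qp 1 2 5 * qp 1 3 5"
  shows "lambert5 1 - 3 * lambert5 2 = fps_X * (A ^ 2 * E ^ 2 * inverse B ^ 3)"
proof -
  \<comment> \<open>The Boolean distinguishes the poles of class 0 from those of class 4.\<close>
  define t where "t = (\<lambda>(b, k). if b then geom (5 * k + 2) - geom (5 * k - 2) else - (geom (5 * k + 6) - geom (5 * k + 2)))"
  define u where "u = (\<lambda>n (b, k).
      if b then (qpn 1 2 5 (nat (int (n+1) - k + 1)) * qpn 1 3 5 (nat (int (n+1) + k))) ^ 2 *
        inverse (qpn 1 5 5 (nat (int (n+1) - k)) * qpn 1 5 5 (nat (int (n+1) + k)) *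
         (qpn 1 4 5 (nat (int (n+1) - k + 1)) * qpn 1 1 5 (nat (int (n+1) + k))))
      else (qpn 1 3 5 (nat (int (n+1) - k)) * qpn 1 2 5 (nat (int (n+1) + k + 1))) ^ 2 *
        inverse (qpn 1 5 5 (nat (int (n+1) - k)) * qpn 1 5 5 (nat (int (n+1) + k)) *
         (qpn 1 1 5 (nat (int (n+1) - k)) * qpn 1 4 5 (nat (int (n+1) + k + 1)))))"
  define F where "F = (\<lambda>n. - fps_X * (qpn 1 4 5 (n+2) * qpn 1 1 5 (n+1)) ^ 2 *
     inverse (qpn 1 2 5 (n+2) * qpn 1 3 5 (n+1) * (qpn 1 1 5 (n+3) * qpn 1 4 5 n)))"
  define L where "L = - fps_X * (qp 1 4 5 * qp 1 1 5) ^ 2 * inverse (qp 1 2 5 * qp 1 3 5 * (qp 1 1 5 * qp 1 4 5))"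
  define U where "U = B ^ 2 * inverse (E * E * A)"
  define I where "I = (\<lambda>n. (UNIV :: bool set) \<times> {-int (n+1)..int (n+1)})"
  let ?X = "fls_X :: complex fls"
  have Isum: "(\<Sum>x\<in>I n. f x) = (\<Sum>k\<in>{-int (n+1)..int (n+1)}. f (True, k)) + (\<Sum>k\<in>{-int (n+1)..int (n+1)}. f (False, k))"
    for n and f :: "bool \<times> int \<Rightarrow> 'z :: comm_monoid_add"
  proof -
    have "I n = Pair True ` {-int (n+1)..int (n+1)} \<union> Pair False ` {-int (n+1)..int (n+1)}"
      unfolding I_def by (auto simp: image_iff)
    thus ?thesis by (simp only:) (subst sum.union_disjoint, auto simp: sum.reindex inj_on_def)
  qed
  have ne: "5 * k + 2 \<noteq> 0" "5 * k - 2 \<noteq> 0" "5 * k + 6 \<noteq> 0" for k :: int by presburger+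
  have F: "F n = (\<Sum>x\<in>I n. t x * u n x)" for n
  proof -
    have H: "qprod (?X ^ 5) (?X ^ j) m = fps_to_fls (qpn 1 j 5 m)" for j m
      by (rule qprod_fls)
    have X1: "?X ^ k \<noteq> 1" if "k > 0" for k using that by (simp add: fls_X_power_eq_1_iff)
    note ft = finite_triple_quotient[of ?X n, OF fls_X_nonzero X1, unfolded H]
    have tT: "fps_to_fls (t (True, k)) = 1 / (1 - ?X powi (5 * k + 2)) - 1 / (1 - ?X powi (5 * k - 2))"
      and tF: "fps_to_fls (t (False, k)) = - (1 / (1 - ?X powi (5 * k + 6)) - 1 / (1 - ?X powi (5 * k + 2)))" for k
      by (simp_all only: t_def prod.case if_True if_False fps_to_fls_minus fps_to_fls_uminus geom_to_fls[OF ne(1)]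
          geom_to_fls[OF ne(2)] geom_to_fls[OF ne(3)])
    have inv: "fps_to_fls (v * inverse w) = fps_to_fls v / fps_to_fls w" if "fps_nth w 0 = 1" for v w :: "complex fps"
      using that by (simp add: fls_times_fps_to_fls fps_to_fls_inverse divide_inverse)
    have "fps_to_fls (F n) = - ?X * (fps_to_fls (qpn 1 4 5 (n+2)) * fps_to_fls (qpn 1 1 5 (n+1))) ^ 2 /
      (fps_to_fls (qpn 1 2 5 (n+2)) * fps_to_fls (qpn 1 3 5 (n+1)) * (fps_to_fls (qpn 1 1 5 (n+3)) * fps_to_fls (qpn 1 4 5 n)))"
      unfolding F_def by (subst inv) (simp_all add: fls_times_fps_to_fls fps_to_fls_power)
    also have "\<dots> = (\<Sum>k\<in>{-int (n+1)..int (n+1)}. fps_to_fls (t (True, k) * u n (True, k))) +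
        (\<Sum>k\<in>{-int (n+1)..int (n+1)}. fps_to_fls (t (False, k) * u n (False, k)))"
    proof -
      have uT: "fps_to_fls (u n (True, k)) =
        ((fps_to_fls (qpn 1 2 5 (nat (int (n+1) - k + 1))) * fps_to_fls (qpn 1 3 5 (nat (int (n+1) + k)))) ^ 2 /
        (fps_to_fls (qpn 1 5 5 (nat (int (n+1) - k))) * fps_to_fls (qpn 1 5 5 (nat (int (n+1) + k))) *
         (fps_to_fls (qpn 1 4 5 (nat (int (n+1) - k + 1))) * fps_to_fls (qpn 1 1 5 (nat (int (n+1) + k))))))"
        for k
        unfolding u_def prod.case if_True
        by (subst inv) (simp_all only: fls_times_fps_to_fls fps_to_fls_power fps_mult_nth_0 qpn_nth_0
            zero_less_numeral zero_less_one mult_1)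
      have uF: "fps_to_fls (u n (False, k)) =
        ((fps_to_fls (qpn 1 3 5 (nat (int (n+1) - k))) * fps_to_fls (qpn 1 2 5 (nat (int (n+1) + k + 1)))) ^ 2 /
        (fps_to_fls (qpn 1 5 5 (nat (int (n+1) - k))) * fps_to_fls (qpn 1 5 5 (nat (int (n+1) + k))) *
         (fps_to_fls (qpn 1 1 5 (nat (int (n+1) - k))) * fps_to_fls (qpn 1 4 5 (nat (int (n+1) + k + 1))))))"
        for k
        unfolding u_def prod.case if_False
        by (subst inv) (simp_all only: fls_times_fps_to_fls fps_to_fls_power fps_mult_nth_0 qpn_nth_0
            zero_less_numeral zero_less_one mult_1)
      show ?thesis
        unfolding fls_times_fps_to_fls tT tF uT uF
        by (subst ft) (assumption, simp only: diff_conv_add_uminus sum_negf mult_minus_left)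
    qed
    also have "\<dots> = fps_to_fls (\<Sum>x\<in>I n. t x * u n x)"
      by (simp only: Isum fps_to_fls_sum fps_to_fls_plus)
    finally have "fps_to_fls (F n) = fps_to_fls (\<Sum>x\<in>I n. t x * u n x)" .
    thus ?thesis by simp
  qed
  have lim: "F \<longlonglongrightarrow> L"
    unfolding F_def L_def power2_eq_square
    by (intro tendsto_mult tendsto_inverse_fps tendsto_const qpn_LIMSEQ qpn_nat_LIMSEQ) auto
  have lim': "(\<lambda>n. u n x) \<longlonglongrightarrow> U" for x
  proof (cases x)
    case (Pair b k)
    have shift: "int (n + 1) + k = int n + (k + 1)" "int (n + 1) - k = int n - (k - 1)"
      "int n - (k - 1) + 1 = int n - (k - 2)" "int n + (k + 1) + 1 = int n + (k + 2)" for n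
      by simp_all
    have U: "U = (qp 1 2 5 * qp 1 3 5) ^ 2 * inverse (qp 1 5 5 * qp 1 5 5 * (qp 1 4 5 * qp 1 1 5))"
      "U = (qp 1 3 5 * qp 1 2 5) ^ 2 * inverse (qp 1 5 5 * qp 1 5 5 * (qp 1 1 5 * qp 1 4 5))"
      by (simp_all add: U_def E_def A_def B_def mult_ac)
    show ?thesis
    proof (cases b)
      case True
      show ?thesis unfolding u_def Pair prod.case if_P[OF True] shift U(1) power2_eq_square
        by (intro tendsto_mult tendsto_inverse_fps qpn_nat_LIMSEQ) auto
    next
      case False
      show ?thesis unfolding u_def Pair prod.case if_not_P[OF False] shift U(2) power2_eq_square
        by (intro tendsto_mult tendsto_inverse_fps qpn_nat_LIMSEQ) auto
    qed
  qed
  have geom0: "fps_nth (geom m) n = (if n = 0 \<and> m > 0 then 1 else 0)" if "\<bar>m\<bar> > int n" for m n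
  proof (cases "n = 0")
    case False
    thus ?thesis using that int_dvd_bound[of m n] by (auto simp: geom_nth)
  qed (simp add: geom_nth_0)
  \<comment> \<open>A single \<open>geom m\<close> has constant coefficient 1 for every positive
    \<open>m\<close>, so the separate families are not locally finite. Beyond this range the two
    exponents of a difference have the same sign and exceed \<open>n\<close> in absolute value, and
    the constant coefficients cancel.\<close>
  have t0: "fps_nth (t x) n = 0" if "x \<notin> UNIV \<times> {-int n - 2..int n + 2}" for x n
  proof (cases x)
    case (Pair b k)
    have k: "k > int n + 2 \<or> k < - int n - 2" using that Pair by auto
    thus ?thesis unfolding Pair t_def by (auto simp: geom0)
  qed
  have fin: "finite {x\<in>UNIV. fps_nth (t x) n \<noteq> 0}" for n
    by (rule finite_subset[of _ "UNIV \<times> {-int n - 2..int n + 2}"]) (use t0 in auto)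
  have "eventually (\<lambda>n. x \<in> I n) sequentially" for x
    using eventually_ge_at_top[of "nat \<bar>snd x\<bar>"] by eventually_elim (auto simp: I_def mem_Times_iff)
  hence "((\<lambda>x. t x * U) has_sum L) UNIV"
    using fps_has_sum_LIMSEQ[of F L t u I UNIV U] lim lim' F fin by (simp add: I_def)
  hence "((\<lambda>x. t x * U * inverse U) has_sum L * inverse U) UNIV"
    by (rule has_sum_cmult_left)
  moreover have "U * inverse U = 1"
    by (intro inverse_mult_eq_1') (simp add: U_def A_def B_def E_def)
  ultimately have S: "(t has_sum L * inverse U) UNIV" by (simp add: mult.assoc)

  have BA: "B * inverse B = 1" "A * inverse A = 1"
    by (intro inverse_mult_eq_1'; simp add: A_def B_def)+
  have "L * inverse U = - fps_X * (A ^ 2 * E ^ 2 * inverse B ^ 3) * (A * inverse A)"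
    unfolding L_def U_def
    by (simp add: fps_inverse_mult fps_inverse_idempotent fps_inverse_power A_def B_def E_def
        power2_eq_square power3_eq_cube mult_ac)
  hence LU: "L * inverse U = - (fps_X * (A ^ 2 * E ^ 2 * inverse B ^ 3))" using BA by simp

  have "fps_nth (lambert5 1 - 3 * lambert5 2) n = - fps_nth (L * inverse U) n" for n
  proof (cases "n = 0")
    case True
    thus ?thesis unfolding LU by (simp add: lambert5_def numeral_fps_const)
  next
    case False
    hence n: "n > 0" by simp
    define K where "K = {-int n - 2..int n + 2}"
    define c where "c = (\<lambda>m. if m dvd int n then of_int (sgn m) else 0 :: complex)"
    have c: "fps_nth (geom m) n = c m" for m using n by (simp add: geom_nth c_def)
    \<comment> \<open>A divisor of \<open>n\<close> is at most \<open>n\<close> in absolute value,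
      so \<open>K\<close> reaches all divisors in the class. The offsets -2 and 6 leave the range 0
      to 4 because the pole parameters are divided and multiplied by $q^2$.\<close>
    have csum: "(\<Sum>k\<in>K. c (5 * k + r)) = of_int (signed_divisors (nat (r mod 5)) n)" if "\<bar>r\<bar> \<le> 6" for r
    proof -
      have "(\<Sum>k\<in>K. c (5 * k + r)) = (\<Sum>k | k \<in> K \<and> 5 * k + r dvd int n. of_int (sgn (5 * k + r)))"
        unfolding c_def by (rule sum.inter_filter [symmetric]) (simp add: K_def)
      also have "\<dots> = (\<Sum>m | m dvd int n \<and> m mod 5 = int (nat (r mod 5)). of_int (sgn m))"
      proof (rule sum.reindex_bij_witness[of _ "\<lambda>m. (m - r) div 5" "\<lambda>k. 5 * k + r"])
        fix m assume m: "m \<in> {m. m dvd int n \<and> m mod 5 = int (nat (r mod 5))}"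
        hence "m mod 5 = r mod 5" by simp
        hence "5 dvd m - r" by (simp add: mod_eq_dvd_iff)
        thus *: "5 * ((m - r) div 5) + r = m" by simp
        have "\<bar>m\<bar> \<le> int n" using m n int_dvd_bound by auto
        hence "(m - r) div 5 \<in> K" using that * unfolding K_def atLeastAtMost_iff by linarith
        thus "(m - r) div 5 \<in> {k. k \<in> K \<and> 5 * k + r dvd int n}" using * m by simp
      qed auto
      finally show ?thesis by (simp add: signed_divisors_def)
    qed
    have "fps_nth (L * inverse U) n = (\<Sum>x | x \<in> UNIV \<and> fps_nth (t x) n \<noteq> 0. fps_nth (t x) n)"
      using has_sum_fpsD(2)[OF S] by simp
    also have "\<dots> = (\<Sum>x\<in>UNIV \<times> K. fps_nth (t x) n)"
      by (rule sum.mono_neutral_left) (use t0 in \<open>auto simp: K_def\<close>)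
    also have "\<dots> = (\<Sum>b\<in>UNIV. \<Sum>k\<in>K. fps_nth (t (b, k)) n)"
      by (simp add: sum.cartesian_product)
    also have "\<dots> = (\<Sum>k\<in>K. c (5 * k + 2)) - (\<Sum>k\<in>K. c (5 * k + (- 2))) - (\<Sum>k\<in>K. c (5 * k + 6)) + (\<Sum>k\<in>K. c (5 * k + 2))"
      by (simp add: UNIV_bool t_def c sum_subtractf sum.distrib)
    also have "\<dots> = of_int (signed_divisors 2 n) - of_int (signed_divisors 3 n)
        - of_int (signed_divisors 1 n) + of_int (signed_divisors 2 n)"
      by (simp only: csum) simp
    finally show ?thesis unfolding signed_divisors_reflect[of 3 2, simplified] using n by (simp add: lambert5_def numeral_fps_const)
  qed
  thus ?thesis unfolding LU by (simp add: fps_eq_iff)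
qed

section \<open>Quintisection of the Euler product\<close>

abbreviation subst5 :: "complex fps \<Rightarrow> complex fps" where
  "subst5 f \<equiv> fps_compose f (fps_X ^ 5)"

definition section5 :: "nat \<Rightarrow> complex fps \<Rightarrow> complex fps" where
  "section5 r f = Abs_fps (\<lambda>n. fps_nth f (5 * n + r))"

lemma section5_nth [simp]: "fps_nth (section5 r f) n = fps_nth f (5 * n + r)"
  by (simp add: section5_def)

lemma fps_nth_compose_X_power:
  fixes f :: "'a :: comm_ring_1 fps"
  assumes "d > 0"
  shows "fps_nth (fps_compose f (fps_X ^ d)) n = (if d dvd n then fps_nth f (n div d) else 0)"
proof -
  have "fps_nth (fps_compose f (fps_X ^ d)) n = (\<Sum>i\<in>{0..n}. if n = d * i then fps_nth f i else 0)"
    unfolding fps_compose_nth by (intro sum.cong refl) (simp flip: power_mult)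
  also have "\<dots> = (if d dvd n then fps_nth f (n div d) else 0)"
  proof (cases "d dvd n")
    case True
    then obtain k where k: "n = d * k" by auto
    have "(\<Sum>i\<in>{0..n}. if n = d * i then fps_nth f i else 0) = (\<Sum>i\<in>{k}. fps_nth f i)"
      by (rule sum.mono_neutral_cong_right) (use k assms in auto)
    thus ?thesis using k assms by simp
  next
    case False
    thus ?thesis by (auto intro!: sum.neutral)
  qed
  finally show ?thesis .
qed

lemma subst5_mult: "subst5 (f * g) = subst5 f * subst5 g"
  by (rule fps_compose_mult_distrib) simp

lemma subst5_power: "subst5 (f ^ n) = subst5 f ^ n"
  by (simp add: fps_compose_power)

lemma subst5_numeral [simp]: "subst5 (numeral k) = numeral k"
  by (simp add: numeral_fps_const)

lemma subst5_X [simp]: "subst5 fps_X = fps_X ^ 5"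
  by (simp add: fps_X_fps_compose_startby0)

lemmas subst5_simps = subst5_mult subst5_power fps_compose_add_distrib fps_compose_sub_distrib
  fps_compose_uminus

lemma fps_compose_X_power_LIMSEQ:
  fixes f :: "nat \<Rightarrow> 'a :: comm_ring_1 fps"
  assumes "f \<longlonglongrightarrow> L" "d > 0"
  shows "(\<lambda>n. fps_compose (f n) (fps_X ^ d)) \<longlonglongrightarrow> fps_compose L (fps_X ^ d)"
proof (rule tendsto_fpsI)
  fix m
  have "eventually (\<lambda>n. fps_nth (f n) (m div d) = fps_nth L (m div d)) sequentially"
    using assms by (simp add: tendsto_fps_iff)
  thus "eventually (\<lambda>n. fps_nth (fps_compose (f n) (fps_X ^ d)) m = fps_nth (fps_compose L (fps_X ^ d)) m) sequentially"
    by eventually_elim (simp add: fps_nth_compose_X_power assms)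
qed

lemma fps_compose_linear_LIMSEQ:
  fixes f :: "nat \<Rightarrow> 'a :: comm_ring_1 fps"
  assumes "f \<longlonglongrightarrow> L"
  shows "(\<lambda>n. fps_compose (f n) (fps_const c * fps_X)) \<longlonglongrightarrow> fps_compose L (fps_const c * fps_X)"
proof (rule tendsto_fpsI)
  fix m
  have "eventually (\<lambda>n. fps_nth (f n) m = fps_nth L m) sequentially"
    using assms by (simp add: tendsto_fps_iff)
  thus "eventually (\<lambda>n. fps_nth (fps_compose (f n) (fps_const c * fps_X)) m = fps_nth (fps_compose L (fps_const c * fps_X)) m) sequentially"
    by eventually_elim simp
qed

lemma qpn_compose_X_power:
  "e > 0 \<Longrightarrow> fps_compose (qpn c i d n) (fps_X ^ e) = qpn c (e * i) (e * d) n"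
proof (induction n)
  case (Suc n)
  have "fps_compose (fps_X ^ (i + d * n)) (fps_X ^ e) = (fps_X ^ (e * i + e * d * n) :: complex fps)"
  proof -
    have "fps_compose (fps_X ^ (i + d * n)) (fps_X ^ e) =
        fps_compose (fps_X :: complex fps) (fps_X ^ e) ^ (i + d * n)"
      using Suc.prems by (intro fps_compose_power [symmetric]) simp
    also have "\<dots> = fps_X ^ (e * (i + d * n))"
      using Suc.prems by (simp add: fps_X_fps_compose_startby0 flip: power_mult)
    finally show ?thesis by (simp only: distrib_left mult_ac)
  qed
  thus ?case using Suc
    by (simp add: qpn_Suc fps_compose_mult_distrib fps_compose_sub_distrib)
qed simp

lemma qp_compose_X_power:
  assumes "e > 0" "i > 0" "d > 0"
  shows "fps_compose (qp c i d) (fps_X ^ e) = qp c (e * i) (e * d)"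
proof -
  have "(\<lambda>n. qpn c (e * i) (e * d) n) \<longlonglongrightarrow> fps_compose (qp c i d) (fps_X ^ e)"
    using fps_compose_X_power_LIMSEQ[OF qpn_LIMSEQ[OF assms(2,3)] assms(1)] assms
    by (simp add: qpn_compose_X_power)
  moreover have "(\<lambda>n. qpn c (e * i) (e * d) n) \<longlonglongrightarrow> qp c (e * i) (e * d)"
    using assms by (intro qpn_LIMSEQ) auto
  ultimately show ?thesis by (rule LIMSEQ_unique)
qed

section \<open>The Rogers-Ramanujan products and dissections at fifth roots of unity\<close>

definition rrA :: "complex fps" where "rrA = qp 1 1 5 * qp 1 4 5"
definition rrB :: "complex fps" where "rrB = qp 1 2 5 * qp 1 3 5"

lemma rr_nth_0 [simp]: "fps_nth rrA 0 = 1" "fps_nth rrB 0 = 1"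
  by (simp_all add: rrA_def rrB_def)

lemma euler_product_dissection: "qp 1 1 1 = rrA * rrB * qp 1 5 5"
proof -
  have "qpn 1 1 1 (5 * n) = (qpn 1 1 5 n * qpn 1 4 5 n) * (qpn 1 2 5 n * qpn 1 3 5 n) * qpn 1 5 5 n" for n
  proof (induction n)
    case (Suc n)
    have e: "5 * Suc n = Suc (Suc (Suc (Suc (Suc (5 * n)))))"
      "1 + Suc (5 * n) = 2 + 5 * n" "1 + Suc (Suc (5 * n)) = 3 + 5 * n"
      "1 + Suc (Suc (Suc (5 * n))) = 4 + 5 * n" "1 + Suc (Suc (Suc (Suc (5 * n)))) = 5 + 5 * n"
      by simp_all
    have "qpn 1 1 1 (5 * Suc n) = qpn 1 1 1 (5 * n) *
        ((1 - fps_X ^ (1 + 5 * n)) * (1 - fps_X ^ (2 + 5 * n)) * (1 - fps_X ^ (3 + 5 * n)) *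
         (1 - fps_X ^ (4 + 5 * n)) * (1 - fps_X ^ (5 + 5 * n)))"
      by (simp only: qpn_Suc e fps_const_1_eq_1 mult_1 mult.assoc)
    thus ?case unfolding Suc by (simp only: qpn_Suc fps_const_1_eq_1 mult_1 mult_ac)
  qed simp
  hence "(\<lambda>n. qpn 1 1 1 (5 * n)) \<longlonglongrightarrow> rrA * rrB * qp 1 5 5"
    unfolding rrA_def rrB_def by (simp only:) (intro tendsto_mult qpn_LIMSEQ; simp)
  thus ?thesis using qpn_mult_LIMSEQ[of 1 1 5 1] LIMSEQ_unique by simp
qed

lemma root5_power_5:
  fixes Z :: "'a :: comm_ring_1"
  assumes "1 + Z + Z^2 + Z^3 + Z^4 = 0"
  shows "Z ^ 5 = 1"
proof -
  have "Z ^ 5 - 1 = (Z - 1) * (1 + Z + Z^2 + Z^3 + Z^4)" by (simp add: algebra_simps eval_nat_numeral)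
  thus ?thesis using assms by simp
qed

text \<open>Pairing $Z^j$ with $Z^{-j}$ leaves two quadratic factors whose middle coefficients
  \<open>s\<close> and \<open>t\<close> satisfy $s + t = st = -1$, so $Z$ drops out. The statement
  is about rings because it is used with the constant series of a root of unity.\<close>

lemma root5_product:
  fixes Z b w :: "'a :: comm_ring_1"
  assumes "1 + Z + Z^2 + Z^3 + Z^4 = 0"
  shows "(b - w) * (b - Z * w) * (b - Z^2 * w) * (b - Z^3 * w) * (b - Z^4 * w) = b ^ 5 - w ^ 5"
proof -
  have Z5: "Z ^ 5 = 1" using assms by (rule root5_power_5)
  define s t where "s = Z + Z^4" and "t = Z^2 + Z^3"
  have st: "s + t = -1" "s * t = -1"
  proof -
    show "s + t = -1" using assms by (simp add: s_def t_def algebra_simps eq_neg_iff_add_eq_0)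
    have "s * t = Z^3 + Z^4 + Z^5 * Z + Z^5 * Z^2" by (simp add: s_def t_def algebra_simps eval_nat_numeral)
    thus "s * t = -1" using Z5 assms by (simp add: algebra_simps eq_neg_iff_add_eq_0)
  qed
  have 1: "(b - Z * w) * (b - Z^4 * w) = b^2 - s * b * w + Z^5 * w^2"
    "(b - Z^2 * w) * (b - Z^3 * w) = b^2 - t * b * w + Z^5 * w^2"
    by (simp_all add: s_def t_def algebra_simps eval_nat_numeral)
  have "(b - w) * (b - Z * w) * (b - Z^2 * w) * (b - Z^3 * w) * (b - Z^4 * w) =
      (b - w) * (((b - Z * w) * (b - Z^4 * w)) * ((b - Z^2 * w) * (b - Z^3 * w)))"
    by (simp only: mult_ac)
  also have "\<dots> = (b - w) * (b^4 - (s + t) * b^3 * w + (2 + s * t) * b^2 * w^2 - (s + t) * b * w^3 + w^4)"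
    unfolding 1 Z5 by (simp add: algebra_simps eval_nat_numeral)
  also have "\<dots> = b ^ 5 - w ^ 5" unfolding st by (simp add: algebra_simps eval_nat_numeral)
  finally show ?thesis .
qed

lemma fps_const_root5_sum:
  assumes "z ^ 5 = 1" "z \<noteq> (1 :: complex)"
  shows "1 + fps_const z + fps_const z ^ 2 + fps_const z ^ 3 + fps_const z ^ 4 = 0"
proof -
  have "1 + fps_const z + fps_const z ^ 2 + fps_const z ^ 3 + fps_const z ^ 4 =
      fps_const (1 + z + z^2 + z^3 + z^4)"
    by (simp only: fps_const_power fps_const_add fps_const_1_eq_1 [symmetric])
  thus ?thesis using root5_sum[OF assms] by simp
qed

lemma root5_powers:
  assumes "z ^ 5 = 1" "z \<noteq> (1 :: complex)" "\<not> 5 dvd m"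
  shows "(z ^ m) ^ 5 = 1" "z ^ m \<noteq> 1"
proof -
  show "(z ^ m) ^ 5 = 1" using assms(1) by (metis power_mult mult.commute power_one)
  show "z ^ m \<noteq> 1"
  proof
    assume *: "z ^ m = 1"
    have "coprime m 5" using assms(3) prime_imp_coprime_nat[of 5 m] by (simp add: coprime_commute)
    then obtain x y where xy: "m * x = 5 * y + 1"
      using coprime_bezout_strong[of m 5] by auto
    have "z ^ (m * x) = 1" using * by (simp add: power_mult)
    moreover have "z ^ (5 * y + 1) = z" using assms(1) by (simp add: power_mult)
    ultimately show False using xy assms(2) by simp
  qed
qed

lemma qp_root5_product:
  assumes "z ^ 5 = 1" "z \<noteq> 1"
  shows "qp 1 5 5 = qp 1 1 1 * qp z 1 1 * qp (z^2) 1 1 * qp (z^3) 1 1 * qp (z^4) 1 1"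
proof -
  have "qpn 1 5 5 n = qpn 1 1 1 n * qpn z 1 1 n * qpn (z^2) 1 1 n * qpn (z^3) 1 1 n * qpn (z^4) 1 1 n" for n
  proof (induction n)
    case (Suc n)
    have "1 - fps_X ^ (5 + 5 * n) = 1 ^ 5 - (fps_X ^ (1 + 1 * n) :: complex fps) ^ 5"
      by (simp add: algebra_simps flip: power_mult power_Suc)
    also have "\<dots> = (1 - fps_X ^ (1 + 1 * n)) * (1 - fps_const z * fps_X ^ (1 + 1 * n)) *
      (1 - fps_const (z^2) * fps_X ^ (1 + 1 * n)) * (1 - fps_const (z^3) * fps_X ^ (1 + 1 * n)) *
      (1 - fps_const (z^4) * fps_X ^ (1 + 1 * n))"
      unfolding fps_const_power [symmetric]
      by (rule root5_product[OF fps_const_root5_sum[OF assms], symmetric])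
    finally show ?case unfolding qpn_Suc Suc fps_const_1_eq_1 mult_1 by (simp only: mult_ac)
  qed simp
  hence "qpn 1 5 5 = (\<lambda>n. qpn 1 1 1 n * qpn z 1 1 n * qpn (z^2) 1 1 n * qpn (z^3) 1 1 n * qpn (z^4) 1 1 n)"
    by auto
  moreover have "(\<lambda>n. qpn 1 1 1 n * qpn z 1 1 n * qpn (z^2) 1 1 n * qpn (z^3) 1 1 n * qpn (z^4) 1 1 n)
      \<longlonglongrightarrow> qp 1 1 1 * qp z 1 1 * qp (z^2) 1 1 * qp (z^3) 1 1 * qp (z^4) 1 1"
    by (intro tendsto_mult qpn_LIMSEQ) auto
  ultimately show ?thesis using qpn_LIMSEQ[of 5 5 1] LIMSEQ_unique by auto
qed

lemma subst5_products:
  "subst5 rrA = qp 1 5 25 * qp 1 20 25" "subst5 rrB = qp 1 10 25 * qp 1 15 25"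
  "subst5 (qp 1 5 5) = qp 1 25 25" "subst5 (qp 1 1 1) = qp 1 5 5"
  by (simp_all add: rrA_def rrB_def subst5_mult qp_compose_X_power)

lemma qp_5_5_eq: "qp 1 5 5 = subst5 rrA * subst5 rrB * subst5 (qp 1 5 5)"
  using arg_cong[OF euler_product_dissection, of subst5]
  by (simp only: subst5_mult subst5_products(4))

lemma theta_dissection':
  assumes "z ^ 5 = 1" "z \<noteq> 1"
  shows "qp 1 1 1 * qp z 1 1 * qp (z^4) 1 1 =
    subst5 (qp 1 5 5) * (subst5 rrB - (1 + fps_const z + fps_const z ^ 4) * fps_X * subst5 rrA)"
proof -
  have "fps_const (1 + z + z ^ 4) = 1 + fps_const z + fps_const z ^ 4"
    by (simp only: fps_const_power fps_const_add fps_const_1_eq_1 [symmetric])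
  thus ?thesis
    using theta_dissection[OF assms] root5_inverse[OF assms(1)]
    by (simp add: subst5_products right_diff_distrib mult_ac)
qed

lemma root5_square:
  assumes "z ^ 5 = 1" "z \<noteq> (1::complex)"
  shows "(z ^ 2) ^ 5 = 1" "z ^ 2 \<noteq> 1" "(z ^ 2) ^ 4 = z ^ 3"
proof -
  show "(z ^ 2) ^ 5 = 1" "z ^ 2 \<noteq> 1" using root5_powers[OF assms, of 2] by auto
  have "(z ^ 2) ^ 4 = z ^ 5 * z ^ 3" by (simp flip: power_mult power_add)
  thus "(z ^ 2) ^ 4 = z ^ 3" using assms by simp
qed

lemma theta_dissection_square:
  assumes "z ^ 5 = 1" "z \<noteq> 1"
  shows "qp 1 1 1 * qp (z^2) 1 1 * qp (z^3) 1 1 =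
    subst5 (qp 1 5 5) * (subst5 rrB - (1 + fps_const z ^ 2 + fps_const z ^ 3) * fps_X * subst5 rrA)"
  using theta_dissection'[of "z ^ 2"] root5_square[OF assms]
  by (simp add: fps_const_power)

text \<open>By \<open>qp_root5_product\<close>, \<open>qp 1 5 5\<close> is the crank product at $z$
  times the theta product at $z^2$. The dissection of the latter is therefore, up to a series in
  $q^5$, one of the reciprocal of the former. The coefficient $-(1 + z^2 + z^3)$ is $z +
  z^4$.\<close>

lemma crank_product_dissection:
  assumes "z ^ 5 = 1" "z \<noteq> 1"
  shows "subst5 rrA * subst5 rrB = qp z 1 1 * qp (z^4) 1 1 *
     (subst5 rrB + (fps_const z + fps_const z ^ 4) * fps_X * subst5 rrA)"
proof -
  have c: "1 + fps_const z ^ 2 + fps_const z ^ 3 = - (fps_const z + fps_const z ^ 4)"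
    using fps_const_root5_sum[OF assms] unfolding eq_neg_iff_add_eq_0
    by (simp only: add_ac)
  have "subst5 (qp 1 5 5) * (subst5 rrA * subst5 rrB) = qp z 1 1 * qp (z^4) 1 1 * (qp 1 1 1 * qp (z^2) 1 1 * qp (z^3) 1 1)"
    using qp_5_5_eq qp_root5_product[OF assms] by (simp add: mult_ac)
  also have "\<dots> = subst5 (qp 1 5 5) * (qp z 1 1 * qp (z^4) 1 1 *
     (subst5 rrB + (fps_const z + fps_const z ^ 4) * fps_X * subst5 rrA))"
    unfolding theta_dissection_square[OF assms] c
    by (simp only: mult_minus_left mult_minus_right diff_minus_eq_add mult_ac)
  finally show ?thesis by (simp add: subst5_products)
qed

lemma ex_root5: "\<exists>z. z ^ 5 = (1 :: complex) \<and> z \<noteq> 1"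
proof -
  have "card {z :: complex. z ^ 5 = 1} = 5" by (rule card_roots_unity_eq) simp
  hence "{z :: complex. z ^ 5 = 1} \<noteq> {1}" by auto
  thus ?thesis by auto
qed

text \<open>The theta products at $z$ and $z^2$ multiply to \<open>qp 1 1 1 * qp 1 5 5\<close>. The
  coefficients $1 + z + z^4$ and $1 + z^2 + z^3$ have sum 1 and product -1, so $z$ disappears from
  the product of the two dissections.\<close>

lemma euler_product_5_dissection:
  defines "a \<equiv> subst5 rrA" and "b \<equiv> subst5 rrB"
  shows "qp 1 1 1 * a * b = subst5 (qp 1 5 5) * (b^2 - fps_X * a * b - fps_X^2 * a^2)"
proof -
  obtain z :: complex where z: "z ^ 5 = 1" "z \<noteq> 1" using ex_root5 by blast
  define e where "e = subst5 (qp 1 5 5)"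
  define Z where "Z = fps_const z"
  note s = fps_const_root5_sum[OF z, folded Z_def]
  have e0: "e \<noteq> 0" by (simp add: e_def subst5_products)
  have "e * (qp 1 1 1 * a * b) = qp 1 1 1 * qp 1 5 5"
  proof -
    have "a * b * e = qp 1 5 5" using qp_5_5_eq by (simp only: a_def b_def e_def)
    moreover have "e * (qp 1 1 1 * a * b) = qp 1 1 1 * (a * b * e)" by (simp only: mult_ac)
    ultimately show ?thesis by simp
  qed
  also have "\<dots> = (qp 1 1 1 * qp z 1 1 * qp (z^4) 1 1) * (qp 1 1 1 * qp (z^2) 1 1 * qp (z^3) 1 1)"
    unfolding qp_root5_product[OF z] by (simp add: mult_ac)
  also have "\<dots> = e * (b - (1 + Z + Z ^ 4) * fps_X * a) * (e * (b - (1 + Z ^ 2 + Z ^ 3) * fps_X * a))"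
    unfolding theta_dissection'[OF z] theta_dissection_square[OF z] by (simp add: e_def a_def b_def Z_def)
  also have "\<dots> = e * (e * (b^2 - (1 + (1 + Z + Z^2 + Z^3 + Z^4)) * fps_X * a * b
      + ((1 + Z + Z ^ 4) * (1 + Z ^ 2 + Z ^ 3)) * fps_X^2 * a^2))"
    by (simp add: algebra_simps power2_eq_square)
  also have "(1 + Z + Z ^ 4) * (1 + Z ^ 2 + Z ^ 3) = (1 + Z + Z^2 + Z^3 + Z^4) * (1 + Z^3) - Z^5"
    by (simp add: algebra_simps eval_nat_numeral)
  finally have "e * (qp 1 1 1 * a * b) = e * (e * (b^2 - fps_X * a * b - fps_X^2 * a^2))"
    using z unfolding s by (simp add: Z_def fps_const_power)
  thus ?thesis using e0 by (simp add: e_def)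
qed


section \<open>The norm of the Euler product under $q -> zq$\<close>

lemma qpn_compose_linear:
  "fps_compose (qpn 1 1 1 n) (fps_const w * fps_X) = (\<Prod>k<n. 1 - fps_const w ^ Suc k * fps_X ^ Suc k)"
proof (induction n)
  case (Suc n)
  have "fps_compose (fps_X ^ Suc n) (fps_const w * fps_X) = fps_compose fps_X (fps_const w * fps_X) ^ Suc n"
    by (intro fps_compose_power [symmetric]) simp
  also have "\<dots> = fps_const w ^ Suc n * fps_X ^ Suc n"
  proof -
    have "fps_compose fps_X (fps_const w * fps_X) = fps_const w * fps_X"
      by (rule fps_X_fps_compose_startby0) simp
    thus ?thesis by (simp only: power_mult_distrib)
  qed
  finally have "fps_compose (1 - fps_X ^ Suc n) (fps_const w * fps_X) = 1 - fps_const w ^ Suc n * fps_X ^ Suc n"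
    by (simp only: fps_compose_sub_distrib fps_compose_1)
  moreover have "qpn 1 1 1 (Suc n) = qpn 1 1 1 n * (1 - fps_X ^ Suc n)"
    by (simp only: qpn_Suc fps_const_1_eq_1 mult_1 plus_1_eq_Suc)
  ultimately show ?case
    using Suc by (simp only: prod.lessThan_Suc) (subst fps_compose_mult_distrib, simp_all)
qed simp

definition rotate_arg :: "complex \<Rightarrow> complex fps \<Rightarrow> complex fps" where
  "rotate_arg w f = fps_compose f (fps_const w * fps_X)"

lemma rotate_arg_nth: "fps_nth (rotate_arg w f) n = w ^ n * fps_nth f n"
  by (simp add: rotate_arg_def)

lemma rotate_arg_mult: "rotate_arg w (f * g) = rotate_arg w f * rotate_arg w g"
  unfolding rotate_arg_def by (rule fps_compose_mult_distrib) simp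

lemma rotate_arg_diff: "rotate_arg w (f - g) = rotate_arg w f - rotate_arg w g"
  by (simp add: fps_eq_iff rotate_arg_nth right_diff_distrib)

lemma rotate_arg_X_power: "rotate_arg w (fps_X ^ k) = fps_const w ^ k * fps_X ^ k"
  by (simp add: fps_eq_iff rotate_arg_nth fps_const_power)

lemma rotate_arg_subst5: "w ^ 5 = 1 \<Longrightarrow> rotate_arg w (subst5 f) = subst5 f"
proof (rule fps_ext)
  fix n assume w: "w ^ 5 = 1"
  have "w ^ n = 1" if "5 dvd n" using that w by (auto simp: power_mult)
  thus "fps_nth (rotate_arg w (subst5 f)) n = fps_nth (subst5 f) n"
    by (auto simp: rotate_arg_nth fps_nth_compose_X_power)
qed

text \<open>The conjugates of $1 - q^m$ multiply to $1 - q^{5m}$ if 5 does not divide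
  \<open>m\<close>; otherwise they all coincide and give $(1 - q^m)^5$. The factor
  \<open>qp 1 25 25\<close> supplies those $1 - q^{5m}$ that are missing for the multiples
  \<open>m\<close> of 5.\<close>

lemma euler_product_norm:
  assumes "z ^ 5 = 1" "z \<noteq> 1"
  shows "qp 1 1 1 * rotate_arg z (qp 1 1 1) * rotate_arg (z^2) (qp 1 1 1) * rotate_arg (z^3) (qp 1 1 1) *
     rotate_arg (z^4) (qp 1 1 1) * qp 1 25 25 = qp 1 5 5 ^ 6"
proof -
  define R where "R = (\<lambda>j n. rotate_arg (z ^ j) (qpn 1 1 1 n))"
  define h where "h = (\<lambda>m. (1 - fps_X ^ m) * (1 - fps_const (z ^ m) * fps_X ^ m) * (1 - fps_const (z ^ m) ^ 2 * fps_X ^ m) *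
      (1 - fps_const (z ^ m) ^ 3 * fps_X ^ m) * (1 - fps_const (z ^ m) ^ 4 * fps_X ^ m))"
  have R_Suc: "R j (Suc n) = R j n * (1 - fps_const (z ^ Suc n) ^ j * fps_X ^ Suc n)" for j n
  proof -
    have "fps_const (z ^ j) ^ Suc n = fps_const (z ^ Suc n) ^ j"
      unfolding fps_const_power by (simp only: mult.commute flip: power_mult)
    thus ?thesis unfolding R_def rotate_arg_def qpn_compose_linear prod.lessThan_Suc by simp
  qed
  define P where "P = (\<lambda>n. qpn 1 1 1 n * R 1 n * R 2 n * R 3 n * R 4 n)"
  have P_Suc: "P (Suc n) = P n * h (Suc n)" for n
    unfolding P_def R_Suc h_def qpn_Suc by (simp only: fps_const_1_eq_1 mult_1 plus_1_eq_Suc power_one_right mult_ac)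
  have h1: "h m = 1 - fps_X ^ (5 * m)" if "\<not> 5 dvd m" for m
  proof -
    have "h m = 1 ^ 5 - (fps_X ^ m) ^ 5"
      unfolding h_def using root5_product[OF fps_const_root5_sum[OF root5_powers[OF assms that]], of 1 "fps_X ^ m"]
      by (simp only:)
    thus ?thesis by (simp add: mult.commute flip: power_mult)
  qed
  have h2: "h m = (1 - fps_X ^ m) ^ 5" if "5 dvd m" for m
  proof -
    have "z ^ m = 1" using that assms by (auto simp: power_mult)
    thus ?thesis by (simp add: h_def eval_nat_numeral)
  qed
  have fin: "P (5 * n) * qpn 1 25 25 n = qpn 1 5 5 n ^ 5 * qpn 1 5 5 (5 * n)" for n
  proof (induction n)
    case 0
    show ?case by (simp add: P_def R_def rotate_arg_def)
  next
    case (Suc n)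
    have e: "5 * Suc n = Suc (Suc (Suc (Suc (Suc (5 * n)))))" by simp
    have nd: "\<not> 5 dvd Suc (5 * n)" "\<not> 5 dvd Suc (Suc (5 * n))" "\<not> 5 dvd Suc (Suc (Suc (5 * n)))"
      "\<not> 5 dvd Suc (Suc (Suc (Suc (5 * n))))" "5 dvd Suc (Suc (Suc (Suc (Suc (5 * n)))))" by presburger+
    have q: "qpn 1 5 5 (Suc m) = qpn 1 5 5 m * (1 - fps_X ^ (5 * Suc m))" for m
      by (simp only: qpn_Suc fps_const_1_eq_1 mult_1) simp
    have q25: "qpn 1 25 25 (Suc n) = qpn 1 25 25 n * (1 - fps_X ^ (5 * Suc (Suc (Suc (Suc (Suc (5 * n)))))))"
      by (simp only: qpn_Suc fps_const_1_eq_1 mult_1) simp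
    have q5: "qpn 1 5 5 (Suc n) = qpn 1 5 5 n * (1 - fps_X ^ Suc (Suc (Suc (Suc (Suc (5 * n))))))"
      by (simp only: q e)
    show ?case
      unfolding q25 q5 unfolding e P_Suc q h1[OF nd(1)] h1[OF nd(2)] h1[OF nd(3)] h1[OF nd(4)] h2[OF nd(5)]
        power_mult_distrib
      using arg_cong[OF Suc, of "\<lambda>y. y * (1 - fps_X ^ (5 * Suc (5 * n))) * (1 - fps_X ^ (5 * Suc (Suc (5 * n)))) *
        (1 - fps_X ^ (5 * Suc (Suc (Suc (5 * n))))) * (1 - fps_X ^ (5 * Suc (Suc (Suc (Suc (5 * n)))))) *
        (1 - fps_X ^ Suc (Suc (Suc (Suc (Suc (5 * n)))))) ^ 5 * (1 - fps_X ^ (5 * Suc (Suc (Suc (Suc (Suc (5 * n)))))))"]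
      by (simp only: mult_ac)
  qed
  have R_lim: "(\<lambda>n. R j (5 * n)) \<longlonglongrightarrow> rotate_arg (z ^ j) (qp 1 1 1)" for j
    unfolding R_def rotate_arg_def by (intro fps_compose_linear_LIMSEQ qpn_mult_LIMSEQ) auto
  have "(\<lambda>n. P (5 * n) * qpn 1 25 25 n) \<longlonglongrightarrow> qp 1 1 1 * rotate_arg (z^1) (qp 1 1 1) * rotate_arg (z^2) (qp 1 1 1) * rotate_arg (z^3) (qp 1 1 1) *
     rotate_arg (z^4) (qp 1 1 1) * qp 1 25 25"
    unfolding P_def by (intro tendsto_mult R_lim qpn_mult_LIMSEQ qpn_LIMSEQ) auto
  moreover have "(\<lambda>n. P (5 * n) * qpn 1 25 25 n) \<longlonglongrightarrow> (qp 1 5 5 * qp 1 5 5 * qp 1 5 5 * qp 1 5 5 * qp 1 5 5) * qp 1 5 5"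
  proof -
    have "(\<lambda>n. (qpn 1 5 5 n * qpn 1 5 5 n * qpn 1 5 5 n * qpn 1 5 5 n * qpn 1 5 5 n) * qpn 1 5 5 (5 * n))
       \<longlonglongrightarrow> (qp 1 5 5 * qp 1 5 5 * qp 1 5 5 * qp 1 5 5 * qp 1 5 5) * qp 1 5 5"
      by (intro tendsto_mult qpn_mult_LIMSEQ qpn_LIMSEQ) auto
    thus ?thesis unfolding fin by (simp add: eval_nat_numeral mult_ac)
  qed
  ultimately have "qp 1 1 1 * rotate_arg (z^1) (qp 1 1 1) * rotate_arg (z^2) (qp 1 1 1) * rotate_arg (z^3) (qp 1 1 1) *
     rotate_arg (z^4) (qp 1 1 1) * qp 1 25 25 = (qp 1 5 5 * qp 1 5 5 * qp 1 5 5 * qp 1 5 5 * qp 1 5 5) * qp 1 5 5"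
    by (rule LIMSEQ_unique)
  thus ?thesis by (simp add: eval_nat_numeral mult_ac)
qed

text \<open>The quadratic form splits over the ring with $s + t = 1$ and $st = -1$, so
  \<open>root5_product\<close> applies to each linear factor. The constant 11 is $s^5 + t^5$, the
  fifth Lucas number.\<close>

lemma golden_product:
  fixes Z a b y :: "'a :: comm_ring_1"
  assumes Z: "1 + Z + Z^2 + Z^3 + Z^4 = 0"
  defines "p \<equiv> \<lambda>u. b^2 - u * a * b - u^2 * a^2"
  shows "p y * p (Z * y) * p (Z^2 * y) * p (Z^3 * y) * p (Z^4 * y) =
    b^10 - 11 * y^5 * a^5 * b^5 - y^10 * a^10"
proof -
  have Z5: "Z ^ 5 = 1" using Z by (rule root5_power_5)
  define s t where "s = - (Z + Z^4)" and "t = - (Z^2 + Z^3)"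
  have st: "s + t = 1" "s * t = -1"
  proof -
    have "1 - (s + t) = 1 + Z + Z^2 + Z^3 + Z^4" by (simp add: s_def t_def)
    thus "s + t = 1" using Z by simp
    have "s * t + 1 = (1 + Z + Z^2 + Z^3 + Z^4) + Z * (Z ^ 5 - 1) + Z^2 * (Z^5 - 1)"
      by (simp add: s_def t_def algebra_simps eval_nat_numeral)
    thus "s * t = -1" using Z Z5 by (simp add: eq_neg_iff_add_eq_0)
  qed
  have p: "p u = (b - s * u * a) * (b - t * u * a)" for u
  proof -
    have "(b - s * u * a) * (b - t * u * a) = b^2 - (s + t) * u * a * b + (s * t) * u^2 * a^2"
      by (simp add: algebra_simps power2_eq_square)
    thus ?thesis by (simp add: st p_def)
  qed
  have "p y * p (Z * y) * p (Z^2 * y) * p (Z^3 * y) * p (Z^4 * y) =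
     ((b - s * y * a) * (b - Z * (s * y * a)) * (b - Z^2 * (s * y * a)) * (b - Z^3 * (s * y * a)) * (b - Z^4 * (s * y * a))) *
     ((b - t * y * a) * (b - Z * (t * y * a)) * (b - Z^2 * (t * y * a)) * (b - Z^3 * (t * y * a)) * (b - Z^4 * (t * y * a)))"
    unfolding p by (simp only: mult_ac)
  also have "\<dots> = (b ^ 5 - (s * y * a) ^ 5) * (b ^ 5 - (t * y * a) ^ 5)"
    unfolding root5_product[OF Z] ..
  also have "\<dots> = b ^ 10 - (s^5 + t^5) * y^5 * a^5 * b^5 + (s * t)^5 * y^10 * a^10"
    by (simp add: algebra_simps power_mult_distrib flip: power_add)
  also have "s^5 + t^5 = (s + t)^5 - 5 * (s * t) * (s + t)^3 + 5 * (s * t)^2 * (s + t)"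
    by (simp add: algebra_simps eval_nat_numeral)
  finally show ?thesis unfolding st by simp
qed

text \<open>The norm of the Euler product is computed twice, from the product itself and from its
  dissection. Divided by $q^5 a^5 b^5$, the result is Ramanujan's formula for $1/R^5 - 11 - R^5$,
  where $R = qa/b$ is the Rogers-Ramanujan continued fraction at $q^5$.\<close>

lemma rogers_ramanujan_relation:
  defines "a \<equiv> subst5 rrA" and "b \<equiv> subst5 rrB"
  shows "(a * b) ^ 11 = b^10 - 11 * fps_X^5 * a^5 * b^5 - fps_X^10 * a^10"
proof -
  obtain z :: complex where z: "z ^ 5 = 1" "z \<noteq> 1" using ex_root5 by blast
  define e where "e = subst5 (qp 1 5 5)"
  define Z where "Z = fps_const z"
  define p where "p = (\<lambda>u. b^2 - u * a * b - u^2 * a^2)"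
  define R where "R = (\<lambda>j. rotate_arg (z^j) (qp 1 1 1))"
  have e0: "e \<noteq> 0" by (simp add: e_def subst5_products)
  have R: "R j * (a * b) = e * p (Z ^ j * fps_X)" for j
  proof -
    have w: "(z ^ j) ^ 5 = 1" using z(1) by (metis power_mult mult.commute power_one)
    have X: "rotate_arg (z ^ j) fps_X = Z ^ j * fps_X"
      using rotate_arg_X_power[of "z ^ j" 1] by (simp add: Z_def fps_const_power)
    have "rotate_arg (z^j) (qp 1 1 1 * a * b) = rotate_arg (z^j) (e * (b^2 - fps_X * a * b - fps_X^2 * a^2))"
      unfolding a_def b_def e_def euler_product_5_dissection ..
    thus ?thesis
      unfolding R_def p_def power2_eq_square rotate_arg_mult rotate_arg_diff X
      by (simp only: a_def b_def e_def rotate_arg_subst5[OF w] mult.assoc)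
  qed
  have R0: "R 0 = qp 1 1 1" by (simp add: R_def rotate_arg_def)
  have qp5: "qp 1 5 5 = a * b * e" unfolding a_def b_def e_def by (rule qp_5_5_eq)
  have "(R 0 * R 1 * R 2 * R 3 * R 4 * e) * (a * b) ^ 5 =
      e * ((R 0 * (a * b)) * (R 1 * (a * b)) * (R 2 * (a * b)) * (R 3 * (a * b)) * (R 4 * (a * b)))"
    by (simp add: eval_nat_numeral mult_ac)
  also have "\<dots> = e ^ 6 * (p fps_X * p (Z * fps_X) * p (Z^2 * fps_X) * p (Z^3 * fps_X) * p (Z^4 * fps_X))"
    unfolding R by (simp add: eval_nat_numeral mult_ac)
  also have "p fps_X * p (Z * fps_X) * p (Z^2 * fps_X) * p (Z^3 * fps_X) * p (Z^4 * fps_X) =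
      b^10 - 11 * fps_X^5 * a^5 * b^5 - fps_X^10 * a^10"
    unfolding p_def using fps_const_root5_sum[OF z, folded Z_def] by (rule golden_product)
  also have "R 0 * R 1 * R 2 * R 3 * R 4 * e = (a * b * e) ^ 6"
    using euler_product_norm[OF z] unfolding R0 qp5 [symmetric]
    by (simp add: R_def e_def subst5_products)
  finally have "e ^ 6 * (a * b) ^ 11 = e ^ 6 * (b^10 - 11 * fps_X^5 * a^5 * b^5 - fps_X^10 * a^10)"
    by (simp add: power_mult_distrib mult_ac flip: power_add)
  thus ?thesis using e0 by simp
qed

text \<open>The polynomial of degree 8 is the cofactor of $b^2 - qab - q^2 a^2$ in the norm form of
  degree 10, which is the product of the other four conjugates; its coefficients begin with the
  Fibonacci numbers 1, 1, 2, 3, 5. By the preceding relation the norm form is a power of $ab$, so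
  the denominator of $1/E_1$ becomes a series in $q^5$.\<close>

lemma inverse_euler_product_dissection:
  defines "a \<equiv> subst5 rrA" and "b \<equiv> subst5 rrB"
  shows "qp 1 1 1 * (b^8 + fps_X * b^7 * a + 2 * fps_X^2 * b^6 * a^2 + 3 * fps_X^3 * b^5 * a^3
      + 5 * fps_X^4 * b^4 * a^4 - 3 * fps_X^5 * b^3 * a^5 + 2 * fps_X^6 * b^2 * a^6
      - fps_X^7 * b * a^7 + fps_X^8 * a^8) = subst5 (qp 1 5 5) * (a * b) ^ 10"
    (is "_ * ?M = _")
proof -
  define x where "x = (fps_X :: complex fps)"
  have key: "(b^2 - x * a * b - x^2 * a^2) * (b^8 + x * b^7 * a + 2 * x^2 * b^6 * a^2 + 3 * x^3 * b^5 * a^3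
      + 5 * x^4 * b^4 * a^4 - 3 * x^5 * b^3 * a^5 + 2 * x^6 * b^2 * a^6
      - x^7 * b * a^7 + x^8 * a^8) = b^10 - 11 * x^5 * a^5 * b^5 - x^10 * a^10"
    by (simp add: algebra_simps eval_nat_numeral)
  have "(a * b) * (qp 1 1 1 * ?M) = (qp 1 1 1 * a * b) * ?M" by (simp only: mult_ac)
  also have "\<dots> = subst5 (qp 1 5 5) * ((b^2 - x * a * b - x^2 * a^2) * ?M)"
    unfolding a_def b_def euler_product_5_dissection x_def by (simp only: mult_ac)
  also have "\<dots> = subst5 (qp 1 5 5) * (a * b) ^ 11"
    unfolding x_def [symmetric] key unfolding x_def a_def b_def rogers_ramanujan_relation ..
  finally have "(a * b) * (qp 1 1 1 * ?M) = (a * b) * (subst5 (qp 1 5 5) * (a * b) ^ 10)"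
    by (simp add: power_Suc[of "a * b" 10, simplified] mult_ac)
  moreover have "a * b \<noteq> 0" by (simp add: a_def b_def subst5_products)
  ultimately show ?thesis using mult_left_cancel by blast
qed

section \<open>Sections modulo 5 and symmetries of the divisor sums\<close>

lemma section5_dissection:
  assumes "f = subst5 F0 + fps_X * subst5 F1 + fps_X^2 * subst5 F2 + fps_X^3 * subst5 F3 + fps_X^4 * subst5 F4"
  shows "section5 0 f = F0" "section5 1 f = F1" "section5 2 f = F2" "section5 3 f = F3" "section5 4 f = F4"
proof -
  have nth: "fps_nth f (5 * n + r) = (if r = 0 then fps_nth F0 n else if r = 1 then fps_nth F1 n
      else if r = 2 then fps_nth F2 n else if r = 3 then fps_nth F3 n else fps_nth F4 n)" if r: "r < 5" for n r
  proof -
    have X: "fps_nth (fps_X ^ k * subst5 G) (5 * n + r) = (if r = k then fps_nth G n else 0)" if "k < 5" for k G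
    proof (cases "r = k")
      case True
      thus ?thesis by (simp add: fps_X_power_mult_nth fps_nth_compose_X_power)
    next
      case False
      have "\<not> 5 dvd 5 * n + r - k" if "\<not> 5 * n + r < k"
        using that False r \<open>k < 5\<close> by presburger
      thus ?thesis using False by (simp add: fps_X_power_mult_nth fps_nth_compose_X_power)
    qed
    have f: "f = fps_X ^ 0 * subst5 F0 + fps_X ^ 1 * subst5 F1 + fps_X^2 * subst5 F2 + fps_X^3 * subst5 F3 + fps_X^4 * subst5 F4"
      using assms by simp
    have X': "fps_nth (fps_X ^ 0 * subst5 F0) (5 * n + r) = (if r = 0 then fps_nth F0 n else 0)"
      "fps_nth (fps_X ^ 1 * subst5 F1) (5 * n + r) = (if r = 1 then fps_nth F1 n else 0)"
      "fps_nth (fps_X ^ 2 * subst5 F2) (5 * n + r) = (if r = 2 then fps_nth F2 n else 0)"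
      "fps_nth (fps_X ^ 3 * subst5 F3) (5 * n + r) = (if r = 3 then fps_nth F3 n else 0)"
      "fps_nth (fps_X ^ 4 * subst5 F4) (5 * n + r) = (if r = 4 then fps_nth F4 n else 0)"
      by (intro X; simp)+
    show ?thesis unfolding f fps_add_nth X' using r by auto
  qed
  show "section5 0 f = F0" "section5 1 f = F1" "section5 2 f = F2" "section5 3 f = F3" "section5 4 f = F4"
    using nth[of 0] nth[of 1] nth[of 2] nth[of 3] nth[of 4] by (simp_all add: fps_eq_iff)
qed


text \<open>A divisor prime to 5 does not see the additional factor 5. This is why the sections at
  $5n$ reproduce the Lambert series.\<close>

lemma signed_divisors_mult_5:
  assumes "n > 0" "0 < r" "r < 5"
  shows "signed_divisors r (5 * n) = signed_divisors r n"
proof -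
  have "m dvd int (5 * n) \<longleftrightarrow> m dvd int n" if "m mod 5 = int r" for m
  proof -
    have "\<not> 5 dvd m" using that assms by (auto simp: dvd_eq_mod_eq_0)
    moreover have "prime (5 :: int)" by simp
    ultimately have "coprime m 5" by (metis coprime_commute prime_imp_coprime_int)
    thus ?thesis by (simp add: coprime_dvd_mult_right_iff)
  qed
  hence "{m. m dvd int (5 * n) \<and> m mod 5 = int r} = {m. m dvd int n \<and> m mod 5 = int r}"
    by blast
  thus ?thesis unfolding signed_divisors_def by (rule arg_cong)
qed

text \<open>The map from \<open>m\<close> to \<open>n / m\<close> preserves signs and exchanges the
  classes of \<open>i\<close> and \<open>j\<close>, whose product is the class of
  \<open>n\<close>.\<close>

lemma signed_divisors_complement:
  assumes n: "n > 0" and ij: "(i * j) mod 5 = n mod 5" "n mod 5 \<noteq> 0" "i < 5" "j < 5"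
  shows "signed_divisors i n = signed_divisors j n"
  unfolding signed_divisors_def
proof (rule sum.reindex_bij_witness[of _ "\<lambda>m. int n div m" "\<lambda>m. int n div m"])
  have *: "int n div m \<in> {m. m dvd int n \<and> m mod 5 = int s} \<and> int n div (int n div m) = m \<and> sgn (int n div m) = sgn m"
    if m: "m \<in> {m. m dvd int n \<and> m mod 5 = int r}" and rs: "(r * s) mod 5 = n mod 5" "r < 5" "s < 5" for m r s
  proof -
    obtain k where k: "int n = m * k" using m by auto
    have mk: "m \<noteq> 0" "k \<noteq> 0" using k n by auto
    have "0 < m * k" using k n by simp
    hence sg: "sgn k = sgn m" by (auto simp: zero_less_mult_iff)
    have r: "m mod 5 = int r" using m by simp
    have "(int r * k) mod 5 = (int r * int s) mod 5"
    proof -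
      have "(int r * k) mod 5 = (m * k) mod 5" using r by (metis mod_mult_left_eq)
      also have "\<dots> = int (n mod 5)" by (simp add: k [symmetric] zmod_int)
      also have "\<dots> = (int r * int s) mod 5" using rs(1) by (metis of_nat_mod of_nat_mult of_nat_numeral)
      finally show ?thesis .
    qed
    moreover have "r \<noteq> 0" using rs ij(2) by (metis mult_0 mod_0)
    hence "coprime (int r) 5"
    proof -
      have "\<not> 5 dvd int r" using \<open>r \<noteq> 0\<close> rs(2) by (auto dest: zdvd_imp_le)
      moreover have "prime (5 :: int)" by simp
      ultimately show ?thesis by (metis coprime_commute prime_imp_coprime_int)
    qed
    ultimately have "[k = int s] (mod 5)"
      using cong_mult_lcancel[of "int r" 5 k "int s"] by (simp add: cong_def)
    hence "k mod 5 = int s" using rs(3) by (simp add: cong_def)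
    moreover have "int n div m = k" "int n div k = m" using k mk by simp_all
    ultimately show ?thesis using k sg by auto
  qed
  fix m
  have ji: "(j * i) mod 5 = n mod 5" using ij(1) by (simp add: mult.commute)
  note 1 = *[OF _ ij(1,3,4)] and 2 = *[OF _ ji ij(4,3)]
  show "int n div (int n div m) = m" "int n div m \<in> {m. m dvd int n \<and> m mod 5 = int j}"
    "sgn (int n div m) = sgn m" if "m \<in> {m. m dvd int n \<and> m mod 5 = int i}"
    using 1[OF that] by auto
  show "int n div (int n div m) = m" "int n div m \<in> {m. m dvd int n \<and> m mod 5 = int i}"
    if "m \<in> {m. m dvd int n \<and> m mod 5 = int j}"
    using 2[OF that] by auto
qed

section \<open>Quintisection of the Lambert series\<close>

lemma fps_eq_section5_sum:
  "f = subst5 (section5 0 f) + fps_X * subst5 (section5 1 f) + fps_X^2 * subst5 (section5 2 f)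
     + fps_X^3 * subst5 (section5 3 f) + fps_X^4 * subst5 (section5 4 f)" (is "f = ?g")
proof (rule fps_ext)
  fix n :: nat
  have "n mod 5 \<in> {0,1,2,3,4}" by auto
  hence "section5 (n mod 5) ?g = section5 (n mod 5) f"
    using section5_dissection[of ?g, OF refl] by auto
  hence "fps_nth (section5 (n mod 5) ?g) (n div 5) = fps_nth (section5 (n mod 5) f) (n div 5)"
    by (simp only:)
  thus "fps_nth f n = fps_nth ?g n" by (simp only: section5_nth mult_div_mod_eq)
qed

abbreviation euler5 :: "complex fps" where "euler5 \<equiv> qp 1 5 5"

text \<open>Kronecker's identity for $(i, l) = (1,1), (1,2), (1,3), (2,2)$. The products $il$ are
  the four nonzero residues modulo 5, and in the second and third case one of $A$ and $B$
  cancels.\<close>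

lemma kronecker_quotients:
  "fps_nth (euler5 ^ 2 * rrB * inverse rrA ^ 2) n = of_int (signed_divisors 1 (5 * n + 1))"
  "fps_nth (euler5 ^ 2 * inverse rrA) n = of_int (signed_divisors 1 (5 * n + 2))"
  "fps_nth (euler5 ^ 2 * inverse rrB) n = of_int (signed_divisors 1 (5 * n + 3))"
  "fps_nth (euler5 ^ 2 * rrA * inverse rrB ^ 2) n = of_int (signed_divisors 2 (5 * n + 4))"
proof -
  have A: "rrA * inverse rrA = 1" and B: "rrB * inverse rrB = 1"
    by (simp_all add: inverse_mult_eq_1')
  have q: "qp 1 2 5 * qp 1 3 5 = rrB" "qp 1 3 5 * qp 1 2 5 = rrB"
    "qp 1 1 5 * qp 1 4 5 = rrA" "qp 1 4 5 * qp 1 1 5 = rrA"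
    by (simp_all add: rrA_def rrB_def)
  have K: "fps_nth (euler5 ^ 2 * (qp 1 a 5 * qp 1 b 5) * inverse (qp 1 i 5 * qp 1 i' 5 * (qp 1 l 5 * qp 1 l' 5))) n =
       of_int (signed_divisors i (5 * n + r))"
    if "0 < i" "0 < l" "i + l < 5" "a = i + l" "b = 5 - i - l" "i' = 5 - i" "l' = 5 - l" "r = i * l" for i l a b i' l' r
    unfolding that(4-8) using kronecker_sum_nth[OF that(1-3) kronecker_sum[OF that(1-3)]] .
  have "fps_nth (euler5 ^ 2 * rrB * inverse (rrA * rrA)) n = of_int (signed_divisors 1 (5 * n + 1))"
    by (rule K[where i = 1 and l = 1 and a = 2 and b = 3 and i' = 4 and l' = 4 and r = 1, unfolded q]) simp_all
  thus "fps_nth (euler5 ^ 2 * rrB * inverse rrA ^ 2) n = of_int (signed_divisors 1 (5 * n + 1))"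
    by (simp add: fps_inverse_mult power2_eq_square)
  have "fps_nth (euler5 ^ 2 * rrB * inverse (rrA * rrB)) n = of_int (signed_divisors 1 (5 * n + 2))"
    by (rule K[where i = 1 and l = 2 and a = 3 and b = 2 and i' = 4 and l' = 3 and r = 2, unfolded q]) simp_all
  also have "euler5 ^ 2 * rrB * inverse (rrA * rrB) = euler5 ^ 2 * inverse rrA * (rrB * inverse rrB)"
    by (simp add: fps_inverse_mult mult_ac)
  finally show "fps_nth (euler5 ^ 2 * inverse rrA) n = of_int (signed_divisors 1 (5 * n + 2))"
    by (simp add: B)
  have "fps_nth (euler5 ^ 2 * rrA * inverse (rrA * rrB)) n = of_int (signed_divisors 1 (5 * n + 3))"
    by (rule K[where i = 1 and l = 3 and a = 4 and b = 1 and i' = 4 and l' = 2 and r = 3, unfolded q]) simp_all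
  also have "euler5 ^ 2 * rrA * inverse (rrA * rrB) = euler5 ^ 2 * inverse rrB * (rrA * inverse rrA)"
    by (simp add: fps_inverse_mult mult_ac)
  finally show "fps_nth (euler5 ^ 2 * inverse rrB) n = of_int (signed_divisors 1 (5 * n + 3))"
    by (simp add: A)
  have "fps_nth (euler5 ^ 2 * rrA * inverse (rrB * rrB)) n = of_int (signed_divisors 2 (5 * n + 4))"
    by (rule K[where i = 2 and l = 2 and a = 4 and b = 1 and i' = 3 and l' = 3 and r = 4, unfolded q]) simp_all
  thus "fps_nth (euler5 ^ 2 * rrA * inverse rrB ^ 2) n = of_int (signed_divisors 2 (5 * n + 4))"
    by (simp add: fps_inverse_mult power2_eq_square)
qed

text \<open>The remaining sections follow by combining two symmetries: the complement exchanges
  classes with product \<open>n\<close>, the reflection exchanges opposite classes with a sign. If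
  both exchange the same pair, as for 1 and 4 at $5n + 4$ or 2 and 3 at $5n + 1$, the section
  vanishes.\<close>

lemma section5_lambert5:
  "section5 0 (lambert5 1) = lambert5 1" "section5 1 (lambert5 1) = euler5 ^ 2 * rrB * inverse rrA ^ 2"
  "section5 2 (lambert5 1) = euler5 ^ 2 * inverse rrA" "section5 3 (lambert5 1) = euler5 ^ 2 * inverse rrB"
  "section5 4 (lambert5 1) = 0"
  "section5 0 (lambert5 2) = lambert5 2" "section5 1 (lambert5 2) = 0"
  "section5 2 (lambert5 2) = euler5 ^ 2 * inverse rrA" "section5 3 (lambert5 2) = - (euler5 ^ 2 * inverse rrB)"
  "section5 4 (lambert5 2) = euler5 ^ 2 * rrA * inverse rrB ^ 2"
proof -
  have c14: "signed_divisors 1 (5 * n + 4) = 0" for n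
  proof -
    have "signed_divisors 1 (5 * n + 4) = signed_divisors 4 (5 * n + 4)"
      by (rule signed_divisors_complement; presburger)
    moreover have "signed_divisors 1 (5 * n + 4) = - signed_divisors 4 (5 * n + 4)"
      by (rule signed_divisors_reflect) simp_all
    ultimately show ?thesis by linarith
  qed
  have c23: "signed_divisors 2 (5 * n + 1) = 0" for n
  proof -
    have "signed_divisors 2 (5 * n + 1) = signed_divisors 3 (5 * n + 1)"
      by (rule signed_divisors_complement; presburger)
    moreover have "signed_divisors 2 (5 * n + 1) = - signed_divisors 3 (5 * n + 1)"
      by (rule signed_divisors_reflect) simp_all
    ultimately show ?thesis by linarith
  qed
  have c12: "signed_divisors 2 (5 * n + 2) = signed_divisors 1 (5 * n + 2)" for n
    by (rule signed_divisors_complement; presburger)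
  have c24: "signed_divisors 2 (5 * n + 3) = - signed_divisors 1 (5 * n + 3)" for n
  proof -
    have "signed_divisors 2 (5 * n + 3) = signed_divisors 4 (5 * n + 3)"
      by (rule signed_divisors_complement; presburger)
    moreover have "signed_divisors 1 (5 * n + 3) = - signed_divisors 4 (5 * n + 3)"
      by (rule signed_divisors_reflect) simp_all
    ultimately show ?thesis by linarith
  qed
  have nth: "fps_nth (section5 r (lambert5 i)) n = of_int (signed_divisors i (5 * n + r))" if "r > 0" for r i n
    using that by (simp add: lambert5_def)
  show "section5 0 (lambert5 1) = lambert5 1" "section5 0 (lambert5 2) = lambert5 2"
    by (simp_all add: fps_eq_iff lambert5_def signed_divisors_mult_5)
  show "section5 1 (lambert5 1) = euler5 ^ 2 * rrB * inverse rrA ^ 2"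
    "section5 2 (lambert5 1) = euler5 ^ 2 * inverse rrA" "section5 3 (lambert5 1) = euler5 ^ 2 * inverse rrB"
    "section5 4 (lambert5 1) = 0" "section5 1 (lambert5 2) = 0"
    "section5 2 (lambert5 2) = euler5 ^ 2 * inverse rrA" "section5 3 (lambert5 2) = - (euler5 ^ 2 * inverse rrB)"
    "section5 4 (lambert5 2) = euler5 ^ 2 * rrA * inverse rrB ^ 2"
    unfolding fps_eq_iff
    by (simp_all only: nth zero_less_one zero_less_numeral kronecker_quotients c14 c23 c12 c24
        fps_neg_nth fps_zero_nth of_int_0 of_int_minus simp_thms)
qed

lemma lambert5_dissection:
  "lambert5 1 = subst5 (lambert5 1) + fps_X * subst5 (euler5 ^ 2 * rrB * inverse rrA ^ 2)
     + fps_X^2 * subst5 (euler5 ^ 2 * inverse rrA) + fps_X^3 * subst5 (euler5 ^ 2 * inverse rrB)"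
  "lambert5 2 = subst5 (lambert5 2) + fps_X^2 * subst5 (euler5 ^ 2 * inverse rrA)
     - fps_X^3 * subst5 (euler5 ^ 2 * inverse rrB) + fps_X^4 * subst5 (euler5 ^ 2 * rrA * inverse rrB ^ 2)"
  by (rule trans[OF fps_eq_section5_sum[of "lambert5 1", unfolded section5_lambert5]], simp)
    (rule trans[OF fps_eq_section5_sum[of "lambert5 2", unfolded section5_lambert5]], simp add: fps_compose_uminus)

section \<open>Partitions weighted by the number of parts\<close>

definition bounded_partitions :: "nat \<Rightarrow> nat \<Rightarrow> nat multiset set" where
  "bounded_partitions N n = {p. is_partition p \<and> \<Sum>\<^sub># p = n \<and> (\<forall>x\<in>#p. x \<le> N)}"

definition partitions :: "nat \<Rightarrow> nat multiset set" where
  "partitions n = {p. is_partition p \<and> \<Sum>\<^sub># p = n}"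

lemma finite_partitions: "finite (partitions n)"
proof (rule finite_subset)
  have "p \<in> hd ` colored_partitions 1 n" if "p \<in> partitions n" for p
    using that by (intro image_eqI[of _ _ "[p]"]) (auto simp: partitions_def colored_partitions_def)
  thus "partitions n \<subseteq> hd ` colored_partitions 1 n" by blast
qed (simp add: finite_colored_partitions)

lemma bounded_partitions_subset: "bounded_partitions N n \<subseteq> partitions n"
  by (auto simp: bounded_partitions_def partitions_def)

lemma finite_bounded_partitions: "finite (bounded_partitions N n)"
  using bounded_partitions_subset finite_partitions finite_subset by blast

lemma bounded_partitions_eq: "n \<le> N \<Longrightarrow> bounded_partitions N n = partitions n"
proof -
  assume "n \<le> N"
  have "x \<le> N" if "x \<in># p" "\<Sum>\<^sub># p = n" for x p
    using that \<open>n \<le> N\<close> by (metis sum_mset.remove le_add1 le_trans)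
  thus ?thesis by (auto simp: bounded_partitions_def partitions_def)
qed

lemma bounded_partitions_0: "bounded_partitions 0 n = (if n = 0 then {{#}} else {})"
proof -
  have "p \<in> bounded_partitions 0 n \<longleftrightarrow> p = {#} \<and> n = 0" for p
  proof
    assume p: "p \<in> bounded_partitions 0 n"
    hence "x \<notin># p" for x by (auto simp: bounded_partitions_def is_partition_def)
    hence "p = {#}" by (meson multiset_nonemptyE)
    thus "p = {#} \<and> n = 0" using p by (simp add: bounded_partitions_def)
  qed (simp add: bounded_partitions_def is_partition_def)
  thus ?thesis by (intro set_eqI) simp
qed

lemma bounded_partitions_Suc:
  "bounded_partitions (Suc N) n = bounded_partitions N n \<union>
     (if n < Suc N then {} else add_mset (Suc N) ` bounded_partitions (Suc N) (n - Suc N))"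
proof (intro equalityI subsetI)
  fix p assume p: "p \<in> bounded_partitions (Suc N) n"
  show "p \<in> bounded_partitions N n \<union>
     (if n < Suc N then {} else add_mset (Suc N) ` bounded_partitions (Suc N) (n - Suc N))"
  proof (cases "Suc N \<in># p")
    case True
    then obtain r where r: "p = add_mset (Suc N) r" by (metis insert_DiffM)
    hence "r \<in> bounded_partitions (Suc N) (n - Suc N)" "\<not> n < Suc N"
      using p by (auto simp: bounded_partitions_def is_partition_def)
    thus ?thesis using r by auto
  next
    case False
    hence "\<forall>x\<in>#p. x \<le> N" using p by (auto simp: bounded_partitions_def le_Suc_eq)
    thus ?thesis using p by (auto simp: bounded_partitions_def)
  qed
qed (auto simp: bounded_partitions_def is_partition_def le_Suc_eq split: if_splits)

definition bounded_gf :: "(nat multiset \<Rightarrow> complex) \<Rightarrow> nat \<Rightarrow> complex fps" where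
  "bounded_gf f N = Abs_fps (\<lambda>n. \<Sum>p\<in>bounded_partitions N n. f p)"

definition partition_gf :: "(nat multiset \<Rightarrow> complex) \<Rightarrow> complex fps" where
  "partition_gf f = Abs_fps (\<lambda>n. \<Sum>p\<in>partitions n. f p)"

lemma bounded_gf_LIMSEQ: "bounded_gf f \<longlonglongrightarrow> partition_gf f"
proof (rule tendsto_fpsI)
  fix n show "eventually (\<lambda>N. fps_nth (bounded_gf f N) n = fps_nth (partition_gf f) n) sequentially"
    using eventually_ge_at_top[of n]
    by eventually_elim (simp add: bounded_gf_def partition_gf_def bounded_partitions_eq)
qed

lemma bounded_gf_0: "bounded_gf f 0 = fps_const (f {#})"
  by (simp add: fps_eq_iff bounded_gf_def bounded_partitions_0)

text \<open>Either \<open>Suc N\<close> is no part, or one copy of it is removed. The second term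
  keeps the bound \<open>Suc N\<close>, since further copies may remain; for a weight that reacts to
  the new part by a factor this is a linear equation for the left-hand side.\<close>

lemma bounded_gf_Suc:
  "bounded_gf f (Suc N) = bounded_gf f N + fps_X ^ Suc N * bounded_gf (\<lambda>p. f (add_mset (Suc N) p)) (Suc N)"
proof (rule fps_ext)
  fix n
  let ?S = "if n < Suc N then {} else add_mset (Suc N) ` bounded_partitions (Suc N) (n - Suc N)"
  have "fps_nth (bounded_gf f (Suc N)) n = (\<Sum>p\<in>bounded_partitions N n \<union> ?S. f p)"
    unfolding bounded_gf_def fps_nth_Abs_fps by (rule arg_cong[OF bounded_partitions_Suc])
  also have "\<dots> = (\<Sum>p\<in>bounded_partitions N n. f p) + (\<Sum>p\<in>?S. f p)"
  proof (rule sum.union_disjoint)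
    have "Suc N \<notin># p" if "p \<in> bounded_partitions N n" for p
      using that by (auto simp: bounded_partitions_def)
    moreover have "Suc N \<in># p" if "p \<in> ?S" for p
      using that by (auto split: if_splits)
    ultimately show "bounded_partitions N n \<inter> ?S = {}" by blast
  qed (simp_all add: finite_bounded_partitions)
  also have "(\<Sum>p\<in>?S. f p) = fps_nth (fps_X ^ Suc N * bounded_gf (\<lambda>p. f (add_mset (Suc N) p)) (Suc N)) n"
    unfolding fps_X_power_mult_nth by (simp add: bounded_gf_def sum.reindex inj_on_def o_def)
  finally show "fps_nth (bounded_gf f (Suc N)) n =
      fps_nth (bounded_gf f N + fps_X ^ Suc N * bounded_gf (\<lambda>p. f (add_mset (Suc N) p)) (Suc N)) n"
    by (simp add: bounded_gf_def)
qed

lemma bounded_gf_cmult: "bounded_gf (\<lambda>p. c * f p) N = fps_const c * bounded_gf f N"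
  by (simp add: fps_eq_iff bounded_gf_def sum_distrib_left)

lemma bounded_gf_add: "bounded_gf (\<lambda>p. f p + g p) N = bounded_gf f N + bounded_gf g N"
  by (simp add: fps_eq_iff bounded_gf_def sum.distrib)

definition size_gf :: "complex \<Rightarrow> complex fps" where
  "size_gf z = partition_gf (\<lambda>p. z ^ size p)"

definition weighted_size_gf :: "complex \<Rightarrow> complex fps" where
  "weighted_size_gf z = partition_gf (\<lambda>p. of_nat (size p) * z ^ size p)"

text \<open>The Lambert series with terms $zq^i/(1 - zq^i)$, which is $z$ times the logarithmic
  $z$-derivative of \<open>size_gf z\<close>.\<close>

definition divisor_gf :: "complex \<Rightarrow> complex fps" where
  "divisor_gf z = Abs_fps (\<lambda>n. if n = 0 then 0 else \<Sum>d | d dvd n. z ^ d)"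

lemma bounded_size_gf: "bounded_gf (\<lambda>p. z ^ size p) N * qpn z 1 1 N = 1"
proof (induction N)
  case (Suc N)
  define u where "u = fps_const z * fps_X ^ Suc N"
  have "bounded_gf (\<lambda>p. z ^ size p) (Suc N) = bounded_gf (\<lambda>p. z ^ size p) N + u * bounded_gf (\<lambda>p. z ^ size p) (Suc N)"
    by (subst bounded_gf_Suc) (simp only: size_add_mset power_Suc bounded_gf_cmult u_def mult_ac)
  hence "bounded_gf (\<lambda>p. z ^ size p) (Suc N) * (1 - u) = bounded_gf (\<lambda>p. z ^ size p) N"
    by (simp add: algebra_simps)
  thus ?case using Suc unfolding qpn_Suc by (simp add: u_def mult_ac)
qed (simp add: bounded_gf_0)

lemma size_gf: "size_gf z * qp z 1 1 = 1"
proof -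
  have "(\<lambda>N. bounded_gf (\<lambda>p. z ^ size p) N * qpn z 1 1 N) \<longlonglongrightarrow> size_gf z * qp z 1 1"
    unfolding size_gf_def by (intro tendsto_mult bounded_gf_LIMSEQ qpn_LIMSEQ) auto
  thus ?thesis unfolding bounded_size_gf using LIMSEQ_unique tendsto_const by blast
qed

text \<open>Logarithmic differentiation in $z$ without a derivative: the factor that belongs to the
  part $i + 1$ contributes $zq^{i+1}/(1 - zq^{i+1})$, written as an inverse minus 1.\<close>

lemma bounded_weighted_size_gf:
  "bounded_gf (\<lambda>p. of_nat (size p) * z ^ size p) N =
     bounded_gf (\<lambda>p. z ^ size p) N * (\<Sum>i<N. inverse (1 - fps_const z * fps_X ^ Suc i) - 1)"
proof (induction N)
  case (Suc N)
  define u where "u = fps_const z * fps_X ^ Suc N"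
  define G where "G = bounded_gf (\<lambda>p. z ^ size p)"
  define H where "H = bounded_gf (\<lambda>p. of_nat (size p) * z ^ size p)"
  define S where "S = (\<lambda>N. \<Sum>i<N. inverse (1 - fps_const z * fps_X ^ Suc i) - 1)"
  have "G (Suc N) = G N + u * G (Suc N)"
    unfolding G_def by (subst bounded_gf_Suc) (simp only: size_add_mset power_Suc bounded_gf_cmult u_def mult_ac)
  hence G: "G N = G (Suc N) * (1 - u)" by (simp add: algebra_simps)
  have "of_nat (size (add_mset (Suc N) p)) * z ^ size (add_mset (Suc N) p) =
      z * (of_nat (size p) * z ^ size p + z ^ size p)" for p :: "nat multiset"
    by (simp add: algebra_simps)
  hence H: "H (Suc N) = H N + u * (H (Suc N) + G (Suc N))"
    unfolding G_def H_def
    by (subst bounded_gf_Suc) (simp only: bounded_gf_cmult bounded_gf_add u_def mult_ac)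
  have u1: "(1 - u) * inverse (1 - u) = 1" by (rule inverse_mult_eq_1') (simp add: u_def)
  have "H (Suc N) * (1 - u) = H N + u * G (Suc N)" using H by (simp add: algebra_simps)
  also have "H N = G N * S N" using Suc by (simp add: G_def H_def S_def)
  also have "G N * S N + u * G (Suc N) = G (Suc N) * ((1 - u) * S N + u)"
    unfolding G by (simp add: algebra_simps)
  also have "(1 - u) * S N + u = (1 - u) * S N + (1 - u) * (inverse (1 - u) - 1)"
    using u1 by (simp only: right_diff_distrib) simp
  also have "\<dots> = (1 - u) * S (Suc N)" by (simp add: S_def u_def distrib_left del: power_Suc)
  finally have "H (Suc N) * (1 - u) = G (Suc N) * S (Suc N) * (1 - u)" by (simp only: mult_ac)
  moreover have "1 - u \<noteq> 0" using u1 by auto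
  ultimately show ?case by (simp add: G_def H_def S_def)
qed (simp add: bounded_gf_0)

text \<open>The part $i$ contributes $z^{n/i}$ to the coefficient of $q^n$ if it divides
  \<open>n\<close>. Summation over the complementary divisor $d = n/i$ gives the divisor sum; only
  parts up to \<open>n\<close> matter.\<close>

lemma divisor_gf_LIMSEQ:
  "(\<lambda>N. \<Sum>i<N. inverse (1 - fps_const z * fps_X ^ Suc i) - 1) \<longlonglongrightarrow> divisor_gf z"
proof (rule tendsto_fpsI)
  fix n
  have nth: "fps_nth (\<Sum>i<N. inverse (1 - fps_const z * fps_X ^ Suc i) - 1) n = fps_nth (divisor_gf z) n"
    if "N \<ge> n" for N
  proof (cases "n = 0")
    case True
    thus ?thesis by (simp add: fps_sum_nth divisor_gf_def)
  next
    case False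
    have "fps_nth (\<Sum>i<N. inverse (1 - fps_const z * fps_X ^ Suc i) - 1) n =
        (\<Sum>i<N. if Suc i dvd n then z ^ (n div Suc i) else 0)"
      unfolding fps_sum_nth using False
      by (intro sum.cong refl) (simp add: fps_nth_inverse_one_minus_monom del: power_Suc)
    also have "\<dots> = (\<Sum>i | i < N \<and> Suc i dvd n. z ^ (n div Suc i))"
      using sum.inter_filter[of "{..<N}" "\<lambda>i. z ^ (n div Suc i)" "\<lambda>i. Suc i dvd n"] by simp
    also have "\<dots> = (\<Sum>d | d dvd n. z ^ d)"
    proof (rule sum.reindex_bij_witness[of _ "\<lambda>d. n div d - 1" "\<lambda>i. n div Suc i"])
      fix d assume d: "d \<in> {d. d dvd n}"
      then obtain k where k: "n = d * k" by auto
      hence "k > 0" "d > 0" using False by auto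
      moreover have "k \<le> n" using k \<open>d > 0\<close> by simp
      hence "k - 1 < N" using \<open>k > 0\<close> that by linarith
      ultimately show "n div d - 1 \<in> {i. i < N \<and> Suc i dvd n}" "n div Suc (n div d - 1) = d"
        using k by auto
    next
      fix i assume i: "i \<in> {i. i < N \<and> Suc i dvd n}"
      then obtain k where k: "n = Suc i * k" by auto
      moreover have "k > 0" using k False by (cases k) auto
      ultimately show "n div (n div Suc i) - 1 = i" "n div Suc i \<in> {d. d dvd n}"
        by (auto simp del: mult_Suc)
    qed auto
    finally show ?thesis using False by (simp add: divisor_gf_def)
  qed
  show "eventually (\<lambda>N. fps_nth (\<Sum>i<N. inverse (1 - fps_const z * fps_X ^ Suc i) - 1) n = fps_nth (divisor_gf z) n) sequentially"
    using eventually_ge_at_top[of n] by eventually_elim (rule nth)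
qed

lemma weighted_size_gf: "weighted_size_gf z = size_gf z * divisor_gf z"
proof (rule LIMSEQ_unique)
  show "bounded_gf (\<lambda>p. of_nat (size p) * z ^ size p) \<longlonglongrightarrow> weighted_size_gf z"
    unfolding weighted_size_gf_def by (rule bounded_gf_LIMSEQ)
  have "(\<lambda>N. bounded_gf (\<lambda>p. z ^ size p) N * (\<Sum>i<N. inverse (1 - fps_const z * fps_X ^ Suc i) - 1))
      \<longlonglongrightarrow> size_gf z * divisor_gf z"
    unfolding size_gf_def by (intro tendsto_mult bounded_gf_LIMSEQ divisor_gf_LIMSEQ)
  thus "bounded_gf (\<lambda>p. of_nat (size p) * z ^ size p) \<longlonglongrightarrow> size_gf z * divisor_gf z"
    unfolding bounded_weighted_size_gf [symmetric] by simp
qed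

lemma sum_colored_partitions_2:
  "(\<Sum>\<pi>\<in>colored_partitions 2 n. f (\<pi> ! 0) (\<pi> ! 1)) =
   (\<Sum>i\<in>{0..n}. \<Sum>p\<in>partitions i. \<Sum>r\<in>partitions (n - i). f p r :: 'a :: comm_monoid_add)"
proof -
  have "(\<Sum>i\<in>{0..n}. \<Sum>p\<in>partitions i. \<Sum>r\<in>partitions (n - i). f p r) =
      (\<Sum>(i, p, r)\<in>(SIGMA i:{0..n}. partitions i \<times> partitions (n - i)). f p r)"
    by (simp add: sum.Sigma sum.cartesian_product finite_partitions case_prod_unfold)
  also have "\<dots> = (\<Sum>\<pi>\<in>colored_partitions 2 n. f (\<pi> ! 0) (\<pi> ! 1))"
  proof (rule sum.reindex_bij_witness[of _ "\<lambda>\<pi>. (\<Sum>\<^sub># (\<pi> ! 0), \<pi> ! 0, \<pi> ! 1)" "\<lambda>(i, p, r). [p, r]"])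
    fix \<pi> assume pi: "\<pi> \<in> colored_partitions 2 n"
    then obtain p r where pr: "\<pi> = [p, r]"
      by (auto simp: colored_partitions_def numeral_2_eq_2 length_Suc_conv)
    thus "(case (\<Sum>\<^sub># (\<pi> ! 0), \<pi> ! 0, \<pi> ! 1) of (i, p, r) \<Rightarrow> [p, r]) = \<pi>"
      "(\<Sum>\<^sub># (\<pi> ! 0), \<pi> ! 0, \<pi> ! 1) \<in> (SIGMA i:{0..n}. partitions i \<times> partitions (n - i))"
      using pi by (auto simp: colored_partitions_def partitions_def)
  qed (auto simp: colored_partitions_def partitions_def)
  finally show ?thesis ..
qed

section \<open>Crank-weighted generating functions\<close>

definition NB_gf :: "nat \<Rightarrow> complex fps" where
  "NB_gf m = Abs_fps (\<lambda>n. of_nat (NB 2 m 5 n))"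

lemma root5_power_mod:
  assumes "z ^ 5 = (1 :: complex)"
  shows "z ^ k = z ^ (k mod 5)"
proof -
  have "z ^ k = z ^ (5 * (k div 5) + k mod 5)" by simp
  also have "\<dots> = (z ^ 5) ^ (k div 5) * z ^ (k mod 5)" by (simp only: power_add power_mult)
  finally show ?thesis using assms by simp
qed

lemma root5_power_crank:
  assumes "z ^ 5 = (1 :: complex)"
  shows "z ^ a * (z ^ 4) ^ b = z ^ nat ((int a - int b) mod 5)"
proof -
  have "int ((a + 4 * b) mod 5) = (int a - int b + int b * 5) mod 5"
    by (simp add: zmod_int algebra_simps)
  also have "\<dots> = (int a - int b) mod 5" by (rule mod_mult_self1)
  finally have "nat ((int a - int b) mod 5) = (a + 4 * b) mod 5" by simp
  moreover have "z ^ a * (z ^ 4) ^ b = z ^ (a + 4 * b)" by (simp add: power_add power_mult)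
  ultimately show ?thesis using root5_power_mod[OF assms, of "a + 4 * b"] by simp
qed

text \<open>Weighting by $z^m$ and summing over the classes \<open>m\<close> replaces the congruence
  condition by the weight $z$ to the crank. This weight factors over the two colours, with $z^4$ in
  the place of $1/z$, and the factor counting parts affects the first colour only.\<close>

lemma NB_gf_root5:
  assumes z: "z ^ 5 = 1"
  shows "(\<Sum>m<5. fps_const (z ^ m) * NB_gf m) = size_gf z * size_gf (z ^ 4) * divisor_gf z"
proof (rule fps_ext)
  fix n
  let ?C = "colored_partitions 2 n"
  define h where "h = (\<lambda>\<pi>::nat multiset list. of_nat (size (\<pi> ! 0)) * z ^ nat (crank \<pi> mod 5))"
  have "fps_nth (\<Sum>m<5. fps_const (z ^ m) * NB_gf m) n = (\<Sum>m<5. z ^ m * of_nat (NB 2 m 5 n))"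
    by (simp add: fps_sum_nth NB_gf_def)
  also have "\<dots> = (\<Sum>m<5. \<Sum>\<pi> | \<pi> \<in> ?C \<and> nat (crank \<pi> mod 5) = m. h \<pi>)"
  proof (intro sum.cong refl)
    fix m :: nat assume "m \<in> {..<5}"
    hence m: "m < 5" by simp
    have "(k mod 5 = int m mod 5) = (nat (k mod 5) = m)" for k :: int
    proof -
      have "int m mod 5 = int m" using m by simp
      moreover have "k mod 5 \<ge> 0" by simp
      ultimately show ?thesis by linarith
    qed
    hence eq: "{\<pi>. \<pi> \<in> ?C \<and> [crank \<pi> = int m] (mod int 5)} = {\<pi>. \<pi> \<in> ?C \<and> nat (crank \<pi> mod 5) = m}"
      by (simp add: cong_def)
    have "z ^ m * of_nat (NB 2 m 5 n) = (\<Sum>\<pi> | \<pi> \<in> ?C \<and> nat (crank \<pi> mod 5) = m. z ^ m * of_nat (size (\<pi> ! 0)))"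
      unfolding NB_def eq by (simp add: sum_distrib_left)
    also have "\<dots> = (\<Sum>\<pi> | \<pi> \<in> ?C \<and> nat (crank \<pi> mod 5) = m. h \<pi>)"
      by (intro sum.cong) (auto simp: h_def)
    finally show "z ^ m * of_nat (NB 2 m 5 n) = \<dots>" .
  qed
  also have "\<dots> = (\<Sum>\<pi>\<in>?C. h \<pi>)"
    by (rule sum.group) (auto simp: finite_colored_partitions nat_less_iff)
  also have "\<dots> = (\<Sum>\<pi>\<in>?C. of_nat (size (\<pi> ! 0)) * z ^ size (\<pi> ! 0) * (z ^ 4) ^ size (\<pi> ! 1))"
    by (simp add: h_def crank_def root5_power_crank[OF z] mult.assoc)
  also have "\<dots> = (\<Sum>i\<in>{0..n}. \<Sum>p\<in>partitions i. \<Sum>r\<in>partitions (n - i). of_nat (size p) * z ^ size p * (z ^ 4) ^ size r)"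
    by (rule sum_colored_partitions_2[where f = "\<lambda>p r. of_nat (size p) * z ^ size p * (z ^ 4) ^ size r"])
  also have "\<dots> = fps_nth (weighted_size_gf z * size_gf (z ^ 4)) n"
    by (simp add: fps_mult_nth weighted_size_gf_def size_gf_def partition_gf_def sum_product)
  finally show "fps_nth (\<Sum>m<5. fps_const (z ^ m) * NB_gf m) n = fps_nth (size_gf z * size_gf (z ^ 4) * divisor_gf z) n"
    by (simp add: weighted_size_gf mult_ac)
qed

lemma signed_divisors_conv_nat:
  assumes n: "n > 0" and rs: "r + s = 5" "0 < r" "0 < s"
  shows "signed_divisors r n = (\<Sum>d | d dvd n. if d mod 5 = r then 1 else 0)
    - (\<Sum>d | d dvd n. if d mod 5 = s then 1 else 0)"
proof -
  let ?D = "{m. m dvd int n \<and> m mod 5 = int r}"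
  have mod: "k mod 5 = t \<longleftrightarrow> int k mod 5 = int t" for k t :: nat
    by (metis of_nat_eq_iff of_nat_mod of_nat_numeral)
  have fin: "finite ?D" using n by (rule finite_int_divisors)
  have pos: "m > 0 \<or> m < 0" if "m \<in> ?D" for m
  proof -
    have "m \<noteq> 0" using that n by auto
    thus ?thesis by linarith
  qed
  have "?D = {m\<in>?D. m > 0} \<union> {m\<in>?D. m < 0}" using pos by blast
  hence "signed_divisors r n = sum sgn ({m\<in>?D. m > 0} \<union> {m\<in>?D. m < 0})"
    unfolding signed_divisors_def by (rule arg_cong)
  also have "\<dots> = (\<Sum>m\<in>{m\<in>?D. m > 0}. sgn m) + (\<Sum>m\<in>{m\<in>?D. m < 0}. sgn m)"
  proof (rule sum.union_disjoint)
    show "finite {m\<in>?D. m > 0}" "finite {m\<in>?D. m < 0}"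
      by (rule finite_subset[OF _ fin], blast)+
  qed auto
  also have "(\<Sum>m\<in>{m\<in>?D. m > 0}. sgn m) = (\<Sum>d | d dvd n \<and> d mod 5 = r. 1)"
  proof (rule sum.reindex_bij_witness[of _ int nat])
    show "nat m \<in> {d. d dvd n \<and> d mod 5 = r}" if "m \<in> {m\<in>?D. m > 0}" for m
      using that by (simp add: nat_dvd_iff mod)
    show "int d \<in> {m\<in>?D. m > 0}" if "d \<in> {d. d dvd n \<and> d mod 5 = r}" for d
    proof -
      have "d > 0" using that n by (auto intro!: Nat.gr0I)
      thus ?thesis using that mod[of d] by simp
    qed
  qed auto
  also have "(\<Sum>m\<in>{m\<in>?D. m < 0}. sgn m) = (\<Sum>d | d dvd n \<and> d mod 5 = s. - 1)"
  proof (rule sum.reindex_bij_witness[of _ "\<lambda>d. - int d" "\<lambda>m. nat (- m)"])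
    fix m assume m: "m \<in> {m\<in>?D. m < 0}"
    have "(- m) mod 5 = int s" using m rs zmod_zminus1_eq_if[of m 5] by auto
    moreover have "int (nat (- m)) = - m" using m by simp
    ultimately have "nat (- m) mod 5 = s" by (metis mod)
    moreover have "nat (- m) dvd n" using m by (simp add: nat_dvd_iff)
    ultimately show "nat (- m) \<in> {d. d dvd n \<and> d mod 5 = s}" by simp
  next
    fix d assume d: "d \<in> {d. d dvd n \<and> d mod 5 = s}"
    hence "int d mod 5 = int s" by (metis (mono_tags) mem_Collect_eq of_nat_mod of_nat_numeral)
    hence "(- int d) mod 5 = int r" using rs zmod_zminus1_eq_if[of "int d" 5] by auto
    moreover have "d > 0" using d n by (auto intro!: Nat.gr0I)
    ultimately show "- int d \<in> {m\<in>?D. m < 0}" using d by auto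
  qed auto
  finally show ?thesis using n by (simp add: sum.inter_filter [symmetric] sum_negf flip: sum.inter_filter)
qed

text \<open>The function $z^d - z^{-d}$ is odd and periodic modulo 5, hence a combination of the two
  odd indicator differences that define $X_1$ and $X_2$.\<close>

lemma divisor_gf_diff:
  assumes z: "z ^ 5 = 1"
  shows "divisor_gf z - divisor_gf (z ^ 4) =
    fps_const (z - z ^ 4) * lambert5 1 + fps_const (z ^ 2 - z ^ 3) * lambert5 2"
proof (rule fps_ext)
  fix n
  show "fps_nth (divisor_gf z - divisor_gf (z ^ 4)) n =
    fps_nth (fps_const (z - z ^ 4) * lambert5 1 + fps_const (z ^ 2 - z ^ 3) * lambert5 2) n"
  proof (cases "n = 0")
    case False
    define \<delta> where "\<delta> = (\<lambda>r d :: nat. if d mod 5 = r then 1 else 0 :: complex)"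
    have L: "of_int (signed_divisors r n) = (\<Sum>d | d dvd n. \<delta> r d - \<delta> s d)"
      if "r + s = 5" "0 < r" "0 < s" for r s
      using signed_divisors_conv_nat[OF _ that, of n] False
      by (simp add: \<delta>_def sum_subtractf if_distrib[of of_int] cong: if_cong)
    have "z ^ d - (z ^ 4) ^ d = (z - z ^ 4) * (\<delta> 1 d - \<delta> 4 d) + (z ^ 2 - z ^ 3) * (\<delta> 2 d - \<delta> 3 d)" for d
    proof -
      define r where "r = d mod 5"
      have r: "r \<in> {0, 1, 2, 3, 4}" unfolding r_def by auto
      have "(z ^ 4) ^ d = z ^ (4 * d)" by (simp only: power_mult)
      also have "\<dots> = z ^ ((4 * r) mod 5)"
        using root5_power_mod[OF z, of "4 * d"] by (simp add: r_def mod_mult_right_eq)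
      finally have "z ^ d - (z ^ 4) ^ d = z ^ r - z ^ ((4 * r) mod 5)"
        using root5_power_mod[OF z, of d] by (simp add: r_def)
      thus ?thesis using r by (auto simp: \<delta>_def r_def [symmetric] simp flip: One_nat_def)
    qed
    hence "(\<Sum>d | d dvd n. z ^ d - (z ^ 4) ^ d) =
        (z - z ^ 4) * (\<Sum>d | d dvd n. \<delta> 1 d - \<delta> 4 d) + (z ^ 2 - z ^ 3) * (\<Sum>d | d dvd n. \<delta> 2 d - \<delta> 3 d)"
      by (simp only: sum.distrib sum_distrib_left)
    thus ?thesis using False L[of 1 4] L[of 2 3]
      by (simp add: divisor_gf_def lambert5_def sum_subtractf)
  qed (simp add: divisor_gf_def lambert5_def)
qed

text \<open>The product \<open>P\<close> of the two partition series is symmetric in $z$ and $z^4$.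
  Subtracting the two evaluations therefore removes the class 0, pairs \<open>m\<close> with
  \<open>5 - m\<close>, and leaves only the odd part of the divisor series.\<close>

lemma crank_differences_root5:
  assumes z: "z ^ 5 = 1" "z \<noteq> 1"
  defines "a \<equiv> subst5 rrA" and "b \<equiv> subst5 rrB"
  shows "a * b * (fps_const (z - z ^ 4) * (NB_gf 1 - NB_gf 4) + fps_const (z ^ 2 - z ^ 3) * (NB_gf 2 - NB_gf 3)) =
    fps_const (z - z ^ 4) * (b * lambert5 1 + fps_X * a * lambert5 2) +
    fps_const (z ^ 2 - z ^ 3) * (b * lambert5 2 + fps_X * a * (lambert5 1 - lambert5 2))"
proof -
  define Z where "Z = fps_const z"
  define P where "P = size_gf z * size_gf (z ^ 4)"
  define s1 s2 where "s1 = Z - Z ^ 4" and "s2 = Z ^ 2 - Z ^ 3"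
  have s: "fps_const (z - z ^ 4) = s1" "fps_const (z ^ 2 - z ^ 3) = s2"
    by (simp_all add: s1_def s2_def Z_def fps_const_power)
  have Z5: "Z ^ 5 = 1" using z by (simp add: Z_def fps_const_power)
  have z4: "(z ^ 4) ^ 5 = 1" "(z ^ 4) ^ 4 = z"
    using z(1) root5_power_mod[OF z(1), of 20] root5_power_mod[OF z(1), of 16] by (simp_all flip: power_mult)
  have Zm: "fps_const ((z ^ 4) ^ 2) = Z ^ 3" "fps_const ((z ^ 4) ^ 3) = Z ^ 2" "fps_const (z ^ k) = Z ^ k" for k
    using root5_power_mod[OF z(1), of 8] root5_power_mod[OF z(1), of 12]
    by (simp_all add: Z_def fps_const_power flip: power_mult)
  have Zp: "Z ^ 8 = Z ^ 3" "Z ^ 12 = Z ^ 2" "Z ^ 16 = Z"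
    using root5_power_mod[OF z(1), of 8] root5_power_mod[OF z(1), of 12] root5_power_mod[OF z(1), of 16]
    by (simp_all add: Z_def fps_const_power)
  have five: "{..<5} = {0, 1, 2, 3, 4 :: nat}" by auto
  have "s1 * (NB_gf 1 - NB_gf 4) + s2 * (NB_gf 2 - NB_gf 3) =
      (\<Sum>m<5. fps_const (z ^ m) * NB_gf m) - (\<Sum>m<5. fps_const ((z ^ 4) ^ m) * NB_gf m)"
    unfolding five using Zm(3)[of 1] Zp
    by (simp add: Zm z4 s1_def s2_def algebra_simps)
  also have "\<dots> = P * (divisor_gf z - divisor_gf (z ^ 4))"
    unfolding NB_gf_root5[OF z(1)] NB_gf_root5[OF z4(1)] z4(2) by (simp add: P_def algebra_simps)
  also have "divisor_gf z - divisor_gf (z ^ 4) = s1 * lambert5 1 + s2 * lambert5 2"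
    using divisor_gf_diff[OF z(1)] by (simp add: s)
  finally have 1: "s1 * (NB_gf 1 - NB_gf 4) + s2 * (NB_gf 2 - NB_gf 3) = P * (s1 * lambert5 1 + s2 * lambert5 2)" .
  have "P * (a * b) = (size_gf z * qp z 1 1) * (size_gf (z ^ 4) * qp (z ^ 4) 1 1) * (b + (Z + Z ^ 4) * fps_X * a)"
    unfolding a_def b_def crank_product_dissection[OF z] by (simp only: P_def Z_def mult_ac)
  hence 2: "P * (a * b) = b + (Z + Z ^ 4) * fps_X * a" by (simp only: size_gf mult_1)
  \<comment> \<open>Multiplication by $z + z^4$ maps the span of \<open>s1\<close> and
    \<open>s2\<close> to itself; this produces the crosswise terms $X_2$ and $X_1 - X_2$.\<close>
  have c: "(Z + Z ^ 4) * s1 = s2" "(Z + Z ^ 4) * s2 = s1 - s2"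
  proof -
    have "(Z + Z ^ 4) * s1 = Z ^ 2 - Z ^ 5 * Z ^ 3" by (simp add: s1_def algebra_simps eval_nat_numeral)
    thus "(Z + Z ^ 4) * s1 = s2" using Z5 by (simp add: s2_def)
    have "(Z + Z ^ 4) * s2 = Z ^ 3 - Z ^ 4 + Z ^ 5 * Z - Z ^ 5 * Z ^ 2"
      by (simp add: s2_def algebra_simps eval_nat_numeral)
    thus "(Z + Z ^ 4) * s2 = s1 - s2" using Z5 by (simp add: s1_def s2_def)
  qed
  have "a * b * (s1 * (NB_gf 1 - NB_gf 4) + s2 * (NB_gf 2 - NB_gf 3)) =
      (P * (a * b)) * (s1 * lambert5 1 + s2 * lambert5 2)"
    unfolding 1 by (simp only: mult_ac)
  also have "\<dots> = b * (s1 * lambert5 1 + s2 * lambert5 2) +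
      fps_X * a * (((Z + Z ^ 4) * s1) * lambert5 1 + ((Z + Z ^ 4) * s2) * lambert5 2)"
    unfolding 2 by (simp add: algebra_simps)
  also have "\<dots> = s1 * (b * lambert5 1 + fps_X * a * lambert5 2) +
    s2 * (b * lambert5 2 + fps_X * a * (lambert5 1 - lambert5 2))"
    unfolding c by (simp add: algebra_simps)
  finally show ?thesis unfolding s .
qed

text \<open>Replacing $z$ by $z^2$ turns the pair \<open>(s1, s2)\<close> into
  \<open>(s2, - s1)\<close>. The two resulting equations for the defects \<open>d1\<close> and
  \<open>d2\<close> can be solved because \<open>s1 * s1 + s2 * s2\<close> is the constant
  -5.\<close>

lemma crank_differences:
  defines "a \<equiv> subst5 rrA" and "b \<equiv> subst5 rrB"
  shows "a * b * (NB_gf 1 - NB_gf 4) = b * lambert5 1 + fps_X * a * lambert5 2"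
    and "a * b * (NB_gf 2 - NB_gf 3) = b * lambert5 2 + fps_X * a * (lambert5 1 - lambert5 2)"
proof -
  obtain z :: complex where z: "z ^ 5 = 1" "z \<noteq> 1" using ex_root5 by blast
  define d1 where "d1 = a * b * (NB_gf 1 - NB_gf 4) - (b * lambert5 1 + fps_X * a * lambert5 2)"
  define d2 where "d2 = a * b * (NB_gf 2 - NB_gf 3) - (b * lambert5 2 + fps_X * a * (lambert5 1 - lambert5 2))"
  define s1 s2 where "s1 = fps_const (z - z ^ 4)" and "s2 = fps_const (z ^ 2 - z ^ 3)"
  have e1: "s1 * d1 + s2 * d2 = 0"
    using crank_differences_root5[OF z] by (simp add: d1_def d2_def s1_def s2_def a_def b_def algebra_simps)
  have p: "(z ^ 2) ^ 4 = z ^ 3" "(z ^ 2) ^ 2 = z ^ 4" "(z ^ 2) ^ 3 = z"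
    using root5_power_mod[OF z(1), of 8] root5_power_mod[OF z(1), of 6] by (simp_all flip: power_mult)
  have "fps_const (z ^ 4 - z) = - s1" by (simp add: s1_def)
  hence e2: "s2 * d1 - s1 * d2 = 0"
    using crank_differences_root5[OF root5_square(1,2)[OF z]] unfolding p
    by (simp add: d1_def d2_def s2_def [symmetric] a_def b_def algebra_simps)
  have "(z - z ^ 4) ^ 2 + (z ^ 2 - z ^ 3) ^ 2 = -5"
  proof -
    have "(z - z ^ 4) ^ 2 + (z ^ 2 - z ^ 3) ^ 2 = z ^ 2 + z ^ 8 + z ^ 4 + z ^ 6 - 4 * z ^ 5"
      by (simp add: algebra_simps eval_nat_numeral)
    also have "\<dots> = (1 + z + z ^ 2 + z ^ 3 + z ^ 4) - 5"
      using z(1) root5_power_mod[OF z(1), of 8] root5_power_mod[OF z(1), of 6] by simp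
    finally show ?thesis using root5_sum[OF z] by simp
  qed
  hence s: "s1 * s1 + s2 * s2 = fps_const (-5)"
    by (simp add: s1_def s2_def power2_eq_square)
  have "fps_const (-5) * d1 = s1 * (s1 * d1 + s2 * d2) + s2 * (s2 * d1 - s1 * d2)"
    unfolding s [symmetric] by (simp add: algebra_simps)
  hence "d1 = 0" unfolding e1 e2 by simp
  moreover have "fps_const (-5) * d2 = s2 * (s1 * d1 + s2 * d2) - s1 * (s2 * d1 - s1 * d2)"
    unfolding s [symmetric] by (simp add: algebra_simps)
  hence "d2 = 0" unfolding e1 e2 by simp
  ultimately show "a * b * (NB_gf 1 - NB_gf 4) = b * lambert5 1 + fps_X * a * lambert5 2"
    "a * b * (NB_gf 2 - NB_gf 3) = b * lambert5 2 + fps_X * a * (lambert5 1 - lambert5 2)"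
    by (simp_all add: d1_def d2_def)
qed

section \<open>The sections of the crank differences\<close>

lemma rr_inverse: "rrA * inverse rrA = 1" "rrB * inverse rrB = 1"
  by (simp_all add: inverse_mult_eq_1')

lemma section5_diff: "section5 r (f - g) = section5 r f - section5 r g"
  and section5_add: "section5 r (f + g) = section5 r f + section5 r g"
  and section5_cmult: "section5 r (numeral k * f) = numeral k * section5 r f"
  by (simp_all add: fps_eq_iff numeral_fps_const)

lemma crank_difference_sections:
  defines "D1 \<equiv> NB_gf 1 - NB_gf 4" and "D2 \<equiv> NB_gf 2 - NB_gf 3"
    and "u \<equiv> inverse rrA" and "v \<equiv> inverse rrB"
  shows "section5 0 D1 = lambert5 1 * u + fps_X * (euler5 ^ 2 * rrA * v ^ 3)"
    "section5 2 D1 = euler5 ^ 2 * u ^ 2"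
    "section5 3 D1 = 2 * (euler5 ^ 2 * u * v)"
    "section5 4 D1 = - (euler5 ^ 2 * v ^ 2)"
    "section5 0 D2 = lambert5 2 * u - fps_X * (euler5 ^ 2 * rrA * v ^ 3)"
    "section5 2 D2 = 2 * (euler5 ^ 2 * u ^ 2)"
    "section5 3 D2 = - (euler5 ^ 2 * u * v)"
    "section5 4 D2 = 3 * (euler5 ^ 2 * v ^ 2)"
proof -
  define a b where "a = subst5 rrA" and "b = subst5 rrB"
  define U V W where "U = subst5 u" and "V = subst5 v" and "W = subst5 (euler5 ^ 2)"
  define x1 x2 where "x1 = subst5 (lambert5 1)" and "x2 = subst5 (lambert5 2)"
  have aU: "a * U = 1" "b * V = 1"
    using arg_cong[OF rr_inverse(1), of subst5] arg_cong[OF rr_inverse(2), of subst5]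
    by (simp_all add: a_def b_def U_def V_def u_def v_def subst5_mult)
  have uA: "rrA * u = 1" "rrB * v = 1" using rr_inverse by (simp_all add: u_def v_def)
  have L1: "lambert5 1 = x1 + fps_X * (W * b * U ^ 2) + fps_X ^ 2 * (W * U) + fps_X ^ 3 * (W * V)"
    using lambert5_dissection(1) unfolding x1_def W_def b_def U_def V_def u_def v_def
    by (simp only: subst5_mult subst5_power)
  have L2: "lambert5 2 = x2 + fps_X ^ 2 * (W * U) - fps_X ^ 3 * (W * V) + fps_X ^ 4 * (W * a * V ^ 2)"
    using lambert5_dissection(2) unfolding x2_def W_def a_def U_def V_def u_def v_def
    by (simp only: subst5_mult subst5_power)
  have "D1 = (a * U) * (b * V) * D1" "D2 = (a * U) * (b * V) * D2" by (simp_all add: aU)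
  hence "D1 = U * V * (a * b * D1)" "D2 = U * V * (a * b * D2)" by (simp_all only: mult_ac)
  hence "D1 = U * V * (b * lambert5 1 + fps_X * a * lambert5 2)"
    "D2 = U * V * (b * lambert5 2 + fps_X * a * (lambert5 1 - lambert5 2))"
    using crank_differences by (simp_all only: D1_def D2_def a_def b_def)
  hence "D1 = (b * V) * U * lambert5 1 + (a * U) * V * (fps_X * lambert5 2)"
    "D2 = (b * V) * U * lambert5 2 + (a * U) * V * (fps_X * (lambert5 1 - lambert5 2))"
    by (simp_all only: distrib_left mult_ac)
  hence D: "D1 = U * lambert5 1 + V * (fps_X * lambert5 2)"
    "D2 = U * lambert5 2 + V * (fps_X * (lambert5 1 - lambert5 2))"
    unfolding aU by simp_all
  have bV: "V * (W * b * U ^ 2) = W * U ^ 2"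
  proof -
    have "V * (W * b * U ^ 2) = (b * V) * (W * U ^ 2)" by (simp only: mult_ac)
    thus ?thesis by (simp add: aU)
  qed
  \<comment> \<open>The term with $q^5$ is $q$ times the part of $X_2$ at exponents $5n + 4$; it
    moves to the section 0, where it becomes the summand with the factor \<open>fps_X\<close>. The
    same term enters \<open>D2\<close> with a minus sign through $X_1 - X_2$.\<close>
  have "D1 = (U * x1 + fps_X ^ 5 * (W * a * V ^ 3)) + fps_X * (U * (W * b * U ^ 2) + V * x2)
      + fps_X ^ 2 * (W * U ^ 2) + fps_X ^ 3 * (2 * (W * U * V)) + fps_X ^ 4 * (- (W * V ^ 2))"
    unfolding D(1) L1 L2 by (simp add: algebra_simps eval_nat_numeral)
  hence D1: "D1 = subst5 (lambert5 1 * u + fps_X * (euler5 ^ 2 * rrA * v ^ 3))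
      + fps_X * subst5 (u * (euler5 ^ 2 * rrB * u ^ 2) + v * lambert5 2)
      + fps_X ^ 2 * subst5 (euler5 ^ 2 * u ^ 2) + fps_X ^ 3 * subst5 (2 * (euler5 ^ 2 * u * v))
      + fps_X ^ 4 * subst5 (- (euler5 ^ 2 * v ^ 2))"
    unfolding subst5_simps subst5_X subst5_numeral x1_def x2_def U_def V_def W_def a_def b_def
    by (simp only: mult.commute)
  have "D2 = (U * x2 - fps_X ^ 5 * (W * a * V ^ 3)) + fps_X * (V * (x1 - x2))
      + fps_X ^ 2 * (W * U ^ 2 + V * (W * b * U ^ 2)) + fps_X ^ 3 * (- (W * U * V))
      + fps_X ^ 4 * (U * (W * a * V ^ 2) + 2 * (W * V ^ 2))"
    unfolding D(2) L1 L2 by (simp add: algebra_simps eval_nat_numeral)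
  also have "U * (W * a * V ^ 2) = W * V ^ 2"
  proof -
    have "U * (W * a * V ^ 2) = (a * U) * (W * V ^ 2)" by (simp only: mult_ac)
    thus ?thesis by (simp add: aU)
  qed
  also note bV
  finally have D2: "D2 = subst5 (lambert5 2 * u - fps_X * (euler5 ^ 2 * rrA * v ^ 3))
      + fps_X * subst5 (v * (lambert5 1 - lambert5 2))
      + fps_X ^ 2 * subst5 (2 * (euler5 ^ 2 * u ^ 2)) + fps_X ^ 3 * subst5 (- (euler5 ^ 2 * u * v))
      + fps_X ^ 4 * subst5 (3 * (euler5 ^ 2 * v ^ 2))"
    unfolding subst5_simps subst5_X subst5_numeral x1_def x2_def U_def V_def W_def a_def b_def
    by (simp add: algebra_simps)
  show "section5 0 D1 = lambert5 1 * u + fps_X * (euler5 ^ 2 * rrA * v ^ 3)"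
    "section5 2 D1 = euler5 ^ 2 * u ^ 2"
    "section5 3 D1 = 2 * (euler5 ^ 2 * u * v)"
    "section5 4 D1 = - (euler5 ^ 2 * v ^ 2)"
    using section5_dissection[OF D1] by simp_all
  show "section5 0 D2 = lambert5 2 * u - fps_X * (euler5 ^ 2 * rrA * v ^ 3)"
    "section5 2 D2 = 2 * (euler5 ^ 2 * u ^ 2)"
    "section5 3 D2 = - (euler5 ^ 2 * u * v)"
    "section5 4 D2 = 3 * (euler5 ^ 2 * v ^ 2)"
    using section5_dissection[OF D2] by simp_all
qed

text \<open>As $E_1 = A B E_5$, the series is $E_5^3/E_1$. Its numerator is $E_1^3$ at $q^5$ and
  passes through the section, so what remains is Ramanujan's generating function $5 E_5^5/E_1^6$ of
  $p(5n+4)$. The factor 5 is the middle coefficient of the cofactor of degree 8.\<close>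

lemma section5_euler_quotient:
  "section5 4 (euler5 ^ 2 * inverse rrA * inverse rrB) = 5 * (euler5 ^ 5 * inverse (qp 1 1 1) ^ 3)"
proof -
  define a b where "a = subst5 rrA" and "b = subst5 rrB"
  define E1 where "E1 = qp 1 1 1"
  define H where "H = E1 ^ 3 * inverse (euler5 * (rrA * rrB) ^ 10)"
  have E1: "E1 = rrA * rrB * euler5" unfolding E1_def by (rule euler_product_dissection)
  have nz: "rrA \<noteq> 0" "rrB \<noteq> 0" "euler5 \<noteq> 0"
    using qp_nonzero rr_nth_0 by (metis fps_zero_nth zero_neq_one, metis fps_zero_nth zero_neq_one, simp)
  let ?M = "b^8 + fps_X * b^7 * a + 2 * fps_X^2 * b^6 * a^2 + 3 * fps_X^3 * b^5 * a^3
      + 5 * fps_X^4 * b^4 * a^4 - 3 * fps_X^5 * b^3 * a^5 + 2 * fps_X^6 * b^2 * a^6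
      - fps_X^7 * b * a^7 + fps_X^8 * a^8"
  define N where "N = subst5 (euler5 * (rrA * rrB) ^ 10)"
  have N: "E1 * ?M = N" unfolding E1_def a_def b_def N_def inverse_euler_product_dissection
    by (simp only: subst5_mult subst5_power)
  have N1: "N * subst5 (inverse (euler5 * (rrA * rrB) ^ 10)) = 1"
  proof -
    have "(euler5 * (rrA * rrB) ^ 10) * inverse (euler5 * (rrA * rrB) ^ 10) = 1"
      by (rule inverse_mult_eq_1') simp
    hence "subst5 ((euler5 * (rrA * rrB) ^ 10) * inverse (euler5 * (rrA * rrB) ^ 10)) = 1" by simp
    thus ?thesis by (simp only: subst5_mult [of "euler5 * _"] N_def)
  qed
  have EE: "euler5 = subst5 E1" by (simp only: E1_def subst5_products)
  have "E1 * (subst5 H * ?M) = subst5 (E1 ^ 3) * (N * subst5 (inverse (euler5 * (rrA * rrB) ^ 10)))"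
    unfolding N [symmetric] H_def subst5_mult[of "E1 ^ 3"] by (simp only: mult_ac)
  also have "\<dots> = euler5 ^ 3" unfolding N1 subst5_power EE [symmetric] by simp
  also have "\<dots> = E1 * (euler5 ^ 2 * inverse rrA * inverse rrB)"
  proof -
    have "E1 * (euler5 ^ 2 * inverse rrA * inverse rrB) = (rrA * inverse rrA) * (rrB * inverse rrB) * euler5 ^ 3"
      unfolding E1 by (simp add: eval_nat_numeral mult_ac)
    thus ?thesis by (simp add: rr_inverse)
  qed
  finally have "subst5 H * ?M = euler5 ^ 2 * inverse rrA * inverse rrB"
    using nz unfolding E1 by simp
  \<comment> \<open>The monomials of \<open>?M\<close> with $q^5$ to $q^8$ join the residues 0 to 3
    and leave a factor \<open>fps_X\<close> inside \<open>subst5\<close>; residue 4 receives a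
    single monomial.\<close>
  moreover have "subst5 H * ?M = subst5 (H * (rrB^8 - 3 * (fps_X * rrB^3 * rrA^5)))
      + fps_X * subst5 (H * (rrB^7 * rrA + 2 * (fps_X * rrB^2 * rrA^6)))
      + fps_X^2 * subst5 (H * (2 * (rrB^6 * rrA^2) - fps_X * rrB * rrA^7))
      + fps_X^3 * subst5 (H * (3 * (rrB^5 * rrA^3) + fps_X * rrA^8))
      + fps_X^4 * subst5 (H * (5 * (rrB^4 * rrA^4)))"
    unfolding subst5_simps subst5_X subst5_numeral a_def [symmetric] b_def [symmetric]
    by (simp add: algebra_simps eval_nat_numeral)
  ultimately have "section5 4 (euler5 ^ 2 * inverse rrA * inverse rrB) = H * (5 * (rrB^4 * rrA^4))"
    using section5_dissection(5) by metis
  also have "\<dots> = 5 * (euler5 ^ 5 * inverse E1 ^ 3)"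
  proof -
    have "fps_to_fls (H * (5 * (rrB^4 * rrA^4))) = fps_to_fls (5 * (euler5 ^ 5 * inverse E1 ^ 3))"
      unfolding H_def E1 using nz
      by (simp add: fls_times_fps_to_fls fps_to_fls_power fps_to_fls_inverse divide_simps)
        (simp add: eval_nat_numeral mult_ac)
    thus ?thesis by simp
  qed
  finally show ?thesis by (simp only: E1_def)
qed

section \<open>The six identities\<close>

theorem theorem1p1:
  fixes A B E1 E5 :: "complex fps"
  assumes A: "A = qpochs_inf [fps_X, fps_X ^ 4] (fps_X ^ 5)"
    and B: "B = qpochs_inf [fps_X ^ 2, fps_X ^ 3] (fps_X ^ 5)"
    and E1: "E1 = qpoch_inf fps_X fps_X"
    and E5: "E5 = qpoch_inf (fps_X ^ 5) (fps_X ^ 5)"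
  shows
    "Abs_fps (\<lambda>n. of_nat (NB 2 1 5 (5*n)) - 3 * of_nat (NB 2 2 5 (5*n))
                + 3 * of_nat (NB 2 3 5 (5*n)) - of_nat (NB 2 4 5 (5*n)))
       = 5 * fps_X * (A * E5 ^ 2 / B ^ 3) \<and>
     Abs_fps (\<lambda>n. of_nat (NB 2 1 5 (5*n+2)) + 2 * of_nat (NB 2 2 5 (5*n+2))
                - 2 * of_nat (NB 2 3 5 (5*n+2)) - of_nat (NB 2 4 5 (5*n+2)))
       = 5 * (E5 ^ 2 / A ^ 2) \<and>
     (\<forall>n. int (NB 2 1 5 (5*n+3)) + 2 * int (NB 2 2 5 (5*n+3))
          - 2 * int (NB 2 3 5 (5*n+3)) - int (NB 2 4 5 (5*n+3)) = 0) \<and>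
     Abs_fps (\<lambda>n. of_nat (NB 2 1 5 (25*n+23)) - of_nat (NB 2 4 5 (25*n+23)))
       = 10 * (E5 ^ 5 / E1 ^ 3) \<and>
     Abs_fps (\<lambda>n. of_nat (NB 2 2 5 (25*n+23)) - of_nat (NB 2 3 5 (25*n+23)))
       = - 5 * (E5 ^ 5 / E1 ^ 3) \<and>
     Abs_fps (\<lambda>n. of_nat (NB 2 1 5 (5*n+4)) + 2 * of_nat (NB 2 2 5 (5*n+4))
                - 2 * of_nat (NB 2 3 5 (5*n+4)) - of_nat (NB 2 4 5 (5*n+4)))
       = 5 * (E5 ^ 2 / B ^ 2)"
proof -
  have A': "A = rrA" unfolding A rrA_def qpochs_inf_def qp_def by simp
  have B': "B = rrB" unfolding B rrB_def qpochs_inf_def qp_def by simp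
  have E1': "E1 = qp 1 1 1" unfolding E1 qp_def by simp
  have E5': "E5 = qp 1 5 5" unfolding E5 qp_def by simp
  define D1 D2 where "D1 = NB_gf 1 - NB_gf 4" and "D2 = NB_gf 2 - NB_gf 3"
  note D_sections = crank_difference_sections [folded D1_def D2_def A' B' E5']
  have div: "f / g ^ k = f * inverse g ^ k" if "fps_nth g 0 = 1" for f g :: "complex fps" and k
    using that by (simp add: fps_divide_unit fps_inverse_power)
  have A0: "fps_nth A 0 = 1" and B0: "fps_nth B 0 = 1" and E10: "fps_nth E1 0 = 1"
    by (simp_all add: A' B' E1')
  have AA: "A * inverse A = 1" using A' rr_inverse by simp
  have triple: "lambert5 1 - 3 * lambert5 2 = fps_X * (A ^ 2 * E5 ^ 2 * inverse B ^ 3)"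
    using lambert_triple_quotient by (simp only: A' B' E5' rrA_def rrB_def)
  \<comment> \<open>The explicit summands of the two sections have opposite signs, so the weights 1
    and -3 collect four copies; the triple quotient divided by \<open>A\<close> is the
    fifth.\<close>
  have "section5 0 (D1 - 3 * D2) =
      (lambert5 1 - 3 * lambert5 2) * inverse A + 4 * (fps_X * (E5 ^ 2 * A * inverse B ^ 3))"
    unfolding section5_diff section5_cmult D_sections by (simp add: algebra_simps)
  also have "\<dots> = (A * inverse A) * (fps_X * (A * E5 ^ 2 * inverse B ^ 3)) + 4 * (fps_X * (E5 ^ 2 * A * inverse B ^ 3))"
    unfolding triple by (simp only: power2_eq_square mult_ac)
  also have "\<dots> = 5 * fps_X * (A * E5 ^ 2 / B ^ 3)"
    unfolding AA div[OF B0] by (simp add: algebra_simps)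
  finally have 1: "section5 0 (D1 - 3 * D2) = 5 * fps_X * (A * E5 ^ 2 / B ^ 3)" .
  \<comment> \<open>The weights 1 and 2 give $1 + 2 * 2 = 5$ here, $2 - 2 = 0$ at $5n + 3$ and $-1 +
    2 * 3 = 5$ at $5n + 4$.\<close>
  have 2: "section5 2 (D1 + 2 * D2) = 5 * (E5 ^ 2 / A ^ 2)"
    unfolding section5_add section5_cmult D_sections div[OF A0] by simp
  have 3: "section5 3 (D1 + 2 * D2) = 0"
    unfolding section5_add section5_cmult D_sections by simp
  have 6: "section5 4 (D1 + 2 * D2) = 5 * (E5 ^ 2 / B ^ 2)"
    unfolding section5_add section5_cmult D_sections div[OF B0] by simp
  have Q: "section5 4 (E5 ^ 2 * inverse A * inverse B) = 5 * (E5 ^ 5 / E1 ^ 3)"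
    unfolding div[OF E10] unfolding A' B' E5' E1' by (rule section5_euler_quotient)
  \<comment> \<open>The exponents $25n + 23 = 5(5n + 4) + 3$ are reached by two successive sections.
    The factors 2 and -1 of \<open>D1\<close> and \<open>D2\<close> at $5n + 3$ become 10 and
    -5.\<close>
  have 4: "section5 4 (section5 3 D1) = 10 * (E5 ^ 5 / E1 ^ 3)"
    unfolding D_sections section5_cmult Q by simp
  have neg: "section5 r (- f) = - section5 r f" for r f by (simp add: fps_eq_iff)
  have 5: "section5 4 (section5 3 D2) = - 5 * (E5 ^ 5 / E1 ^ 3)"
    unfolding D_sections neg Q by simp
  have n25: "5 * (5 * n + 4) + 3 = 25 * n + 23" for n :: nat by simp
  have g1: "Abs_fps (\<lambda>n. of_nat (NB 2 1 5 (5*n)) - 3 * of_nat (NB 2 2 5 (5*n))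
                + 3 * of_nat (NB 2 3 5 (5*n)) - of_nat (NB 2 4 5 (5*n))) = section5 0 (D1 - 3 * D2)"
    by (simp add: fps_eq_iff D1_def D2_def NB_gf_def numeral_fps_const algebra_simps)
  have g2: "Abs_fps (\<lambda>n. of_nat (NB 2 1 5 (5*n+r)) + 2 * of_nat (NB 2 2 5 (5*n+r))
                - 2 * of_nat (NB 2 3 5 (5*n+r)) - of_nat (NB 2 4 5 (5*n+r))) = section5 r (D1 + 2 * D2)" for r
    by (simp add: fps_eq_iff D1_def D2_def NB_gf_def numeral_fps_const algebra_simps)
  have g3: "Abs_fps (\<lambda>n. of_nat (NB 2 1 5 (25*n+23)) - of_nat (NB 2 4 5 (25*n+23))) = section5 4 (section5 3 D1)"
    "Abs_fps (\<lambda>n. of_nat (NB 2 2 5 (25*n+23)) - of_nat (NB 2 3 5 (25*n+23))) = section5 4 (section5 3 D2)"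
    unfolding n25 [symmetric] by (simp_all add: fps_eq_iff D1_def D2_def NB_gf_def)
  have "int (NB 2 1 5 (5*n+3)) + 2 * int (NB 2 2 5 (5*n+3))
          - 2 * int (NB 2 3 5 (5*n+3)) - int (NB 2 4 5 (5*n+3)) = 0" for n
  proof -
    have "fps_nth (section5 3 (D1 + 2 * D2)) n = 0" unfolding 3 by simp
    hence "complex_of_int (int (NB 2 1 5 (5*n+3)) + 2 * int (NB 2 2 5 (5*n+3))
          - 2 * int (NB 2 3 5 (5*n+3)) - int (NB 2 4 5 (5*n+3))) = 0"
      unfolding g2 [symmetric] by simp
    thus ?thesis unfolding of_int_eq_0_iff .
  qed
  thus ?thesis unfolding g1 g2 g3 using 1 2 4 5 6 by blast
qed

end
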